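(* Let $g\in\mathcal{M}(\mathbb{R})$ and $a>0$ be such that $\int_0^\infty|\hat g(\xi)|e^{a\xi}\,d\xi<\infty$ and $(\mathcal{L}k)(z)\ne-1$ for all $z\in\mathbb{C}$ with $\Re z\ge-a$. Then there exist $\delta>0$ and a finite constant $c_1$ such that for all initial data $\rho_{in}\in\mathcal{M}(\Gamma)$ with velocity marginal $g$, Fourier transform $u_{in}$ and $$M_{in}:=\sup_{l\in\mathbb{N}}\sup_{\xi\in\mathbb{R}}|u_{in}(l,\xi)|e^{a\xi}\le\delta,$$ the Fourier transform $u$ of the solution to the Kuramoto equation with initial data $\rho_{in}$ satisfies $$\sup_{t\in\mathbb{R}^+}\sup_{l\ge1}\sup_{\xi\in\mathbb{R}}|u(t,l,\xi)|e^{a(\xi+tl/2)}\le(1+c_1)M_{in}.$$ In particular, the order parameter $\eta(t)=u(t,1,0)$ decays as $O(e^{-at})$ as $t\to\infty$.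
   Context: $\mathbb{R}^+=[0,\infty)$, $\mathbb{N}=\{1,2,\dots\}$, $\mathbb{T}=[0,2\pi)$ is the torus, $\Gamma=\mathbb{T}\times\mathbb{R}$, and $\mathcal{M}(X)$ is the set of Borel probability measures on $X$. The coupling constant $K\ge0$ is fixed. A solution to the Kuramoto equation with initial data $\rho_{in}\in\mathcal{M}(\Gamma)$ is a family $(\rho_t)_{t\in\mathbb{R}^+}$ in $\mathcal{M}(\Gamma)$ such that $t\mapsto\int h\,d\rho_t$ is continuous for every $h\in C_b(\Gamma)$, and for all compactly supported $h\in C^1(\mathbb{R}^+\times\Gamma)$ $$0=\int_\Gamma h(0,P)\rho_{in}(dP)+\int_{\mathbb{R}^+}\int_\Gamma\big[V(t,P)\partial_\theta h(t,P)+\partial_th(t,P)\big]\rho_t(dP)\,dt,$$ where $V(t,\theta,\omega)=\omega+\frac{K}{2i}\big(\eta(t)e^{-i\theta}-\overline{\eta(t)}e^{i\theta}\big)$, $\eta(t)=\int_\Gamma e^{i\theta}\rho_t(d\theta,d\omega)$. For every $\rho_{in}$ there is a unique solution (known). The velocity marginal of $\rho_{in}$ is $g(A)=\rho_{in}(\mathbb{T}\times A)$. Fourier transforms: $u(t,l,\xi)=\int_\Gamma e^{il\theta}e^{i\xi\omega}\rho_t(d\theta,d\omega)$, $u_{in}(l,\xi)=\int_\Gamma e^{il\theta}e^{i\xi\omega}\rho_{in}(d\theta,d\omega)$, $\hat g(\xi)=\int_{\mathbb{R}}e^{i\xi\omega}g(d\omega)$. The kernel is $k(t)=-\frac K2\hat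 g(t)$ and $(\mathcal{L}k)(z)=\int_0^\infty k(t)e^{-tz}\,dt$ is its Laplace transform. *)

theory Defs
  imports "HOL-Probability.Probability" "HOL-Library.Landau_Symbols"
begin

text \<open>
  The torus is represented by its fundamental domain \<open>[0, 2\<pi>)\<close>. The Borel sets of the torus are
  exactly the Borel sets of this interval, but its topology is not the one inherited from the real
  line: continuous or differentiable functions on phase space are therefore taken to be functions
  on \<open>\<real> \<times> \<real>\<close> that are \<open>2\<pi>\<close>-periodic in the first argument.
  The probability measures on phase space are the elements of
  \<open>space (prob_algebra phase_space)\<close>.
\<close>

definition phase_space :: "(real \<times> real) measure" where
  "phase_space = restrict_space borel ({0..<2 * pi} \<times> UNIV)"

definition theta_periodic :: "(real \<times> real \<Rightarrow> complex) \<Rightarrow> bool" where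
  "theta_periodic f \<longleftrightarrow> (\<forall>\<theta> \<omega>. f (\<theta> + 2 * pi, \<omega>) = f (\<theta>, \<omega>))"

definition phase_Cb :: "(real \<times> real \<Rightarrow> complex) set" where
  "phase_Cb = {f. theta_periodic f \<and> continuous_on UNIV f \<and> bounded (range f)}"

definition partial_t :: "(real \<Rightarrow> real \<times> real \<Rightarrow> complex) \<Rightarrow> real \<Rightarrow> real \<times> real \<Rightarrow> complex" where
  "partial_t h t P = vector_derivative (\<lambda>s. h s P) (at t within {0..})"

definition partial_theta :: "(real \<Rightarrow> real \<times> real \<Rightarrow> complex) \<Rightarrow> real \<Rightarrow> real \<times> real \<Rightarrow> complex" where
  "partial_theta h t P = vector_derivative (\<lambda>\<theta>. h t (\<theta>, snd P)) (at (fst P))"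

definition partial_omega :: "(real \<Rightarrow> real \<times> real \<Rightarrow> complex) \<Rightarrow> real \<Rightarrow> real \<times> real \<Rightarrow> complex" where
  "partial_omega h t P = vector_derivative (\<lambda>\<omega>. h t (fst P, \<omega>)) (at (snd P))"

text \<open>
  Compactly supported \<open>C\<^sup>1\<close> functions on \<open>[0, \<infinity>) \<times> phase space\<close>: all first-order partial derivatives
  exist (one-sided in time at \<open>t = 0\<close>) and are jointly continuous. As the torus is compact, compact
  support only restricts \<open>t\<close> and \<open>\<omega>\<close>. Values at negative times are irrelevant.
\<close>

definition test_functions :: "(real \<Rightarrow> real \<times> real \<Rightarrow> complex) set" where
  "test_functions = {h.
     (\<forall>t\<ge>0. theta_periodic (h t)) \<and>
     (\<forall>t\<ge>0. \<forall>\<theta> \<omega>.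
        (\<lambda>s. h s (\<theta>, \<omega>)) differentiable (at t within {0..}) \<and>
        (\<lambda>x. h t (x, \<omega>)) differentiable (at \<theta>) \<and>
        (\<lambda>w. h t (\<theta>, w)) differentiable (at \<omega>)) \<and>
     continuous_on ({0..} \<times> UNIV) (\<lambda>(t, P). partial_t h t P) \<and>
     continuous_on ({0..} \<times> UNIV) (\<lambda>(t, P). partial_theta h t P) \<and>
     continuous_on ({0..} \<times> UNIV) (\<lambda>(t, P). partial_omega h t P) \<and>
     (\<exists>R. \<forall>t\<ge>0. \<forall>\<theta> \<omega>. h t (\<theta>, \<omega>) \<noteq> 0 \<longrightarrow> t \<le> R \<and> \<bar>\<omega>\<bar> \<le> R)}"

definition order_parameter :: "(real \<times> real) measure \<Rightarrow> complex" where
  "order_parameter \<mu> = (CLINT P|\<mu>. iexp (fst P))"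

definition velocity :: "real \<Rightarrow> (real \<times> real) measure \<Rightarrow> real \<times> real \<Rightarrow> complex" where
  "velocity K \<mu> P =
     of_real (snd P) + of_real K / (2 * \<i>) *
       (order_parameter \<mu> * iexp (- fst P) - cnj (order_parameter \<mu>) * iexp (fst P))"

definition kuramoto_solution ::
    "real \<Rightarrow> (real \<times> real) measure \<Rightarrow> (real \<Rightarrow> (real \<times> real) measure) \<Rightarrow> bool" where
  "kuramoto_solution K \<rho>_in \<rho> \<longleftrightarrow>
     (\<forall>t\<ge>0. \<rho> t \<in> space (prob_algebra phase_space)) \<and>
     (\<forall>f\<in>phase_Cb. continuous_on {0..} (\<lambda>t. CLINT P|\<rho> t. f P)) \<and>
     (\<forall>h\<in>test_functions.
        0 = (CLINT P|\<rho>_in. h 0 P) +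
            (CLINT t:{0..}|lborel.
               (CLINT P|\<rho> t. velocity K (\<rho> t) P * partial_theta h t P + partial_t h t P)))"

definition fourier :: "(real \<times> real) measure \<Rightarrow> int \<Rightarrow> real \<Rightarrow> complex" where
  "fourier \<mu> l \<xi> = (CLINT P|\<mu>. iexp (of_int l * fst P) * iexp (\<xi> * snd P))"

lemma order_parameter_eq_fourier: "order_parameter \<mu> = fourier \<mu> 1 0"
  by (simp add: order_parameter_def fourier_def)

text \<open>The Fourier transform of a measure on the real line is the library's \<open>char\<close>.\<close>

definition kuramoto_kernel :: "real \<Rightarrow> real measure \<Rightarrow> real \<Rightarrow> complex" where
  "kuramoto_kernel K g t = - (of_real K / 2) * char g t"

definition laplace_transform :: "(real \<Rightarrow> complex) \<Rightarrow> complex \<Rightarrow> complex" where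
  "laplace_transform k z = (CLINT t:{0..}|lborel. k t * exp (- (of_real t * z)))"

definition initial_norm :: "real \<Rightarrow> (real \<times> real) measure \<Rightarrow> ereal" where
  "initial_norm a \<mu> = (SUP l\<in>{1..}. SUP \<xi>. ereal (cmod (fourier \<mu> l \<xi>) * exp (a * \<xi>)))"

end

theory Submission
  imports Defs "HOL-Complex_Analysis.Complex_Analysis"
begin

text \<open>
  Write \<open>u(t, l, \<xi>)\<close> for the Fourier transform of the solution and \<open>\<eta>(t) = u(t, 1, 0)\<close>. Testing the weak
  equation with plane waves that are carried along by free transport gives, for every integer \<open>l\<close>,
  the Duhamel formula

  \<open>u(t, l, \<xi>) = u\<^sub>0(l, \<xi> + l t) + (K l / 2) \<integral>\<^sub>0\<^sup>t (\<eta>(s) u(s, l - 1, \<xi> + l (t - s)) - cnj \<eta>(s) u(s, l + 1, \<xi> + l (t - s))) ds\<close>,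

  where \<open>u(t, 0, \<cdot>)\<close> is the characteristic function of the velocity distribution at all times
  (\<open>kuramoto_duhamel\<close>, \<open>fourier_zero_mode\<close>). The estimate is a bootstrap on the single scalar quantity
  \<open>\<eta>\<close>: as long as \<open>\<bar>\<eta>(s)\<bar> \<le> E exp (- a s)\<close> with a small \<open>E\<close>, two things happen.

  First, all modes \<open>l \<ge> 1\<close> satisfy \<open>\<bar>u(t, l, \<xi>)\<bar> \<le> m exp (- a (\<xi> + t l / 2))\<close> with \<open>m\<close> linear in the size of
  the data and in \<open>E\<close> (\<open>weighted_bound\<close>). The weight grows along the characteristics at the rate
  \<open>a l / 2\<close>, and the resulting factor \<open>1 / (a l)\<close> compensates the unbounded factor \<open>l\<close> of the coupling.
  There is no a priori reason for the weighted supremum to be finite, so the bound is obtained by comparison: the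
  right-hand side is a supersolution of the Duhamel inequality, \<open>exp (l a t / 4)\<close> is contracted by a factor
  \<open>1/2\<close>, and \<open>\<bar>u\<bar> \<le> 1\<close> starts the induction (\<open>comparison\<close>).

  Second, the equation for \<open>l = 1\<close> and \<open>\<xi> = 0\<close> is a Volterra equation \<open>\<eta> + k * \<eta> = F\<close> in which \<open>F\<close> consists of the
  data and of a term that is quadratic in the solution, because \<open>u(s, 2, t - s)\<close> is already of size
  \<open>m exp (- a t)\<close>. If the Volterra equation loses only a constant in the norm weighted by \<open>exp (a t)\<close>, then the bound on
  \<open>\<eta>\<close> improves from \<open>E\<close> to \<open>E / 2\<close> (\<open>order_bound_step\<close>), and continuity of \<open>\<eta>\<close> lets the bound
  persist for all times (\<open>order_decay\<close>).

  The remaining point, \<open>volterra_stability\<close>, is the half-line theorem of Paley and Wiener: an integrable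
  causal kernel whose Laplace transform omits the value \<open>-1\<close> on the closed right half-plane has a bounded
  solution operator. The weight \<open>exp (a t)\<close> shifts the half-plane \<open>Re z \<ge> - a\<close> to \<open>Re z \<ge> 0\<close>.
  The proof follows Newman's proof of Wiener's lemma. The kernel is approximated in \<open>L\<^sup>1\<close> by an exponential
  sum, whose Laplace transform is rational. In the coordinate \<open>x = 1 / (z + 1)\<close> the closed half-plane
  with its point at infinity is the disc with centre and radius \<open>1/2\<close>, and the symbol of the approximation stays
  away from zero on a slightly larger disc. The powers \<open>(1 + k\<^sub>0)\<^sup>-\<^sup>n\<close> then have kernels given
  by contour integrals over the boundary of the larger disc, which yields the geometric bound
  (\<open>circle_power_recursion\<close>) that beats the powers of the approximation error (\<open>newman_iteration\<close>).
\<close>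

section \<open>Convolution with integrable causal kernels\<close>

definition bounded_borel :: "(real \<Rightarrow> complex) \<Rightarrow> bool" where
  "bounded_borel f \<longleftrightarrow> f \<in> borel_measurable borel \<and> bounded (range f)"

definition causal_kernel :: "(real \<Rightarrow> complex) \<Rightarrow> bool" where
  "causal_kernel K \<longleftrightarrow> integrable lborel K \<and> (\<forall>t<0. K t = 0)"

text \<open>
  Kernels are functions on the whole line that vanish on the negative half-line, so that the Volterra
  convolution is an ordinary convolution and Fubini's theorem on the plane gives its algebra.
\<close>

definition conv :: "(real \<Rightarrow> complex) \<Rightarrow> (real \<Rightarrow> complex) \<Rightarrow> real \<Rightarrow> complex" where
  "conv K f t = (CLINT s|lborel. K s * f (t - s))"

abbreviation L1_norm :: "(real \<Rightarrow> complex) \<Rightarrow> real" where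
  "L1_norm K \<equiv> (LINT t|lborel. cmod (K t))"

lemma L1_norm_nonneg: "0 \<le> L1_norm K"
  by (rule integral_nonneg_AE) auto

lemma conv_integrable:
  assumes "integrable lborel K" "bounded_borel f"
  shows "integrable lborel (\<lambda>s. K s * f (t - s))"
proof -
  obtain B where B: "\<And>x. cmod (f x) \<le> B"
    using assms(2) by (auto simp: bounded_borel_def bounded_iff)
  have [measurable]: "f \<in> borel_measurable borel" "K \<in> borel_measurable borel"
    using assms by (auto simp: bounded_borel_def dest: borel_measurable_integrable)
  show ?thesis
  proof (rule Bochner_Integration.integrable_bound)
    show "integrable lborel (\<lambda>s. B * cmod (K s))"
      using assms(1) by simp
    have "cmod (K s * f (t - s)) \<le> \<bar>B * cmod (K s)\<bar>" for s
      using mult_right_mono[OF B, of "cmod (K s)" "t - s"] by (simp add: norm_mult mult.commute)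
    then show "AE s in lborel. norm (K s * f (t - s)) \<le> norm (B * cmod (K s))"
      by simp
  qed measurable
qed

lemma conv_bounded_borel:
  assumes "integrable lborel K" "bounded_borel f"
  shows "bounded_borel (conv K f)"
proof -
  obtain B where B: "\<And>x. cmod (f x) \<le> B"
    using assms(2) by (auto simp: bounded_borel_def bounded_iff)
  have [measurable]: "f \<in> borel_measurable borel" "K \<in> borel_measurable borel"
    using assms by (auto simp: bounded_borel_def dest: borel_measurable_integrable)
  have "conv K f \<in> borel_measurable borel"
    unfolding conv_def by measurable
  moreover have "cmod (conv K f t) \<le> (LINT s|lborel. cmod (K s) * B)" for t
    unfolding conv_def
    by (intro order_trans[OF integral_norm_bound] integral_mono integrable_norm conv_integrable assms)
       (use assms(1) B in \<open>auto simp: norm_mult intro!: mult_left_mono\<close>)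
  ultimately show ?thesis
    by (auto simp: bounded_borel_def bounded_iff)
qed

text \<open>
  Causality makes the estimate local in time: only the past of \<open>t\<close> enters. This is what produces bounds on
  \<open>[0, T]\<close> whose constants do not depend on \<open>T\<close>.
\<close>

lemma conv_norm_le:
  assumes "causal_kernel K" "bounded_borel f" "\<And>s. s \<le> t \<Longrightarrow> cmod (f s) \<le> B"
  shows "cmod (conv K f t) \<le> L1_norm K * B"
proof -
  have "cmod (conv K f t) \<le> (LINT s|lborel. cmod (K s) * B)"
    unfolding conv_def
  proof (intro order_trans[OF integral_norm_bound] integral_mono integrable_norm conv_integrable)
    fix s show "norm (K s * f (t - s)) \<le> cmod (K s) * B"
      using assms by (cases "s < 0") (auto simp: norm_mult causal_kernel_def intro!: mult_left_mono)
  qed (use assms in \<open>auto simp: causal_kernel_def\<close>)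
  then show ?thesis by simp
qed

lemma conv_add:
  assumes "integrable lborel K" "bounded_borel f" "bounded_borel g"
  shows "conv K (\<lambda>t. f t + g t) t = conv K f t + conv K g t"
  unfolding conv_def distrib_left
  by (intro Bochner_Integration.integral_add conv_integrable assms)

lemma conv_uminus: "conv K (\<lambda>t. - f t) t = - conv K f t"
  by (simp add: conv_def)

lemma conv_kernel_add:
  assumes "integrable lborel K" "integrable lborel H" "bounded_borel f"
  shows "conv (\<lambda>t. K t + H t) f t = conv K f t + conv H f t"
  unfolding conv_def distrib_right
  by (intro Bochner_Integration.integral_add conv_integrable assms)

lemma conv_commute: "conv K H t = conv H K t"
  unfolding conv_def
  by (subst lborel_integral_real_affine[where c="-1" and t=t]) (auto simp: mult.commute)

lemma bounded_borel_add:
  assumes "bounded_borel f" "bounded_borel g"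
  shows "bounded_borel (\<lambda>t. f t + g t)"
  using assms by (auto simp: bounded_borel_def intro!: bounded_plus_comp)

lemma bounded_borel_uminus: "bounded_borel f \<Longrightarrow> bounded_borel (\<lambda>t. - f t)"
  by (auto simp: bounded_borel_def bounded_iff)

lemma conv_product_integrable:
  fixes K H :: "real \<Rightarrow> complex"
  assumes "integrable lborel K" "integrable lborel H"
  shows "integrable (lborel \<Otimes>\<^sub>M lborel) (\<lambda>(r, s). K s * H (r - s))"
proof -
  have [measurable]: "K \<in> borel_measurable borel" "H \<in> borel_measurable borel"
    using assms by (auto dest: borel_measurable_integrable)
  have "integrable (lborel \<Otimes>\<^sub>M lborel) (\<lambda>(s, r). K s * H (r - s))"
  proof (rule lborel_pair.Fubini_integrable)
    have *: "integrable lborel (\<lambda>r. H (r - s))" for s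
      using lborel_integrable_real_affine[OF assms(2), of 1 "-s"] by simp
    show "AE s in lborel. integrable lborel (\<lambda>r. case (s, r) of (s, r) \<Rightarrow> K s * H (r - s))"
      using * by simp
    have "(LINT r|lborel. cmod (H (r - s))) = L1_norm H" for s
      by (subst (2) lborel_integral_real_affine[where c=1 and t="-s"]) auto
    then show "integrable lborel (\<lambda>s. LINT r|lborel. norm (case (s, r) of (s, r) \<Rightarrow> K s * H (r - s)))"
      using assms(1) by (simp add: norm_mult)
  qed simp
  from lborel_pair.integrable_product_swap[OF this] show ?thesis
    by (simp add: case_prod_beta)
qed

lemma conv_assoc:
  assumes "integrable lborel K" "integrable lborel H" "bounded_borel f"
  shows "conv K (conv H f) t = conv (conv K H) f t"
proof -
  obtain B where B: "\<And>x. cmod (f x) \<le> B"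
    using assms(3) by (auto simp: bounded_borel_def bounded_iff)
  have [measurable]: "f \<in> borel_measurable borel" "K \<in> borel_measurable borel" "H \<in> borel_measurable borel"
    using assms by (auto simp: bounded_borel_def dest: borel_measurable_integrable)
  have int: "integrable (lborel \<Otimes>\<^sub>M lborel) (\<lambda>(r, s). K s * H (r - s) * f (t - r))"
  proof (rule Bochner_Integration.integrable_bound)
    show "integrable (lborel \<Otimes>\<^sub>M lborel) (\<lambda>x. B * norm (case x of (r, s) \<Rightarrow> K s * H (r - s)))"
      using conv_product_integrable[OF assms(1,2)] by simp
    have "cmod (w * f x) \<le> \<bar>B * cmod w\<bar>" for w x
      using mult_right_mono[OF B, of "cmod w" x] by (simp add: norm_mult mult.commute)
    then show "AE x in lborel \<Otimes>\<^sub>M lborel. norm (case x of (r, s) \<Rightarrow> K s * H (r - s) * f (t - r))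
            \<le> norm (B * norm (case x of (r, s) \<Rightarrow> K s * H (r - s)))"
      by (auto intro!: AE_I2)
  qed simp
  have "conv (conv K H) f t = (CLINT r|lborel. (CLINT s|lborel. K s * H (r - s) * f (t - r)))"
    by (simp add: conv_def)
  also have "\<dots> = (CLINT s|lborel. (CLINT r|lborel. K s * H (r - s) * f (t - r)))"
    by (rule lborel_pair.Fubini_integral[OF int, symmetric])
  also have "\<dots> = (CLINT s|lborel. K s * conv H f (t - s))"
  proof (rule Bochner_Integration.integral_cong)
    fix s
    have "(CLINT r|lborel. K s * H (r - s) * f (t - r)) = K s * (CLINT r|lborel. H (r - s) * f (t - r))"
      by (simp add: mult.assoc)
    also have "(CLINT r|lborel. H (r - s) * f (t - r)) = conv H f (t - s)"
      unfolding conv_def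
      by (subst lborel_integral_real_affine[where c=1 and t=s]) (auto simp: algebra_simps)
    finally show "(CLINT r|lborel. K s * H (r - s) * f (t - r)) = K s * conv H f (t - s)" .
  qed simp
  finally show ?thesis by (simp add: conv_def)
qed

lemma conv_left_commute:
  assumes "integrable lborel K" "integrable lborel H" "bounded_borel f"
  shows "conv K (conv H f) t = conv H (conv K f) t"
proof -
  have "conv K H = conv H K" by (rule ext) (rule conv_commute)
  then show ?thesis using assms by (simp add: conv_assoc)
qed

lemma conv_kernel_integrable:
  assumes "integrable lborel K" "integrable lborel H"
  shows "integrable lborel (conv K H)"
  unfolding conv_def using lborel_pair.integrable_fst'[OF conv_product_integrable[OF assms]] by simp

lemma conv_causal:
  assumes "causal_kernel K" "causal_kernel H"
  shows "causal_kernel (conv K H)"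
proof -
  have "conv K H t = 0" if "t < 0" for t
  proof -
    have "K s * H (t - s) = 0" for s
      using assms that by (cases "s < 0") (auto simp: causal_kernel_def)
    then have "(\<lambda>s. K s * H (t - s)) = (\<lambda>s. 0)" by (rule ext)
    then show ?thesis unfolding conv_def by simp
  qed
  then show ?thesis
    using assms by (auto simp: causal_kernel_def conv_kernel_integrable)
qed

section \<open>Exponential sums are dense among integrable causal kernels\<close>

lemma exp_integral:
  assumes "c > 0"
  shows "set_integrable lborel {0..} (\<lambda>t. exp (- (c * t)) :: real)"
    and "(LINT t:{0..}|lborel. exp (- (c * t))) = 1 / c"
proof -
  have hi: "((\<lambda>x. exp (- (c * x))) has_integral 1 / c) {0..}"
    using has_integral_exp_minus_to_infinity[OF assms, of 0] by simp
  have abs: "(\<lambda>x. exp (- (c * x))) absolutely_integrable_on {0..}"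
    by (rule nonnegative_absolutely_integrable_1) (use hi in \<open>auto simp: integrable_on_def\<close>)
  then show int: "set_integrable lborel {0..} (\<lambda>t. exp (- (c * t)) :: real)"
    unfolding set_integrable_def by (subst (asm) integrable_completion) auto
  show "(LINT t:{0..}|lborel. exp (- (c * t))) = 1 / c"
    using set_borel_integral_eq_integral(2)[OF int] hi by (simp add: integral_unique)
qed

definition expsum :: "nat \<Rightarrow> (nat \<Rightarrow> complex) \<Rightarrow> real \<Rightarrow> complex" where
  "expsum N c t = (if t < 0 then 0 else \<Sum>j<N. c j * exp (- ((of_nat j + 1) * of_real t)))"

lemma expsum_measurable [measurable]: "expsum N c \<in> borel_measurable borel"
  unfolding expsum_def by measurable

lemma complex_polynomial_approximation:
  fixes f :: "real \<Rightarrow> complex"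
  assumes "continuous_on {0..1} f" "e > 0"
  obtains N c where "\<And>x. x \<in> {0..1} \<Longrightarrow> cmod (f x - (\<Sum>j<N. c j * of_real x ^ j)) < e"
proof -
  obtain g where g: "polynomial_function g" "\<And>x. x \<in> {0..1} \<Longrightarrow> cmod (f x - g x) < e"
    using Stone_Weierstrass_polynomial_function[OF compact_Icc assms] by blast
  have "real_polynomial_function (Re \<circ> g)" "real_polynomial_function (Im \<circ> g)"
    using g(1) bounded_linear_Re bounded_linear_Im unfolding polynomial_function_def by blast+
  then obtain a n b m where a: "Re \<circ> g = (\<lambda>x. \<Sum>i\<le>n. a i * x ^ i)" 
    and b: "Im \<circ> g = (\<lambda>x. \<Sum>i\<le>m. b i * x ^ i)"
    unfolding real_polynomial_function_iff_sum by blast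
  define N where "N = Suc (max n m)"
  define c where "c = (\<lambda>j. of_real (if j \<le> n then a j else 0) + \<i> * of_real (if j \<le> m then b j else 0) :: complex)"
  have "g x = (\<Sum>j<N. c j * of_real x ^ j)" for x
  proof (rule complex_eqI)
    have pad: "(\<Sum>i\<le>k. d i * x ^ i) = (\<Sum>j<N. (if j \<le> k then d j else 0) * x ^ j)" 
      if "k \<le> max n m" for k and d :: "nat \<Rightarrow> real"
      by (rule sum.mono_neutral_cong_left) (use that in \<open>auto simp: N_def\<close>)
    have re: "Re (c j * of_real x ^ j) = (if j \<le> n then a j else 0) * x ^ j" 
     and im: "Im (c j * of_real x ^ j) = (if j \<le> m then b j else 0) * x ^ j" for j
      by (simp_all add: c_def flip: of_real_power)
    show "Re (g x) = Re (\<Sum>j<N. c j * of_real x ^ j)"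
      unfolding Re_sum re using fun_cong[OF a, of x] pad[of n a] by simp
    show "Im (g x) = Im (\<Sum>j<N. c j * of_real x ^ j)"
      unfolding Im_sum im using fun_cong[OF b, of x] pad[of m b] by simp
  qed
  with g(2) show ?thesis by (intro that[of c N]) simp
qed

lemma L1_tail:
  fixes K :: "real \<Rightarrow> complex"
  assumes "integrable lborel K" "e > 0"
  obtains T where "T > 0" "(LINT t|lborel. indicator {T..} t * cmod (K t)) < e"
proof -
  have [measurable]: "K \<in> borel_measurable borel"
    using borel_measurable_integrable[OF assms(1)] by simp
  have "(\<lambda>n. LINT t|lborel. indicator {real n..} t * cmod (K t)) \<longlonglongrightarrow> (LINT t|(lborel :: real measure). 0 :: real)"
  proof (rule integral_dominated_convergence)
    show "integrable lborel (\<lambda>t. cmod (K t))" using assms by simp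
    show "AE t in lborel. (\<lambda>n. indicator {real n..} t * cmod (K t)) \<longlonglongrightarrow> 0"
    proof (rule AE_I2)
      fix t :: real
      have "eventually (\<lambda>n. real n > t) sequentially"
        by (rule filterlim_real_sequentially[THEN filterlim_at_top_dense[THEN iffD1], rule_format])
      then have "eventually (\<lambda>n. indicator {real n..} t * cmod (K t) = 0) sequentially"
        by eventually_elim auto
      then show "(\<lambda>n. indicator {real n..} t * cmod (K t)) \<longlonglongrightarrow> 0"
        by (rule tendsto_eventually)
    qed
    show "AE t in lborel. norm (indicator {real n..} t * cmod (K t)) \<le> cmod (K t)" for n
      by (rule AE_I2) (auto simp: indicator_def)
  qed auto
  then have "eventually (\<lambda>n. (LINT t|lborel. indicator {real n..} t * cmod (K t)) < e) sequentially"
    using assms(2) by (auto dest: order_tendstoD)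
  with eventually_gt_at_top[of 0]
  have "eventually (\<lambda>n. real n > 0 \<and> (LINT t|lborel. indicator {real n..} t * cmod (K t)) < e) sequentially"
    by eventually_elim auto
  then obtain n :: nat where "real n > 0" "(LINT t|lborel. indicator {real n..} t * cmod (K t)) < e"
    by (auto dest: eventually_happens)
  with that show ?thesis by blast
qed

text \<open>
  The substitution \<open>x = exp (- t)\<close> turns \<open>exp (- t) p (exp (- t))\<close>, for a polynomial \<open>p\<close>, into an
  exponential sum and maps the half-line to \<open>(0, 1]\<close>. After cutting off the tail of \<open>K\<close>, the Weierstrass
  theorem on \<open>[0, 1]\<close> gives a uniform approximation of \<open>exp t K(t)\<close>, and the factor \<open>exp (- t)\<close> makes
  the error integrable.
\<close>

lemma expsum_dense_L1:
  assumes "causal_kernel K" "continuous_on {0..} K" "e > 0"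
  obtains N c where "L1_norm (\<lambda>t. K t - expsum N c t) \<le> e"
proof -
  have K[simp]: "integrable lborel K" "\<And>t. t < 0 \<Longrightarrow> K t = 0"
    using assms by (auto simp: causal_kernel_def)
  have [measurable]: "K \<in> borel_measurable borel"
    using borel_measurable_integrable[OF K(1)] by simp
  obtain T where T: "T > 0" "(LINT t|lborel. indicator {T..} t * cmod (K t)) < e / 2"
    using L1_tail[OF K(1), of "e / 2"] assms(3) by auto
  define chi where "chi t = max 0 (min 1 (T + 1 - t))" for t
  define f where "f x = (if x \<le> 0 then 0 else K (- ln x) * of_real (chi (- ln x)) / of_real x)" for x
  have "continuous_on ({0..exp (-(T+1))} \<union> {exp (-(T+1))..1}) f"
  proof (rule continuous_on_closed_Un)
    have "f x = 0" if "x \<in> {0..exp (-(T+1))}" for x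
    proof (cases "x = 0")
      case False
      with that have "x > 0" by simp
      with that have "ln x \<le> -(T+1)" using ln_le_cancel_iff[of x "exp (-(T+1))"] by simp
      then show ?thesis by (simp add: f_def chi_def)
    qed (simp add: f_def)
    then show "continuous_on {0..exp (-(T+1))} f"
      by (subst continuous_on_cong[of _ _ _ "\<lambda>_. 0"]) auto
    have pos: "x > 0" if "x \<in> {exp (-(T+1))..1}" for x
      using that exp_gt_zero[of "-(T+1)"] by (auto simp del: exp_gt_zero intro: less_le_trans)
    have "continuous_on {exp (-(T+1))..1} (\<lambda>x. K (- ln x))"
      by (rule continuous_on_compose2[OF assms(2)])
         (use pos in \<open>auto intro!: continuous_intros simp: less_imp_neq[symmetric]\<close>)
    then have "continuous_on {exp (-(T+1))..1} (\<lambda>x. K (- ln x) * of_real (chi (- ln x)) / of_real x)"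
      unfolding chi_def
      by (intro continuous_intros) (use pos in \<open>auto simp: less_imp_neq[symmetric]\<close>)
    then show "continuous_on {exp (-(T+1))..1} f"
      by (rule continuous_on_eq) (use pos in \<open>force simp: f_def\<close>)
  qed auto
  moreover have "{0..exp (-(T+1))} \<union> {exp (-(T+1))..1} = {0..1}"
    using T(1) exp_gt_zero[of "-(T+1)"] exp_le_one_iff[of "-(T+1)"]
    by (auto simp del: exp_le_one_iff exp_gt_zero)
  ultimately have contf: "continuous_on {0..1} f" by simp
  obtain N c where p: "\<And>x. x \<in> {0..1} \<Longrightarrow> cmod (f x - (\<Sum>j<N. c j * of_real x ^ j)) < e / 2"
    by (rule complex_polynomial_approximation[OF contf, of "e / 2"]) (use assms(3) in auto)
  have bound: "cmod (K t - expsum N c t) \<le> indicator {T..} t * cmod (K t) + e / 2 * (indicator {0..} t *\<^sub>R exp (- (1 * t)))" for t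
  proof (cases "t < 0")
    case True then show ?thesis by (simp add: expsum_def)
  next
    case False
    define x where "x = exp (- t)"
    have x: "x \<in> {0..1}" "x > 0" "ln x = - t" using False by (auto simp: x_def)
    have "exp (- ((of_nat j + 1) * complex_of_real t)) = of_real x * of_real x ^ j" for j
    proof -
      have "exp (- ((of_nat j + 1) * complex_of_real t)) = exp (of_real (-t)) * exp (of_nat j * of_real (- t))"
        unfolding exp_add[symmetric] by (simp add: algebra_simps)
      also have "\<dots> = of_real x * of_real x ^ j"
        unfolding exp_of_nat_mult exp_of_real x_def ..
      finally show ?thesis .
    qed
    then have e: "expsum N c t = of_real x * (\<Sum>j<N. c j * of_real x ^ j)"
      using False by (simp add: expsum_def sum_distrib_left mult_ac)
    have f: "of_real x * f x = K t * of_real (chi t)"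
      using x by (simp add: f_def)
    have "K t - expsum N c t = K t * of_real (1 - chi t) + of_real x * (f x - (\<Sum>j<N. c j * of_real x ^ j))"
      unfolding e right_diff_distrib f by (simp add: algebra_simps)
    then have "cmod (K t - expsum N c t) \<le> cmod (K t) * \<bar>1 - chi t\<bar> + x * cmod (f x - (\<Sum>j<N. c j * of_real x ^ j))"
      using norm_triangle_ineq[of "K t * of_real (1 - chi t)" "of_real x * (f x - (\<Sum>j<N. c j * of_real x ^ j))"] x(2)
      unfolding norm_mult norm_of_real by simp
    also have "\<dots> \<le> cmod (K t) * indicator {T..} t + x * (e / 2)"
      using p[OF x(1)] x(2) by (intro add_mono mult_left_mono) (auto simp: chi_def indicator_def)
    finally show ?thesis using False by (simp add: x_def mult_ac)
  qed
  have int1: "integrable lborel (\<lambda>t. indicator {T..} t * cmod (K t))"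
    using integrable_mult_indicator[of "{T..}" lborel "\<lambda>t. cmod (K t)"] by simp
  note int2 = exp_integral[of 1, unfolded set_integrable_def set_lebesgue_integral_def]
  have intb: "integrable lborel (\<lambda>t. indicator {T..} t * cmod (K t) + e / 2 * (indicator {0..} t *\<^sub>R exp (- (1 * t))))"
    using int1 int2(1) by simp
  have "L1_norm (\<lambda>t. K t - expsum N c t) \<le> 
      (LINT t|lborel. indicator {T..} t * cmod (K t) + e / 2 * (indicator {0..} t *\<^sub>R exp (- (1 * t))))"
  proof (rule integral_mono_AE[OF _ intb])
    show "integrable lborel (\<lambda>t. cmod (K t - expsum N c t))"
      by (rule Bochner_Integration.integrable_bound[OF intb]) (use bound in \<open>auto intro!: AE_I2 order_trans[OF bound]\<close>)
  qed (use bound in auto)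
  also have "\<dots> = (LINT t|lborel. indicator {T..} t * cmod (K t)) + e / 2 * 1"
    using int1 int2 by (subst Bochner_Integration.integral_add) auto
  also have "\<dots> \<le> e" using T(2) by simp
  finally show ?thesis by (rule that)
qed

section \<open>Laplace transforms on the closed right half-plane\<close>

lemma complex_exp_integral:
  assumes "Re w > 0"
  shows "set_integrable lborel {0..} (\<lambda>t. exp (- (of_real t * w)))"
    and "(CLINT t:{0..}|lborel. exp (- (of_real t * w))) = 1 / w"
proof -
  show int: "set_integrable lborel {0..} (\<lambda>t. exp (- (of_real t * w)))"
  proof (rule set_integrable_bound[OF exp_integral(1)[OF assms]])
    show "set_borel_measurable lborel {0..} (\<lambda>t. exp (- (complex_of_real t * w)))"
      unfolding set_borel_measurable_def by measurable
  qed (auto simp: mult.commute)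
  have w: "w \<noteq> 0" using assms by auto
  have "((\<lambda>y. CLINT t|lborel. indicator {..y} t *\<^sub>R (indicator {0..} t *\<^sub>R exp (- (of_real t * w)))) \<longlongrightarrow>
      (CLINT t:{0..}|lborel. exp (- (of_real t * w)))) at_top"
    unfolding set_lebesgue_integral_def
    by (rule tendsto_integral_at_top) (use int in \<open>auto simp: set_integrable_def\<close>)
  moreover have "eventually (\<lambda>y. (CLINT t|lborel. indicator {..y} t *\<^sub>R (indicator {0..} t *\<^sub>R exp (- (of_real t * w))))
       = 1 / w - exp (- (of_real y * w)) / w) at_top"
    using eventually_ge_at_top[of 0]
  proof eventually_elim
    fix y :: real assume y: "0 \<le> y"
    have "((\<lambda>t. - exp (- (of_real t * w)) / w) has_vector_derivative exp (- (of_real t * w))) (at t within {0..y})" for t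
    proof -
      have "((\<lambda>z. - exp (- (z * w)) / w) has_field_derivative exp (- (of_real t * w))) (at (of_real t))"
        using w by (auto intro!: derivative_eq_intros)
      from has_vector_derivative_real_field[OF this] show ?thesis .
    qed
    then have "(CLINT t|lborel. indicator {0..y} t *\<^sub>R exp (- (of_real t * w))) = - exp (- (of_real y * w)) / w - - exp (- (of_real 0 * w)) / w"
      by (intro integral_FTC_Icc y) (auto intro!: continuous_intros)
    then have "(CLINT t|lborel. indicator {0..y} t *\<^sub>R exp (- (of_real t * w))) = 1 / w - exp (- (of_real y * w)) / w"
      by simp
    moreover have "indicator {..y} t *\<^sub>R (indicator {0..} t *\<^sub>R exp (- (of_real t * w))) = indicator {0..y} t *\<^sub>R exp (- (of_real t * w))" for t
      by (auto simp: indicator_def)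
    ultimately show "(CLINT t|lborel. indicator {..y} t *\<^sub>R (indicator {0..} t *\<^sub>R exp (- (of_real t * w))))
       = 1 / w - exp (- (of_real y * w)) / w" by simp
  qed
  ultimately have lim: "((\<lambda>y. 1 / w - exp (- (of_real y * w)) / w) \<longlongrightarrow> (CLINT t:{0..}|lborel. exp (- (of_real t * w)))) at_top"
    by (rule Lim_transform_eventually)
  have "((\<lambda>y. exp (- (y * Re w))) \<longlongrightarrow> 0) at_top"
    using assms by real_asymp
  then have "((\<lambda>y. cmod (exp (- (of_real y * w)))) \<longlongrightarrow> 0) at_top"
    by simp
  then have "((\<lambda>y. exp (- (of_real y * w))) \<longlongrightarrow> 0) at_top"
    by (rule tendsto_norm_zero_cancel)
  then have "((\<lambda>y. 1 / w - exp (- (of_real y * w)) / w) \<longlongrightarrow> 1 / w - 0 / w) at_top"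
    by (rule tendsto_diff[OF tendsto_const tendsto_divide[OF _ tendsto_const w]])
  with lim show "(CLINT t:{0..}|lborel. exp (- (of_real t * w))) = 1 / w"
    using tendsto_unique[OF _ lim] by simp
qed

lemma expsum_indicator:
  "expsum N c t = (\<Sum>j<N. c j * (indicator {0..} t *\<^sub>R exp (- (of_real t * (of_nat j + 1)))))"
  by (auto simp: expsum_def indicator_def mult.commute)

lemma expsum_causal: "causal_kernel (expsum N c)"
proof -
  have "integrable lborel (\<lambda>t. indicator {0..} t *\<^sub>R exp (- (of_real t * (of_nat j + 1 :: complex))))" for j
    using complex_exp_integral(1)[of "of_nat j + 1"] unfolding set_integrable_def by simp
  then have "integrable lborel (expsum N c)"
    unfolding expsum_indicator[abs_def]
    by (intro Bochner_Integration.integrable_sum integrable_mult_right)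
  then show ?thesis by (simp add: causal_kernel_def expsum_def)
qed

definition laplace :: "(real \<Rightarrow> complex) \<Rightarrow> complex \<Rightarrow> complex" where
  "laplace K z = (CLINT t|lborel. K t * exp (- (of_real t * z)))"

lemma causal_exp_bound:
  assumes "causal_kernel K" "Re z \<ge> 0"
  shows "cmod (K t * exp (- (of_real t * z))) \<le> cmod (K t)"
proof (cases "t < 0")
  case False
  then have "exp (- (t * Re z)) \<le> 1" using assms by simp
  then show ?thesis by (simp add: norm_mult mult_left_le)
qed (use assms in \<open>simp add: causal_kernel_def\<close>)

lemma laplace_integrable:
  assumes "causal_kernel K" "Re z \<ge> 0"
  shows "integrable lborel (\<lambda>t. K t * exp (- (of_real t * z)))"
proof (rule Bochner_Integration.integrable_bound)
  show K: "integrable lborel K" using assms by (simp add: causal_kernel_def)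
  have [measurable]: "K \<in> borel_measurable borel" using borel_measurable_integrable[OF K] by simp
  show "(\<lambda>t. K t * exp (- (of_real t * z))) \<in> borel_measurable lborel" by measurable
qed (use causal_exp_bound[OF assms] in auto)

lemma laplace_norm_le:
  assumes "causal_kernel K" "Re z \<ge> 0"
  shows "cmod (laplace K z) \<le> L1_norm K"
  unfolding laplace_def
  by (rule order_trans[OF integral_norm_bound integral_mono])
     (use assms causal_exp_bound[OF assms] laplace_integrable[OF assms] in \<open>auto simp: causal_kernel_def\<close>)

lemma laplace_diff:
  assumes "causal_kernel K" "causal_kernel H" "Re z \<ge> 0"
  shows "laplace (\<lambda>t. K t - H t) z = laplace K z - laplace H z"
  unfolding laplace_def left_diff_distrib
  by (intro Bochner_Integration.integral_diff laplace_integrable assms)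

lemma laplace_expsum:
  assumes "Re z \<ge> 0"
  shows "laplace (expsum N c) z = (\<Sum>j<N. c j / (z + of_nat j + 1))"
proof -
  have pos: "Re (z + of_nat j + 1) > 0" for j :: nat using assms by simp
  have *: "expsum N c t * exp (- (of_real t * z)) = 
      (\<Sum>j<N. c j * (indicator {0..} t *\<^sub>R exp (- (of_real t * (z + of_nat j + 1)))))" for t
    unfolding expsum_indicator sum_distrib_right
    by (intro sum.cong refl) (simp add: algebra_simps flip: exp_add)
  note I = complex_exp_integral[OF pos, unfolded set_integrable_def set_lebesgue_integral_def]
  show ?thesis
    unfolding laplace_def *
    by (subst Bochner_Integration.integral_sum)
       (intro integrable_mult_right I(1), simp only: integral_mult_right_zero I(2) times_divide_eq_right mult_1_right)
qed

text \<open>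
  The function \<open>1 + L k\<^sub>0\<close> for the exponential sum \<open>k\<^sub>0\<close>, written in the coordinate \<open>x = 1 / (z + 1)\<close>, in which
  \<open>1 / (z + j + 1) = x / (1 + j x)\<close>. The point at infinity becomes \<open>x = 0\<close>, where the symbol equals \<open>1\<close>.
\<close>

definition symbol :: "nat \<Rightarrow> (nat \<Rightarrow> complex) \<Rightarrow> complex \<Rightarrow> complex" where
  "symbol N c x = 1 + (\<Sum>j<N. c j * x / (1 + of_nat j * x))"

lemma half_disc_iff: "x \<in> cball (1/2) r \<longleftrightarrow> r \<ge> 0 \<and> (cmod x)\<^sup>2 - Re x \<le> r\<^sup>2 - 1/4"
proof -
  have "dist (1/2) x \<le> r \<longleftrightarrow> r \<ge> 0 \<and> (dist (1/2) x)\<^sup>2 \<le> r\<^sup>2"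
    using power_mono[of "dist (1/2) x" r 2] power2_le_imp_le[of "dist (1/2) x" r] zero_le_dist[of "1/2" x]
    by (auto simp del: zero_le_dist)
  also have "(dist (1/2) x)\<^sup>2 = (cmod x)\<^sup>2 - Re x + 1/4"
    unfolding dist_norm cmod_power2 by (simp add: power2_eq_square algebra_simps)
  finally show ?thesis by auto
qed

lemma half_disc_laplace_point:
  assumes "x \<in> cball (1/2) (1/2)" "x \<noteq> 0"
  shows "Re (1 / x - 1) \<ge> 0"
proof -
  have "(cmod x)\<^sup>2 \<le> Re x" using assms(1) unfolding half_disc_iff by (simp add: power2_eq_square)
  moreover have "(cmod x)\<^sup>2 > 0" using assms(2) by simp
  moreover have "Re (1 / x) = Re x / (cmod x)\<^sup>2" by (simp add: Re_divide cmod_power2)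
  ultimately show ?thesis by simp
qed

lemma half_disc_denominator:
  fixes x :: complex
  assumes "x \<in> cball (1/2) (1/2)"
  shows "1 + of_nat j * x \<noteq> 0"
proof -
  have "Re x \<ge> 0" using assms order_trans[OF zero_le_square[of "cmod x"]]
    unfolding half_disc_iff by (simp add: power2_eq_square)
  then have "Re (1 + of_nat j * x) > 0" by (simp add: add_pos_nonneg)
  then show ?thesis by (metis less_irrefl zero_complex.sel(1))
qed

lemma symbol_eq_laplace:
  assumes "x \<in> cball (1/2) (1/2)" "x \<noteq> 0"
  shows "symbol N c x = 1 + laplace (expsum N c) (1 / x - 1)"
proof -
  have "c j * x / (1 + of_nat j * x) = c j / (1 / x - 1 + of_nat j + 1)" for j
    using assms(2) half_disc_denominator[OF assms(1), of j] by (simp add: field_simps)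
  then show ?thesis
    unfolding symbol_def laplace_expsum[OF half_disc_laplace_point[OF assms]] by simp
qed

lemma symbol_holomorphic:
  assumes "\<And>x j. x \<in> S \<Longrightarrow> j < N \<Longrightarrow> 1 + of_nat j * x \<noteq> 0"
  shows "symbol N c holomorphic_on S"
  unfolding symbol_def using assms by (intro holomorphic_intros) auto

lemma causal_kernel_diff:
  "causal_kernel K \<Longrightarrow> causal_kernel H \<Longrightarrow> causal_kernel (\<lambda>t. K t - H t)"
  by (auto simp: causal_kernel_def)

text \<open>
  In the coordinate \<open>x\<close> the function \<open>1 + L K\<close> lives on a compact disc. It is continuous there, also at
  \<open>x = 0\<close>, because it is the uniform limit of the symbols of approximating exponential sums. Hence it attains
  its minimum, which is positive by hypothesis.
\<close>

lemma laplace_bounded_below: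
  assumes K: "causal_kernel K" "continuous_on {0..} K"
    and nz: "\<And>z. Re z \<ge> 0 \<Longrightarrow> laplace K z \<noteq> -1"
  obtains m where "0 < m" "m \<le> 1" "\<And>z. Re z \<ge> 0 \<Longrightarrow> cmod (1 + laplace K z) \<ge> m"
proof -
  define D where "D = cball (1/2 :: complex) (1/2)"
  define L where "L x = (if x = 0 then 1 else 1 + laplace K (1 / x - 1))" for x
  have "\<exists>N c. L1_norm (\<lambda>t. K t - expsum N c t) \<le> inverse (real (Suc n))" for n
    by (rule expsum_dense_L1[OF K, of "inverse (real (Suc n))"]) (simp, blast)
  then obtain N c where Nc: "\<And>n. L1_norm (\<lambda>t. K t - expsum (N n) (c n) t) \<le> inverse (real (Suc n))"
    by metis
  have close: "cmod (symbol (N n) (c n) x - L x) \<le> inverse (real (Suc n))" if "x \<in> D" for n x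
  proof (cases "x = 0")
    case False
    have "symbol (N n) (c n) x - L x = - laplace (\<lambda>t. K t - expsum (N n) (c n) t) (1 / x - 1)"
      using that False half_disc_laplace_point[of x]
      by (simp add: L_def D_def symbol_eq_laplace laplace_diff K expsum_causal)
    also have "cmod \<dots> \<le> L1_norm (\<lambda>t. K t - expsum (N n) (c n) t)"
      using that False half_disc_laplace_point[of x]
      by (simp only: norm_minus_cancel) (intro laplace_norm_le causal_kernel_diff K expsum_causal, simp add: D_def)
    finally show ?thesis using Nc[of n] by simp
  qed (simp add: L_def symbol_def)
  have "uniform_limit D (\<lambda>n. symbol (N n) (c n)) L sequentially"
  proof (rule uniform_limitI)
    fix e :: real assume "e > 0"
    with LIMSEQ_inverse_real_of_nat have "eventually (\<lambda>n. inverse (real (Suc n)) < e) sequentially"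
      by (rule order_tendstoD(2))
    then show "\<forall>\<^sub>F n in sequentially. \<forall>x\<in>D. dist (symbol (N n) (c n) x) (L x) < e"
      by eventually_elim (use close in \<open>auto simp: dist_norm intro: le_less_trans\<close>)
  qed
  moreover have "continuous_on D (symbol N c)" for N c
    by (rule holomorphic_on_imp_continuous_on[OF symbol_holomorphic]) (simp add: D_def half_disc_denominator del: mem_cball)
  ultimately have "continuous_on D L"
    by (intro uniform_limit_theorem[of _ "\<lambda>n. symbol (N n) (c n)"]) auto
  then have "continuous_on D (\<lambda>x. cmod (L x))" by (intro continuous_intros)
  moreover have "compact D" "0 \<in> D" by (auto simp: D_def dist_norm)
  ultimately obtain x0 where x0: "x0 \<in> D" "\<And>x. x \<in> D \<Longrightarrow> cmod (L x0) \<le> cmod (L x)"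
    using continuous_attains_inf[of D "\<lambda>x. cmod (L x)"] by auto
  have pos: "L x0 \<noteq> 0"
  proof (cases "x0 = 0")
    case False
    have "laplace K (1 / x0 - 1) \<noteq> -1" using x0(1) False by (intro nz half_disc_laplace_point) (auto simp: D_def)
    then show ?thesis using False by (simp add: L_def add_eq_0_iff)
  qed (simp add: L_def)
  show ?thesis
  proof (rule that[of "cmod (L x0)"])
    show "0 < cmod (L x0)" using pos by simp
    show "cmod (L x0) \<le> 1" using x0(2)[OF \<open>0 \<in> D\<close>] by (simp add: L_def)
    fix z assume z: "Re z \<ge> 0"
    define x where "x = 1 / (z + 1)"
    have z1: "Re (z + 1) \<ge> 1" using z by simp
    then have nz1: "z + 1 \<noteq> 0" by (auto simp del: plus_complex.simps)
    have "Re x = Re (z+1) / (cmod (z+1))\<^sup>2" unfolding x_def by (simp add: Re_divide cmod_power2)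
    moreover have "(cmod x)\<^sup>2 = 1 / (cmod (z+1))\<^sup>2" by (simp add: x_def norm_divide power_divide)
    ultimately have "(cmod x)\<^sup>2 \<le> Re x" using z1 by (auto intro!: divide_right_mono)
    then have "x \<in> D" unfolding D_def half_disc_iff by (simp add: power2_eq_square)
    moreover have "L x = 1 + laplace K z" using nz1 by (simp add: L_def x_def)
    ultimately show "cmod (1 + laplace K z) \<ge> cmod (L x0)" using x0(2)[of x] by simp
  qed
qed

text \<open>
  For a rational symbol the lower bound extends by compactness to a strictly larger disc, whose boundary
  corresponds to a circle in the open left half-plane.
\<close>

lemma circle_around_half_disc:
  assumes "0 < b" "\<And>x. x \<in> cball (1/2) (1/2) \<Longrightarrow> cmod (symbol N c x) > b"
  obtains r where "r > 1/2" 
    "\<And>(x :: complex) j. x \<in> cball (1/2) r \<Longrightarrow> j < N \<Longrightarrow> 1 + of_nat j * x \<noteq> 0"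
    "\<And>x. x \<in> cball (1/2) r \<Longrightarrow> cmod (symbol N c x) > b"
proof -
  define U where "U = (\<Inter>j\<in>{..<N}. {x :: complex. 1 + of_nat j * x \<noteq> 0})"
  have "open U" unfolding U_def by (intro open_INT ballI open_Collect_neq continuous_intros) auto
  moreover have "continuous_on U (\<lambda>x. cmod (symbol N c x))"
    by (intro continuous_on_norm holomorphic_on_imp_continuous_on[OF symbol_holomorphic]) (auto simp: U_def)
  ultimately have "open (U \<inter> (\<lambda>x. cmod (symbol N c x)) -` {b<..})"
    by (intro continuous_open_preimage) auto
  moreover have "cball (1/2) (1/2) \<subseteq> U \<inter> (\<lambda>x. cmod (symbol N c x)) -` {b<..}"
    using assms(2) half_disc_denominator by (auto simp: U_def simp del: mem_cball)
  ultimately obtain e where e: "e > 0" 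
      "(\<Union>x\<in>cball (1/2) (1/2). cball x e) \<subseteq> U \<inter> (\<lambda>x. cmod (symbol N c x)) -` {b<..}"
    using compact_subset_open_imp_cball_epsilon_subset[OF compact_cball] by metis
  have "x \<in> (\<Union>y\<in>cball (1/2) (1/2). cball y e)" if x: "x \<in> cball (1/2 :: complex) (1/2 + e)" for x
  proof
    define q where "q = (1/2) / (1/2 + e)"
    define y where "y = 1/2 + of_real q * (x - 1/2)"
    have q: "0 \<le> q" "q \<le> 1" "q * (1/2 + e) = 1/2" "(1 - q) * (1/2 + e) = e"
      using e(1) by (auto simp: q_def field_simps)
    have n: "cmod (x - 1/2) \<le> 1/2 + e" using x by (simp add: dist_norm norm_minus_commute)
    have "cmod (y - 1/2) = q * cmod (x - 1/2)" using q(1) by (simp add: y_def norm_mult)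
    also have "\<dots> \<le> 1/2" using mult_left_mono[OF n q(1)] q(3) by simp
    finally show "y \<in> cball (1/2) (1/2)" by (simp add: dist_norm norm_minus_commute)
    have "y - x = of_real (1 - q) * (1/2 - x)" by (simp add: y_def field_simps)
    then have "cmod (y - x) = (1 - q) * cmod (x - 1/2)" 
      using q(2) by (simp add: norm_mult norm_minus_commute[of "1/2" x] del: of_real_diff)
    also have "\<dots> \<le> e" using mult_left_mono[OF n, of "1 - q"] q(2,4) by simp
    finally show "x \<in> cball y e" by (simp add: dist_norm)
  qed
  with e(2) have sub: "cball (1/2) (1/2 + e) \<subseteq> U \<inter> (\<lambda>x. cmod (symbol N c x)) -` {b<..}" by blast
  show ?thesis
    by (rule that[of "1/2 + e"]) (use sub e(1) in \<open>auto simp: U_def subset_iff simp del: mem_cball\<close>)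
qed

section \<open>Inverse powers of a rational symbol as contour integrals\<close>

text \<open>
  An inverse Laplace transform over the boundary of the larger disc: \<open>exp (t (1 / x - 1))\<close> is the exponential
  \<open>exp (t z)\<close> in the coordinate \<open>x\<close>.
\<close>

definition circle_kernel :: "real \<Rightarrow> (complex \<Rightarrow> complex) \<Rightarrow> real \<Rightarrow> complex" where
  "circle_kernel r h t = (if t < 0 then 0 else
     contour_integral (circlepath (1/2) r) (\<lambda>x. h x * exp (of_real t * (1/x - 1))) / (2 * of_real pi * \<i>))"

lemma circle_avoids_zero: "r > 1/2 \<Longrightarrow> x \<in> sphere (1/2 :: complex) r \<Longrightarrow> x \<noteq> 0"
  by (auto simp: dist_norm)

text \<open>
  Points of the circle have \<open>Re z < 0\<close> uniformly, which makes all circle kernels decay exponentially.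
\<close>

lemma circle_decay:
  assumes "r > 1/2" "x \<in> sphere (1/2 :: complex) r"
  shows "Re (1 / x - 1) \<le> - ((r - 1/2) / (r + 1/2))"
proof -
  have x: "x \<noteq> 0" by (rule circle_avoids_zero[OF assms])
  have d: "dist (1/2) x = r" using assms by simp
  have "(dist (1/2) x)\<^sup>2 = (cmod x)\<^sup>2 - Re x + 1/4"
    unfolding dist_norm cmod_power2 by (simp add: power2_eq_square algebra_simps)
  with d have e: "(cmod x)\<^sup>2 - Re x = (r - 1/2) * (r + 1/2)" 
    by (simp add: power2_eq_square algebra_simps)
  have "cmod x \<le> r + 1/2"
    using norm_triangle_ineq[of "x - 1/2" "1/2"] d by (simp add: dist_norm norm_minus_commute)
  then have le: "(cmod x)\<^sup>2 \<le> (r + 1/2)\<^sup>2" by (intro power_mono) auto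
  have pos: "(cmod x)\<^sup>2 > 0" using x by simp
  have "(r - 1/2) / (r + 1/2) = (r - 1/2) * (r + 1/2) / (r + 1/2)\<^sup>2"
    using assms(1) by (simp add: power2_eq_square)
  also have "\<dots> \<le> (r - 1/2) * (r + 1/2) / (cmod x)\<^sup>2"
    using assms(1) le pos by (intro divide_left_mono mult_pos_pos) (auto intro!: mult_nonneg_nonneg)
  also have "\<dots> = 1 - Re x / (cmod x)\<^sup>2"
    unfolding e[symmetric] using pos by (simp add: diff_divide_distrib)
  also have "Re x / (cmod x)\<^sup>2 = Re (1 / x)" by (simp add: Re_divide cmod_power2)
  finally show ?thesis by simp
qed

context
  fixes r :: real and h :: "complex \<Rightarrow> complex"
  assumes r: "r > 1/2" and h: "continuous_on (sphere (1/2) r) h"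
begin

lemma circle_integrable:
  "continuous_on (sphere (1/2) r) f \<Longrightarrow> f contour_integrable_on (circlepath (1/2) r)"
  using r by (intro contour_integrable_continuous_circlepath) (simp add: path_image_circlepath)

lemma on_circle: "circlepath (1/2) r \<phi> \<in> sphere (1/2) r"
  using r by (simp add: circlepath dist_norm norm_mult)

lemma on_circle_nz: "circlepath (1/2) r \<phi> \<noteq> 0"
  by (rule circle_avoids_zero[OF r on_circle])

lemma cont_comp:
  assumes "continuous_on (sphere (1/2) r) f"
  shows "continuous_on S (\<lambda>\<phi>. f (circlepath (1/2) r \<phi>))"
  by (rule continuous_on_compose2[OF assms])
     (auto intro!: continuous_intros on_circle simp: circlepath simp del: mem_sphere,
      use on_circle in \<open>simp add: circlepath\<close>)

lemma circle_kernel_continuous: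
  "continuous_on UNIV (\<lambda>t. contour_integral (circlepath (1/2) r) (\<lambda>x. h x * exp (of_real t * (1/x - 1))))"
proof -
  have "continuous_on (UNIV \<times> cbox 0 1) (\<lambda>(t, \<phi>). h (circlepath (1/2) r \<phi>) *
     exp (of_real t * (1 / circlepath (1/2) r \<phi> - 1)) * vector_derivative (circlepath (1/2) r) (at \<phi>))"
    unfolding vector_derivative_circlepath case_prod_beta
    by (intro continuous_intros continuous_on_compose2[OF cont_comp[OF h, of UNIV]]
          continuous_on_compose2[OF cont_comp[OF continuous_on_id, of UNIV]])
       (auto simp: on_circle_nz)
  from integral_continuous_on_param[OF this] show ?thesis
    unfolding contour_integral_integral by simp
qed

lemma circle_kernel_measurable: "circle_kernel r h \<in> borel_measurable borel"
proof -
  have [measurable]: "(\<lambda>t. contour_integral (circlepath (1/2) r) (\<lambda>x. h x * exp (of_real t * (1/x - 1)))) \<in> borel_measurable borel"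
    by (rule borel_measurable_continuous_onI[OF circle_kernel_continuous])
  have "circle_kernel r h = (\<lambda>t. indicator {0..} t *\<^sub>R
     (contour_integral (circlepath (1/2) r) (\<lambda>x. h x * exp (of_real t * (1/x - 1))) / (2 * of_real pi * \<i>)))"
    by (auto simp: circle_kernel_def indicator_def)
  also have "\<dots> \<in> borel_measurable borel" by measurable
  finally show ?thesis .
qed

lemma circle_kernel_bound:
  assumes B: "\<And>x. x \<in> sphere (1/2) r \<Longrightarrow> cmod (h x) \<le> B"
  shows "cmod (circle_kernel r h t) \<le> B * r * (indicator {0..} t *\<^sub>R exp (- ((r - 1/2) / (r + 1/2) * t)))"
proof (cases "t < 0")
  case True then show ?thesis by (simp add: circle_kernel_def)
next
  case False
  have B0: "0 \<le> B" using B[OF on_circle[of 0]] norm_ge_zero by (rule order_trans[rotated])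
  define f where "f = (\<lambda>x. h x * exp (of_real t * (1/x - 1)))"
  have "continuous_on (sphere (1/2) r) f"
    unfolding f_def using circle_avoids_zero[OF r] by (intro continuous_intros h) auto
  then have "(f has_contour_integral contour_integral (circlepath (1/2) r) f) (circlepath (1/2) r)"
    by (intro has_contour_integral_integral circle_integrable)
  then have "cmod (contour_integral (circlepath (1/2) r) f) \<le> B * exp (- ((r - 1/2) / (r + 1/2) * t)) * (2 * pi * r)"
  proof (rule has_contour_integral_bound_circlepath)
    fix x assume "cmod (x - 1/2) = r"
    then have x: "x \<in> sphere (1/2) r" by (simp add: dist_norm norm_minus_commute)
    have "cmod (exp (of_real t * (1/x - 1))) = exp (t * Re (1/x - 1))" by simp
    also have "t * Re (1/x - 1) \<le> t * - ((r - 1/2) / (r + 1/2))"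
      using False by (intro mult_left_mono circle_decay[OF r x]) auto
    finally show "cmod (f x) \<le> B * exp (- ((r - 1/2) / (r + 1/2) * t))"
      unfolding f_def norm_mult using B[OF x] B0 by (intro mult_mono) (auto simp: mult.commute)
  qed (use r B0 in auto)
  then show ?thesis using False
    by (simp add: circle_kernel_def f_def norm_divide norm_mult divide_le_eq mult_ac)
qed

lemma circle_kernel_L1:
  assumes B: "\<And>x. x \<in> sphere (1/2) r \<Longrightarrow> cmod (h x) \<le> B"
  shows "causal_kernel (circle_kernel r h)" "bounded_borel (circle_kernel r h)"
    and "L1_norm (circle_kernel r h) \<le> B * r / ((r - 1/2) / (r + 1/2))"
proof -
  let ?k = "(r - 1/2) / (r + 1/2)"
  have k: "?k > 0" using r by simp
  have B0: "0 \<le> B" using B[OF on_circle[of 0]] norm_ge_zero by (rule order_trans[rotated])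
  note I = exp_integral[OF k, unfolded set_integrable_def set_lebesgue_integral_def]
  have int: "integrable lborel (circle_kernel r h)"
  proof (rule Bochner_Integration.integrable_bound)
    show "integrable lborel (\<lambda>t. B * r * (indicator {0..} t *\<^sub>R exp (- (?k * t))))"
      by (intro integrable_mult_right I)
  qed (use circle_kernel_measurable circle_kernel_bound[OF B] in \<open>auto intro!: AE_I2 order_trans[OF circle_kernel_bound[OF B]]\<close>)
  then show "causal_kernel (circle_kernel r h)"
    by (auto simp: causal_kernel_def circle_kernel_def)
  have "L1_norm (circle_kernel r h) \<le> (LINT t|lborel. B * r * (indicator {0..} t *\<^sub>R exp (- (?k * t))))"
    by (intro integral_mono integrable_mult_right integrable_norm int I circle_kernel_bound B)
  then show "L1_norm (circle_kernel r h) \<le> B * r / ?k"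
    using I(2) by simp
  have "cmod (circle_kernel r h t) \<le> B * r" for t
  proof -
    have "B * r * (indicator {0..} t *\<^sub>R exp (- (?k * t))) \<le> B * r * 1"
      using B0 r k by (intro mult_left_mono) (auto simp: indicator_def)
    with circle_kernel_bound[OF B, of t] show ?thesis by linarith
  qed
  then show "bounded_borel (circle_kernel r h)"
    unfolding bounded_borel_def bounded_iff using circle_kernel_measurable by auto
qed

text \<open>
  Interchanging the two integrals reduces this to the convolution of two exponentials,
  \<open>(exp (t z) - exp (- (j + 1) t)) / (z + j + 1)\<close>.
\<close>

lemma conv_exp_circle_kernel:
  assumes nz: "\<And>x :: complex. x \<in> sphere (1/2) r \<Longrightarrow> 1 + of_nat j * x \<noteq> 0" and t: "t \<ge> 0"
  shows "conv (\<lambda>s. indicator {0..} s *\<^sub>R exp (- (of_real s * (of_nat j + 1)))) (circle_kernel r h) t =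
    contour_integral (circlepath (1/2) r) (\<lambda>x. h x * (x / (1 + of_nat j * x)) *
      (exp (of_real t * (1/x - 1)) - exp (- (of_real t * (of_nat j + 1))))) / (2 * of_real pi * \<i>)"
proof -
  define e where "e s = exp (- (of_real s * (of_nat j + 1 :: complex)))" for s :: real
  define g where "g = circlepath (1/2) r"
  define G where "G \<phi> = h (g \<phi>) * vector_derivative g (at \<phi>)" for \<phi>
  define Z where "Z \<phi> = 1 / g \<phi> - 1" for \<phi>
  have contg: "continuous_on S g" for S 
    using cont_comp[OF continuous_on_id] by (simp add: g_def)
  have contG: "continuous_on S G" for S
    unfolding G_def g_def vector_derivative_circlepath by (intro continuous_intros cont_comp h)
  have contZ: "continuous_on S Z" for S
    unfolding Z_def by (intro continuous_intros contg) (use on_circle_nz in \<open>auto simp: g_def\<close>)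
  define I where "I u = contour_integral g (\<lambda>x. h x * exp (of_real u * (1/x - 1)))" for u
  have I: "I u = integral {0..1} (\<lambda>\<phi>. G \<phi> * exp (of_real u * Z \<phi>))" for u
    unfolding I_def contour_integral_integral G_def Z_def by (simp add: mult_ac)
  have contI: "continuous_on UNIV I"
    unfolding I_def g_def by (rule circle_kernel_continuous)
  have "conv (\<lambda>s. indicator {0..} s *\<^sub>R exp (- (of_real s * (of_nat j + 1)))) (circle_kernel r h) t
      = (CLINT s:{0..t}|lborel. e s * I (t - s)) / (2 * of_real pi * \<i>)"
    unfolding conv_def set_lebesgue_integral_def integral_divide_zero[symmetric]
    by (intro Bochner_Integration.integral_cong)
       (use t in \<open>auto simp: circle_kernel_def indicator_def e_def I_def g_def\<close>)
  also have "(CLINT s:{0..t}|lborel. e s * I (t - s)) = integral {0..t} (\<lambda>s. e s * I (t - s))"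
    unfolding e_def
    by (intro set_borel_integral_eq_integral borel_integrable_atLeastAtMost' continuous_intros
          continuous_on_compose2[OF contI]) auto
  also have "\<dots> = integral {0..t} (\<lambda>s. integral {0..1} (\<lambda>\<phi>. G \<phi> * (e s * exp (of_real (t - s) * Z \<phi>))))"
  proof (rule Henstock_Kurzweil_Integration.integral_cong)
    fix s
    have "e s * I (t - s) = integral {0..1} (\<lambda>\<phi>. e s * (G \<phi> * exp (of_real (t - s) * Z \<phi>)))"
      unfolding I by (rule Henstock_Kurzweil_Integration.integral_mult_right[symmetric])
    then show "e s * I (t - s) = integral {0..1} (\<lambda>\<phi>. G \<phi> * (e s * exp (of_real (t - s) * Z \<phi>)))"
      by (simp only: mult.left_commute)
  qed
  also have "\<dots> = integral {0..1} (\<lambda>\<phi>. integral {0..t} (\<lambda>s. G \<phi> * (e s * exp (of_real (t - s) * Z \<phi>))))"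
  proof -
    have "continuous_on (cbox (0, 0) (t, 1)) (\<lambda>(s, \<phi>). G \<phi> * (e s * exp (of_real (t - s) * Z \<phi>)))"
      unfolding case_prod_beta e_def
      by (intro continuous_intros continuous_on_compose2[OF contG[of UNIV]] continuous_on_compose2[OF contZ[of UNIV]]) auto
    from integral_swap_continuous[OF this] show ?thesis by simp
  qed
  also have "\<dots> = integral {0..1} (\<lambda>\<phi>. G \<phi> * ((exp (of_real t * Z \<phi>) - e t) * (g \<phi> / (1 + of_nat j * g \<phi>))))"
  proof (rule Henstock_Kurzweil_Integration.integral_cong)
    fix \<phi> :: real
    define w where "w = Z \<phi> + of_nat j + 1"
    have g0: "g \<phi> \<noteq> 0" "1 + of_nat j * g \<phi> \<noteq> 0"
      using on_circle_nz nz[OF on_circle] by (auto simp: g_def)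
    have w: "w = (1 + of_nat j * g \<phi>) / g \<phi>"
      using g0 by (simp add: w_def Z_def field_simps)
    have w0: "w \<noteq> 0" using g0 by (simp add: w)
    have deriv: "((\<lambda>s. - exp (of_real t * Z \<phi> - of_real s * w) / w) has_vector_derivative
        (e s * exp (of_real (t - s) * Z \<phi>))) (at s within {0..t})" for s
    proof -
      have "((\<lambda>s. - exp (of_real t * Z \<phi> - s * w) / w) has_field_derivative exp (of_real t * Z \<phi> - of_real s * w)) (at (of_real s))"
        using w0 by (auto intro!: derivative_eq_intros)
      from has_vector_derivative_real_field[OF this]
      have "((\<lambda>s. - exp (of_real t * Z \<phi> - of_real s * w) / w) has_vector_derivative
        exp (of_real t * Z \<phi> - of_real s * w)) (at s within {0..t})" .
      moreover have "exp (of_real t * Z \<phi> - of_real s * w) = e s * exp (of_real (t - s) * Z \<phi>)"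
        unfolding e_def exp_add[symmetric] w_def by (simp add: algebra_simps)
      ultimately show ?thesis by simp
    qed
    have "((\<lambda>s. e s * exp (of_real (t - s) * Z \<phi>)) has_integral 
       (- exp (of_real t * Z \<phi> - of_real t * w) / w - - exp (of_real t * Z \<phi> - of_real 0 * w) / w)) {0..t}"
      by (rule fundamental_theorem_of_calculus[OF t deriv])
    then have "integral {0..t} (\<lambda>s. e s * exp (of_real (t - s) * Z \<phi>)) = 
       - exp (of_real t * Z \<phi> - of_real t * w) / w - - exp (of_real t * Z \<phi> - of_real 0 * w) / w"
      by (rule integral_unique)
    also have "exp (of_real t * Z \<phi> - of_real t * w) = e t"
      unfolding e_def w_def by (simp add: algebra_simps)
    also have "- e t / w - - exp (of_real t * Z \<phi> - of_real 0 * w) / w = (exp (of_real t * Z \<phi>) - e t) * (g \<phi> / (1 + of_nat j * g \<phi>))"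
      by (simp add: w diff_divide_distrib left_diff_distrib)
    finally show "integral {0..t} (\<lambda>s. G \<phi> * (e s * exp (of_real (t - s) * Z \<phi>))) = 
        G \<phi> * ((exp (of_real t * Z \<phi>) - e t) * (g \<phi> / (1 + of_nat j * g \<phi>)))"
      by simp
  qed
  also have "\<dots> = contour_integral g (\<lambda>x. h x * (x / (1 + of_nat j * x)) *
      (exp (of_real t * (1/x - 1)) - exp (- (of_real t * (of_nat j + 1)))))"
    unfolding contour_integral_integral G_def Z_def e_def by (simp add: mult_ac)
  finally show ?thesis unfolding g_def .
qed

end

text \<open>
  The kernel \<open>s n\<close> represents \<open>(1 + k\<^sub>0)\<^sup>-\<^sup>n - 1\<close>. Convolving with \<open>k\<^sub>0\<close> multiplies the integrand by
  \<open>symbol - 1\<close> and leaves boundary terms \<open>exp (- (j + 1) t)\<close>, whose coefficient is the residue at \<open>x = 0\<close>, where the symbol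
  is \<open>1\<close>; they add up to \<open>k\<^sub>0\<close> itself. The geometric bound is the standard estimate of the contour
  integral with \<open>\<bar>symbol\<bar> > b\<close> on the circle.
\<close>

lemma circle_power_recursion:
  assumes r: "r > 1/2"
    and den: "\<And>x j. x \<in> cball (1/2) r \<Longrightarrow> j < N \<Longrightarrow> 1 + of_nat j * x \<noteq> (0 :: complex)"
    and b: "0 < b" "\<And>x. x \<in> cball (1/2) r \<Longrightarrow> cmod (symbol N c x) > b"
  defines "s \<equiv> \<lambda>n. circle_kernel r (\<lambda>x. inverse (symbol N c x) ^ n / x\<^sup>2)"
  shows "causal_kernel (s n)" "L1_norm (s n) \<le> r * (r + 1/2) / (r - 1/2) ^ 3 * inverse b ^ n"
    and "s 0 t = 0"
    and "s (Suc n) t + expsum N c t + conv (expsum N c) (s (Suc n)) t = s n t"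
proof -
  define g where "g = circlepath (1/2 :: complex) r"
  define q where "q = symbol N c"
  have sub: "sphere (1/2 :: complex) r \<subseteq> cball (1/2) r" by auto
  have qnz: "q x \<noteq> 0" if "x \<in> cball (1/2) r" for x using b(1) b(2)[OF that] by (auto simp: q_def)
  have qhol: "q holomorphic_on cball (1/2) r" unfolding q_def by (rule symbol_holomorphic) (use den in auto)
  then have qcont: "continuous_on (sphere (1/2) r) q" 
    using sub holomorphic_on_imp_continuous_on continuous_on_subset by blast
  define h where "h n x = inverse (q x) ^ n / x\<^sup>2" for n x
  have s: "s n = circle_kernel r (h n)" for n unfolding s_def h_def q_def ..
  have hcont: "continuous_on (sphere (1/2) r) (h n)" for n
    unfolding h_def using qnz sub circle_avoids_zero[OF r] by (intro continuous_intros qcont) auto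
  have hbound: "cmod (h n x) \<le> inverse b ^ n / (r - 1/2)\<^sup>2" if x: "x \<in> sphere (1/2) r" for n x
  proof -
    have "cmod (q x) > b" using b(2) x sub by (auto simp: q_def)
    then have 1: "inverse (cmod (q x)) \<le> inverse b" using b(1) by (intro le_imp_inverse_le) auto
    have "r = cmod (x - 1/2)" using x by (simp add: dist_norm norm_minus_commute)
    also have "\<dots> \<le> cmod x + 1/2" using norm_triangle_ineq4[of x "1/2"] by simp
    finally have 2: "r - 1/2 \<le> cmod x" by simp
    show ?thesis unfolding h_def norm_divide norm_power norm_inverse
      using 1 2 b(1) r by (intro frac_le power_mono) auto
  qed
  note L1 = circle_kernel_L1[OF r hcont hbound]
  show "causal_kernel (s n)" unfolding s by (rule L1(1))
  have "L1_norm (s n) \<le> inverse b ^ n / (r - 1/2)\<^sup>2 * r / ((r - 1/2) / (r + 1/2))" unfolding s by (rule L1(3))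
  also have "\<dots> = r * (r + 1/2) / (r - 1/2) ^ 3 * inverse b ^ n"
    by (simp add: power2_eq_square power3_eq_cube)
  finally show "L1_norm (s n) \<le> r * (r + 1/2) / (r - 1/2) ^ 3 * inverse b ^ n" .
  have int: "f contour_integrable_on g" if "continuous_on (sphere (1/2) r) f" for f
    unfolding g_def using r that by (intro contour_integrable_continuous_circlepath) (simp add: path_image_circlepath)
  show "s 0 t = 0"
  proof (cases "t < 0")
    case False
    \<comment> \<open>The integrand for \<open>n = 0\<close> has a primitive away from the origin, so its contour integral vanishes.\<close>
    define F where "F x = (if t = 0 then - 1 / x else - exp (of_real t * (1/x - 1)) / of_real t)" for x :: complex
    have "(F has_field_derivative (exp (of_real t * (1/x - 1)) / x\<^sup>2)) (at x within -{0})" if "x \<in> -{0}" for x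
      using that unfolding F_def
      by (cases "t = 0") (auto intro!: derivative_eq_intros simp: power2_eq_square field_simps)
    then have "((\<lambda>x. exp (of_real t * (1/x - 1)) / x\<^sup>2) has_contour_integral F (pathfinish g) - F (pathstart g)) g"
      using circle_avoids_zero[OF r, of 0] r
      by (intro contour_integral_primitive[where S = "-{0}"]) (auto simp: g_def path_image_circlepath simp del: mem_sphere)
    then have "contour_integral g (\<lambda>x. exp (of_real t * (1/x - 1)) / x\<^sup>2) = 0"
      by (intro contour_integral_unique) (simp add: g_def)
    then show ?thesis using False by (simp add: s circle_kernel_def h_def g_def)
  qed (simp add: s circle_kernel_def)
  show "s (Suc n) t + expsum N c t + conv (expsum N c) (s (Suc n)) t = s n t"
  proof (cases "t < 0")
    case True
    have "conv (expsum N c) (s (Suc n)) t = 0"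
      using conv_causal[OF expsum_causal[of N c] L1(1)[of "Suc n"]] True by (simp add: causal_kernel_def s)
    then show ?thesis using True by (simp add: s circle_kernel_def expsum_def)
  next
    case False
    then have t: "t \<ge> 0" by simp
    define tp where "tp = 2 * complex_of_real pi * \<i>"
    have tp: "tp \<noteq> 0" by (simp add: tp_def)
    define e where "e j s = indicator {0..} s *\<^sub>R exp (- (of_real s * (of_nat j + 1 :: complex)))" for j :: nat and s :: real
    define E where "E x = exp (of_real t * (1/x - 1))" for x :: complex
    define y where "y j x = x / (1 + of_nat j * x)" for j and x :: complex
    have Econt: "continuous_on (sphere (1/2) r) E" 
      unfolding E_def using circle_avoids_zero[OF r] by (intro continuous_intros) auto
    have ycont: "continuous_on (sphere (1/2) r) (y j)" if "j < N" for j
      unfolding y_def by (intro continuous_intros ballI den[OF _ that] subsetD[OF sub])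
    have eint: "integrable lborel (e j)" for j
      unfolding e_def using complex_exp_integral(1)[of "of_nat j + 1"] by (simp add: set_integrable_def)
    have residue: "contour_integral g (\<lambda>x. h (Suc n) x * y j x) = tp" if "j < N" for j
    proof -
      define f where "f x = inverse (q x) ^ Suc n / (1 + of_nat j * x)" for x
      have fhol: "f holomorphic_on cball (1/2) r"
        unfolding f_def by (intro holomorphic_intros qhol) (use den that qnz in auto)
      have "((\<lambda>u. f u / (u - 0)) has_contour_integral 2 * complex_of_real pi * \<i> * f 0) (circlepath (1/2) r)"
        by (rule Cauchy_integral_circlepath)
           (use r in \<open>simp_all add: holomorphic_on_imp_continuous_on[OF fhol] holomorphic_on_subset[OF fhol]\<close>)
      moreover have "f 0 = 1" by (simp add: f_def q_def symbol_def)
      moreover have "h (Suc n) x * y j x = f x / (x - 0)" if "x \<in> sphere (1/2) r" for x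
      proof -
        have "A / x\<^sup>2 * (x / d) = A / d / (x - 0)" if "x \<noteq> 0" for A d x :: complex
          using that by (simp add: power2_eq_square)
        from this[OF circle_avoids_zero[OF r that]] show ?thesis unfolding h_def y_def f_def .
      qed
      ultimately have "((\<lambda>x. h (Suc n) x * y j x) has_contour_integral 2 * complex_of_real pi * \<i> * 1) (circlepath (1/2) r)"
        using r has_contour_integral_eq[of "\<lambda>u. f u / (u - 0)" "2 * complex_of_real pi * \<i> * 1" "circlepath (1/2) r"
            "\<lambda>x. h (Suc n) x * y j x"]
        by (simp only: path_image_circlepath abs_of_pos[of r])
      then have "((\<lambda>x. h (Suc n) x * y j x) has_contour_integral tp) g"
        by (simp add: g_def tp_def)
      then show ?thesis by (rule contour_integral_unique)
    qed
    have conv_e: "conv (e j) (s (Suc n)) t = contour_integral g (\<lambda>x. h (Suc n) x * y j x * E x) / tp - e j t" 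
      if j: "j < N" for j
    proof -
      have "conv (e j) (s (Suc n)) t = contour_integral g (\<lambda>x. h (Suc n) x * y j x * (E x - e j t)) / tp"
        unfolding s e_def y_def E_def g_def tp_def using t
        by (subst conv_exp_circle_kernel[OF r hcont]) (use den j sub in auto)
      also have "(\<lambda>x. h (Suc n) x * y j x * (E x - e j t)) = (\<lambda>x. h (Suc n) x * y j x * E x - h (Suc n) x * y j x * e j t)"
        by (simp add: right_diff_distrib)
      also have "contour_integral g \<dots> = contour_integral g (\<lambda>x. h (Suc n) x * y j x * E x) - tp * e j t"
      proof -
        have c: "continuous_on (sphere (1/2) r) (\<lambda>x. h (Suc n) x * y j x)"
          by (intro continuous_on_mult hcont ycont j)
        have "contour_integral g (\<lambda>x. h (Suc n) x * y j x * E x - h (Suc n) x * y j x * e j t) =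
            contour_integral g (\<lambda>x. h (Suc n) x * y j x * E x) - contour_integral g (\<lambda>x. h (Suc n) x * y j x * e j t)"
          by (intro contour_integral_diff int continuous_on_mult c Econt continuous_on_const)
        also have "contour_integral g (\<lambda>x. h (Suc n) x * y j x * e j t) = contour_integral g (\<lambda>x. h (Suc n) x * y j x) * e j t"
          by (rule contour_integral_rmul[OF int[OF c]])
        also have "contour_integral g (\<lambda>x. h (Suc n) x * y j x) = tp" by (rule residue[OF j])
        finally show ?thesis .
      qed
      finally show ?thesis using tp by (simp add: diff_divide_distrib)
    qed
    have "conv (expsum N c) (s (Suc n)) t = (CLINT u|lborel. \<Sum>j<N. c j * (e j u * s (Suc n) (t - u)))"
      unfolding conv_def expsum_indicator e_def sum_distrib_right by (simp only: mult.assoc)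
    also have "\<dots> = (\<Sum>j<N. c j * conv (e j) (s (Suc n)) t)"
      unfolding conv_def
      by (subst Bochner_Integration.integral_sum)
         (auto intro!: integrable_mult_right conv_integrable eint L1(2) simp: s)
    also have "\<dots> = (\<Sum>j<N. c j * (contour_integral g (\<lambda>x. h (Suc n) x * y j x * E x) / tp - e j t))"
      by (intro sum.cong refl) (simp add: conv_e)
    also have "\<dots> = (\<Sum>j<N. c j * contour_integral g (\<lambda>x. h (Suc n) x * y j x * E x)) / tp - expsum N c t"
      unfolding expsum_indicator e_def by (simp add: right_diff_distrib sum_subtractf sum_divide_distrib)
    also have "(\<Sum>j<N. c j * contour_integral g (\<lambda>x. h (Suc n) x * y j x * E x)) 
        = contour_integral g (\<lambda>x. \<Sum>j<N. c j * (h (Suc n) x * y j x * E x))"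
    proof -
      have i: "(\<lambda>x. h (Suc n) x * y j x * E x) contour_integrable_on g" if "j < N" for j
        by (intro int continuous_on_mult hcont ycont Econt that)
      show ?thesis
        by (subst contour_integral_sum)
           (simp_all add: contour_integrable_lmul i contour_integral_lmul[OF i])
    qed
    also have "\<dots> = contour_integral g (\<lambda>x. h n x * E x - h (Suc n) x * E x)"
    proof (rule contour_integral_eq)
      fix x assume "x \<in> path_image g"
      then have x: "x \<in> sphere (1/2) r" using r by (simp add: g_def path_image_circlepath)
      have "q x * h (Suc n) x = h n x" using qnz[of x] x by (simp add: h_def field_simps)
      then have "h n x * E x - h (Suc n) x * E x = (q x - 1) * h (Suc n) x * E x"
        by (simp add: left_diff_distrib)
      also have "q x - 1 = (\<Sum>j<N. c j * y j x)" by (simp add: q_def symbol_def y_def)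
      also have "\<dots> * h (Suc n) x * E x = (\<Sum>j<N. c j * (h (Suc n) x * y j x * E x))"
        unfolding sum_distrib_right by (intro sum.cong refl) (simp add: mult_ac)
      finally show "(\<Sum>j<N. c j * (h (Suc n) x * y j x * E x)) = h n x * E x - h (Suc n) x * E x" ..
    qed
    also have "\<dots> = contour_integral g (\<lambda>x. h n x * E x) - contour_integral g (\<lambda>x. h (Suc n) x * E x)"
      by (intro contour_integral_diff int continuous_on_mult hcont Econt)
    also have "(contour_integral g (\<lambda>x. h n x * E x) - contour_integral g (\<lambda>x. h (Suc n) x * E x)) / tp = s n t - s (Suc n) t"
      using t by (simp add: s circle_kernel_def E_def g_def tp_def diff_divide_distrib)
    finally have "conv (expsum N c) (s (Suc n)) t = s n t - s (Suc n) t - expsum N c t" .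
    then show ?thesis by simp
  qed
qed

section \<open>Stability of Volterra equations\<close>

text \<open>
  With \<open>S n = 1 + s n\<close>, \<open>L = 1 + k\<^sub>0\<close> and \<open>D = - k\<^sub>1\<close>, all acting by convolution, the recursion says
  \<open>S (n + 1) L = S n\<close> and \<open>S 0 = 1\<close>. From \<open>L f = F + D f\<close> and since \<open>D\<close> commutes with \<open>L\<close>,
  \<open>f = (\<Sum>j<n. S (j + 1) D\<^sup>j F) + S n D\<^sup>n f\<close>. One exponent \<open>n\<close> for which the last operator has
  norm at most \<open>1/2\<close> suffices to absorb the last term into the supremum of \<open>f\<close>.
\<close>

lemma newman_iteration:
  assumes k0: "causal_kernel k0" and k1: "causal_kernel k1"
    and s: "\<And>n. causal_kernel (s n)" and s0: "\<And>t. s 0 t = 0"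
    and s_Suc: "\<And>n t. s (Suc n) t + k0 t + conv k0 (s (Suc n)) t = s n t"
    and small: "(1 + L1_norm (s n)) * L1_norm k1 ^ n \<le> 1/2"
  obtains C where "C \<ge> 0"
    "\<And>f T B t. bounded_borel f \<Longrightarrow> (\<And>t. t \<le> T \<Longrightarrow> cmod (f t + conv (\<lambda>t. k0 t + k1 t) f t) \<le> B) \<Longrightarrow>
       t \<le> T \<Longrightarrow> cmod (f t) \<le> C * B"
proof -
  have ik0: "integrable lborel k0" and ik1: "integrable lborel k1" and is_n: "integrable lborel (s n)" for n
    using k0 k1 s by (auto simp: causal_kernel_def)
  define S where "S n f = (\<lambda>t. f t + conv (s n) f t)" for n f
  define L where "L f = (\<lambda>t. f t + conv k0 f t)" for f
  define D where "D f = (\<lambda>t. - conv k1 f t)" for f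
  have bbS: "bounded_borel (S n f)" and bbL: "bounded_borel (L f)" and bbD: "bounded_borel (D f)"
    if "bounded_borel f" for f n
    using that unfolding S_def L_def D_def
    by (auto intro!: bounded_borel_add bounded_borel_uminus conv_bounded_borel ik0 ik1 is_n)
  have bbDn: "bounded_borel ((D ^^ n) f)" if "bounded_borel f" for f n
    by (induction n) (auto intro: that bbD)
  have D_add: "D (\<lambda>t. f t + g t) = (\<lambda>t. D f t + D g t)" if "bounded_borel f" "bounded_borel g" for f g
    unfolding D_def by (simp add: conv_add[OF ik1 that])
  have Dn_add: "(D ^^ n) (\<lambda>t. f t + g t) = (\<lambda>t. (D ^^ n) f t + (D ^^ n) g t)" 
    if "bounded_borel f" "bounded_borel g" for f g n
    by (induction n) (auto simp: D_add bbDn that)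
  have LD: "L (D f) = D (L f)" if "bounded_borel f" for f
  proof
    fix t
    have "conv k0 (D f) t = - conv k0 (conv k1 f) t" unfolding D_def by (rule conv_uminus)
    also have "\<dots> = - conv k1 (conv k0 f) t" by (simp add: conv_left_commute[OF ik0 ik1 that])
    finally show "L (D f) t = D (L f) t"
      unfolding L_def by (simp add: D_def conv_add[OF ik1 that conv_bounded_borel[OF ik0 that]])
  qed
  have LDn: "L ((D ^^ n) f) = (D ^^ n) (L f)" if "bounded_borel f" for f n
    by (induction n) (auto simp: LD bbDn that)
  have S_add: "S n (\<lambda>t. f t + g t) t = S n f t + S n g t" if "bounded_borel f" "bounded_borel g" for f g n t
    unfolding S_def by (simp add: conv_add[OF is_n that])
  have SL: "S (Suc n) (L f) = S n f" if bb: "bounded_borel f" for f n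
  proof
    fix t
    have eq: "s n = (\<lambda>t. (s (Suc n) t + k0 t) + conv k0 (s (Suc n)) t)" using s_Suc[of n] by auto
    have comm: "conv (s (Suc n)) k0 = conv k0 (s (Suc n))" by (rule ext, rule conv_commute)
    have "conv (s n) f t = conv (\<lambda>t. s (Suc n) t + k0 t) f t + conv (conv k0 (s (Suc n))) f t"
      unfolding eq by (intro conv_kernel_add Bochner_Integration.integrable_add conv_kernel_integrable is_n ik0 bb)
    also have "conv (\<lambda>t. s (Suc n) t + k0 t) f t = conv (s (Suc n)) f t + conv k0 f t"
      by (intro conv_kernel_add is_n ik0 bb)
    also have "conv (conv k0 (s (Suc n))) f t = conv (s (Suc n)) (conv k0 f) t"
      by (simp add: conv_assoc[OF is_n ik0 bb] comm)
    finally show "S (Suc n) (L f) t = S n f t"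
      unfolding S_def L_def by (simp add: conv_add[OF is_n bb conv_bounded_borel[OF ik0 bb]])
  qed
  have S_bound: "cmod (S n f t) \<le> (1 + L1_norm (s n)) * B" 
    if "bounded_borel f" "\<And>u. u \<le> t \<Longrightarrow> cmod (f u) \<le> B" for f n t B
  proof -
    have "cmod (conv (s n) f t) \<le> L1_norm (s n) * B"
      by (rule conv_norm_le[OF s that(1)]) (rule that(2))
    with norm_triangle_ineq[of "f t" "conv (s n) f t"] that(2)[of t] show ?thesis
      unfolding S_def by (simp add: distrib_right)
  qed
  have Dn_bound: "cmod ((D ^^ n) f t) \<le> L1_norm k1 ^ n * B" 
    if "bounded_borel f" "\<And>u. u \<le> t \<Longrightarrow> cmod (f u) \<le> B" for f n t B
    using that(2)
  proof (induction n arbitrary: t)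
    case (Suc n)
    have "cmod (conv k1 ((D ^^ n) f) t) \<le> L1_norm k1 * (L1_norm k1 ^ n * B)"
      by (rule conv_norm_le[OF k1 bbDn[OF that(1)]]) (use Suc in auto)
    then show ?case by (simp add: D_def[of "(D ^^ n) f"] mult.assoc)
  qed simp
  define A where "A = (\<Sum>j<n. (1 + L1_norm (s (Suc j))) * L1_norm k1 ^ j)"
  show ?thesis
  proof (rule that[of "2 * A"])
    show "0 \<le> 2 * A" unfolding A_def by (auto intro!: sum_nonneg mult_nonneg_nonneg add_nonneg_nonneg zero_le_power L1_norm_nonneg)
    fix f T B t
    assume bb: "bounded_borel f" and B: "\<And>t. t \<le> T \<Longrightarrow> cmod (f t + conv (\<lambda>t. k0 t + k1 t) f t) \<le> B" and t: "t \<le> T"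
    define F where "F = (\<lambda>t. f t + conv (\<lambda>t. k0 t + k1 t) f t)"
    have bbF: "bounded_borel F"
      unfolding F_def by (intro bounded_borel_add bb conv_bounded_borel Bochner_Integration.integrable_add ik0 ik1)
    have LF: "L f = (\<lambda>t. F t + D f t)"
      unfolding L_def F_def D_def by (simp add: conv_kernel_add[OF ik0 ik1 bb])
    have expand: "f t = (\<Sum>j<n. S (Suc j) ((D ^^ j) F) t) + S n ((D ^^ n) f) t" for n t
    proof (induction n)
      case 0 then show ?case by (simp add: S_def conv_def s0)
    next
      case (Suc n)
      have "S n ((D ^^ n) f) t = S (Suc n) ((D ^^ n) (L f)) t"
        using SL[OF bbDn[OF bb], of n n] LDn[OF bb, of n] by simp
      also have "(D ^^ n) (L f) = (\<lambda>t. (D ^^ n) F t + (D ^^ Suc n) f t)"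
        unfolding LF Dn_add[OF bbF bbD[OF bb]] by (simp add: funpow_swap1)
      also have "S (Suc n) (\<lambda>t. (D ^^ n) F t + (D ^^ Suc n) f t) t = 
          S (Suc n) ((D ^^ n) F) t + S (Suc n) ((D ^^ Suc n) f) t"
        by (rule S_add[OF bbDn[OF bbF] bbDn[OF bb]])
      finally show ?case using Suc by simp
    qed
    have est: "cmod (f t) \<le> A * B + G / 2" if G: "\<And>u. u \<le> T \<Longrightarrow> cmod (f u) \<le> G" and t: "t \<le> T" for G t
    proof -
      have "cmod (S (Suc j) ((D ^^ j) F) t) \<le> (1 + L1_norm (s (Suc j))) * (L1_norm k1 ^ j * B)" for j
        by (intro S_bound bbDn bbF Dn_bound) (use t B in \<open>auto simp: F_def\<close>)
      then have 1: "cmod (\<Sum>j<n. S (Suc j) ((D ^^ j) F) t) \<le> A * B"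
        unfolding A_def sum_distrib_right by (intro sum_norm_le) (simp add: mult.assoc)
      have "G \<ge> 0" using G[OF t] norm_ge_zero[of "f t"] by linarith
      have "cmod (S n ((D ^^ n) f) t) \<le> (1 + L1_norm (s n)) * (L1_norm k1 ^ n * G)"
        by (intro S_bound bbDn bb Dn_bound) (use t G in auto)
      also have "\<dots> = ((1 + L1_norm (s n)) * L1_norm k1 ^ n) * G" by simp
      also have "\<dots> \<le> 1/2 * G" by (intro mult_right_mono small \<open>G \<ge> 0\<close>)
      finally have 2: "cmod (S n ((D ^^ n) f) t) \<le> G / 2" by simp
      have "cmod (f t) \<le> cmod (\<Sum>j<n. S (Suc j) ((D ^^ j) F) t) + cmod (S n ((D ^^ n) f) t)"
        by (subst expand[of t n]) (rule norm_triangle_ineq)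
      then show ?thesis using 1 2 by linarith
    qed
    define G where "G = (SUP u\<in>{..T}. cmod (f u))"
    have bdd: "bdd_above ((\<lambda>u. cmod (f u)) ` {..T})"
      using bb unfolding bounded_borel_def bounded_iff bdd_above_def by auto
    have G: "cmod (f u) \<le> G" if "u \<le> T" for u
      unfolding G_def using that by (intro cSUP_upper bdd) auto
    have "G \<le> A * B + G / 2"
      unfolding G_def[symmetric] by (subst (1) G_def, rule cSUP_least) (use est[OF G] in auto)
    then show "cmod (f t) \<le> 2 * A * B" using G[OF t] by linarith
  qed
qed

text \<open>
  The half-line theorem of Paley and Wiener, in the form of an a priori estimate on \<open>(- \<infinity>, T]\<close> with a constant
  independent of \<open>T\<close>. With \<open>m\<close> the minimum of \<open>\<bar>1 + L K\<bar>\<close>, the approximation error is at most \<open>m / 4\<close>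
  while the symbol stays above \<open>m / 2\<close>, so that the powers in the iteration decay like \<open>2\<^sup>-\<^sup>n\<close>.
\<close>

theorem volterra_stability:
  assumes K: "causal_kernel K" "continuous_on {0..} K"
    and nz: "\<And>z. Re z \<ge> 0 \<Longrightarrow> laplace K z \<noteq> -1"
  obtains C where "C \<ge> 0"
    "\<And>f T B t. bounded_borel f \<Longrightarrow> (\<And>t. t \<le> T \<Longrightarrow> cmod (f t + conv K f t) \<le> B) \<Longrightarrow>
       t \<le> T \<Longrightarrow> cmod (f t) \<le> C * B"
proof -
  obtain m where m: "0 < m" "m \<le> 1" "\<And>z. Re z \<ge> 0 \<Longrightarrow> cmod (1 + laplace K z) \<ge> m"
    by (rule laplace_bounded_below[OF K nz]) (assumption, blast)
  define b where "b = m / 2"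
  have b: "0 < b" using m by (simp add: b_def)
  obtain N c where Nc: "L1_norm (\<lambda>t. K t - expsum N c t) \<le> b / 2"
    by (rule expsum_dense_L1[OF K, of "b / 2"]) (use b in auto)
  define k1 where "k1 t = K t - expsum N c t" for t
  have k1: "causal_kernel k1" unfolding k1_def by (intro causal_kernel_diff K expsum_causal)
  have big: "cmod (symbol N c x) > b" if x: "x \<in> cball (1/2) (1/2)" for x
  proof (cases "x = 0")
    case False
    define z where "z = 1 / x - 1"
    have z: "Re z \<ge> 0" unfolding z_def by (rule half_disc_laplace_point[OF x False])
    have "1 + laplace K z = symbol N c x + laplace k1 z"
      unfolding symbol_eq_laplace[OF x False] k1_def z_def[symmetric]
      by (simp add: laplace_diff[OF K(1) expsum_causal z])
    then have "m \<le> cmod (symbol N c x) + cmod (laplace k1 z)"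
      using m(3)[OF z] norm_triangle_ineq[of "symbol N c x" "laplace k1 z"] by simp
    moreover have "cmod (laplace k1 z) \<le> b / 2"
      using laplace_norm_le[OF k1 z] Nc by (simp add: k1_def[abs_def])
    ultimately show ?thesis using m(1) by (simp add: b_def)
  qed (use m in \<open>simp add: symbol_def b_def\<close>)
  obtain r where r: "r > 1/2" 
      "\<And>(x :: complex) j. x \<in> cball (1/2) r \<Longrightarrow> j < N \<Longrightarrow> 1 + of_nat j * x \<noteq> 0"
      "\<And>x. x \<in> cball (1/2) r \<Longrightarrow> cmod (symbol N c x) > b"
    by (rule circle_around_half_disc[OF b big]) (assumption, blast)
  define s where "s = (\<lambda>n. circle_kernel r (\<lambda>x. inverse (symbol N c x) ^ n / x\<^sup>2))"
  define M where "M = r * (r + 1/2) / (r - 1/2) ^ 3"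
  have s1: "causal_kernel (s n)" for n
    unfolding s_def by (rule circle_power_recursion(1)) (use r b in blast)+
  have s2: "L1_norm (s n) \<le> M * inverse b ^ n" for n
    unfolding s_def M_def by (rule circle_power_recursion(2)) (use r b in blast)+
  have s3: "s 0 t = 0" for t
    unfolding s_def by (rule circle_power_recursion(3)) (use r b in blast)+
  have s4: "s (Suc n) t + expsum N c t + conv (expsum N c) (s (Suc n)) t = s n t" for n t
    unfolding s_def by (rule circle_power_recursion(4)) (use r b in blast)+
  have M: "M \<ge> 0" using r(1) by (simp add: M_def)
  have "(\<lambda>n. (1 + M) * (1/2) ^ n) \<longlonglongrightarrow> (1 + M) * 0"
    by (intro tendsto_mult tendsto_const LIMSEQ_power_zero) auto
  then have "eventually (\<lambda>n. (1 + M) * (1/2) ^ n < 1/2) sequentially"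
    by (rule order_tendstoD) auto
  then obtain n where n: "(1 + M) * (1/2) ^ n < 1/2" by (auto dest: eventually_happens)
  have "(1 + L1_norm (s n)) * L1_norm k1 ^ n \<le> (1 + M * inverse b ^ n) * (b / 2) ^ n"
    using s2[of n] Nc M b L1_norm_nonneg[of k1]
    by (intro mult_mono power_mono) (auto simp: k1_def[abs_def])
  also have "\<dots> = (b / 2) ^ n + M * (1/2) ^ n"
  proof -
    have "inverse b ^ n * (b / 2) ^ n = (1/2) ^ n"
      using b by (simp add: power_mult_distrib[symmetric])
    then show ?thesis by (simp only: distrib_right mult_1_left mult.assoc)
  qed
  also have "\<dots> \<le> (1 / 2) ^ n + M * (1/2) ^ n"
    using b m by (intro add_right_mono power_mono) (auto simp: b_def)
  also have "\<dots> \<le> 1/2" using n by (simp add: distrib_right)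
  finally have small: "(1 + L1_norm (s n)) * L1_norm k1 ^ n \<le> 1/2" .
  have K_split: "(\<lambda>t. expsum N c t + k1 t) = K" by (simp add: k1_def)
  obtain C where C: "C \<ge> 0" "\<And>f T B t. bounded_borel f \<Longrightarrow>
      (\<And>t. t \<le> T \<Longrightarrow> cmod (f t + conv (\<lambda>t. expsum N c t + k1 t) f t) \<le> B) \<Longrightarrow> t \<le> T \<Longrightarrow> cmod (f t) \<le> C * B"
    by (rule newman_iteration[OF expsum_causal k1 s1 s3 s4 small]) (rule that; blast)
  show ?thesis by (rule that[OF C(1)]) (rule C(2)[unfolded K_split]; blast)
qed

section \<open>Weak solutions satisfy the Duhamel formula\<close>

lemma at_within_atLeast_neq_bot: "t \<ge> 0 \<Longrightarrow> at t within {0::real..} \<noteq> bot"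
proof -
  assume "t \<ge> 0"
  then have "at_right t \<le> at t within {0..}" by (intro at_le) auto
  then show ?thesis using trivial_limit_at_right_real[of t] by (auto simp: bot_unique)
qed

lemma has_vector_derivative_primitive:
  fixes p :: "real \<Rightarrow> complex"
  assumes "continuous_on {0..} p" "t \<ge> 0"
  shows "((\<lambda>u. integral {0..u} p) has_vector_derivative p t) (at t within {0..})"
proof -
  have "((\<lambda>u. integral {0..u} p) has_vector_derivative p t) (at t within {0..t+1})"
    using assms by (intro integral_has_vector_derivative) (auto intro: continuous_on_subset)
  also have "at t within {0..t+1} = at t within {0..}"
    using assms(2) by (intro at_within_nhd[of _ "{..<t+1}"]) auto
  finally show ?thesis .
qed

text \<open>
  The difference \<open>d\<close> of the two sides is orthogonal to the derivative \<open>p\<close> of every admissible test function.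
  Any continuous \<open>p\<close> with compact support occurs, with \<open>\<psi> t = - \<integral> p\<close> over \<open>[t, \<infinity>)\<close>, and
  \<open>p = cnj d\<close> times a positive weight forces \<open>d = 0\<close>.
\<close>

lemma weak_ode_imp_integral_equation:
  fixes f b :: "real \<Rightarrow> complex"
  assumes f: "continuous_on {0..} f" and b: "continuous_on {0..} b"
    and weak: "\<And>\<psi> p N. continuous_on {0..} p \<Longrightarrow>
        (\<And>t. t \<ge> 0 \<Longrightarrow> (\<psi> has_vector_derivative p t) (at t within {0..})) \<Longrightarrow>
        (\<And>t. t \<ge> N \<Longrightarrow> \<psi> t = 0) \<Longrightarrow> (\<And>t. t \<ge> N \<Longrightarrow> p t = 0) \<Longrightarrow>
        0 = \<psi> 0 * c + (CLINT t:{0..}|lborel. p t * f t + \<psi> t * b t)"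
    and t: "t \<ge> 0"
  shows "f t = c + (CLINT s:{0..t}|lborel. b s)"
proof -
  define B where "B t = c + integral {0..t} b" for t
  define N where "N = t + 1"
  define d where "d t = f t - B t" for t
  \<comment> \<open>The weight vanishes from \<open>N\<close> on and is positive at \<open>t\<close>.\<close>
  define p where "p t = cnj (d t) * of_real (max 0 (N - t))" for t
  define \<psi> where "\<psi> t = integral {0..t} p - integral {0..N} p" for t
  have Bder: "(B has_vector_derivative b t) (at t within {0..})" if "t \<ge> 0" for t
    unfolding B_def using has_vector_derivative_add[OF has_vector_derivative_const has_vector_derivative_primitive[OF b that]]
    by simp
  have Bcont: "continuous_on {0..} B"
    by (rule continuous_on_vector_derivative[OF Bder]) simp
  have dcont: "continuous_on {0..} d" unfolding d_def by (intro continuous_intros f Bcont)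
  have pcont: "continuous_on {0..} p" unfolding p_def by (intro continuous_intros dcont)
  have pder: "(\<psi> has_vector_derivative p t) (at t within {0..})" if "t \<ge> 0" for t
    unfolding \<psi>_def using has_vector_derivative_diff[OF has_vector_derivative_primitive[OF pcont that] has_vector_derivative_const]
    by simp
  have \<psi>cont: "continuous_on {0..} \<psi>"
    by (rule continuous_on_vector_derivative[OF pder]) simp
  have N: "N > 0" using t by (simp add: N_def)
  have p0: "p t = 0" if "t \<ge> N" for t using that by (simp add: p_def)
  have \<psi>0: "\<psi> u = 0" if "u \<ge> N" for u
  proof -
    have "integral {0..N} p + integral {N..u} p = integral {0..u} p"
      using N that by (intro Henstock_Kurzweil_Integration.integral_combine integrable_continuous_real
            continuous_on_subset[OF pcont]) auto
    moreover have "integral {N..u} p = 0"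
      using Henstock_Kurzweil_Integration.integral_cong[of "{N..u}" p "\<lambda>_. 0"] p0 by simp
    ultimately show ?thesis by (simp add: \<psi>_def)
  qed
  have "(CLINT t:{0..}|lborel. p t * f t + \<psi> t * b t) = (CLINT t:{0..N}|lborel. p t * f t + \<psi> t * b t)"
    unfolding set_lebesgue_integral_def
    by (intro Bochner_Integration.integral_cong) (auto simp: indicator_def p0 \<psi>0)
  also have "\<dots> = integral {0..N} (\<lambda>t. p t * f t + \<psi> t * b t)"
    by (intro set_borel_integral_eq_integral borel_integrable_atLeastAtMost' continuous_intros
          continuous_on_subset[OF pcont] continuous_on_subset[OF f] continuous_on_subset[OF b] continuous_on_subset[OF \<psi>cont]) auto
  finally have 1: "0 = \<psi> 0 * c + integral {0..N} (\<lambda>t. p t * f t + \<psi> t * b t)"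
    using weak[OF pcont pder \<psi>0 p0] by simp
  have "((\<lambda>t. \<psi> t * b t + p t * B t) has_integral \<psi> N * B N - \<psi> 0 * B 0) {0..N}"
  proof (rule fundamental_theorem_of_calculus)
    fix t assume "t \<in> {0..N}"
    then show "((\<lambda>t. \<psi> t * B t) has_vector_derivative \<psi> t * b t + p t * B t) (at t within {0..N})"
      by (intro has_vector_derivative_within_subset[OF has_vector_derivative_mult[OF pder Bder]]) auto
  qed (use N in simp)
  then have 2: "integral {0..N} (\<lambda>t. \<psi> t * b t + p t * B t) = - (\<psi> 0 * c)"
    by (simp add: integral_unique \<psi>0 B_def)
  have "integral {0..N} (\<lambda>t. p t * d t) = integral {0..N} (\<lambda>t. (p t * f t + \<psi> t * b t) - (\<psi> t * b t + p t * B t))"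
    by (simp add: d_def algebra_simps)
  also have "\<dots> = 0"
    using 1 2 by (subst Henstock_Kurzweil_Integration.integral_diff)
     (auto intro!: integrable_continuous_real continuous_intros
          continuous_on_subset[OF pcont] continuous_on_subset[OF f] continuous_on_subset[OF b] continuous_on_subset[OF \<psi>cont] 
          continuous_on_subset[OF Bcont] simp: add.commute)
  also have "(\<lambda>t. p t * d t) = (\<lambda>t. complex_of_real ((cmod (d t))\<^sup>2 * max 0 (N - t)))"
    unfolding p_def of_real_mult complex_norm_square by (simp only: mult_ac)
  finally have "integral {0..N} (\<lambda>t. complex_of_real ((cmod (d t))\<^sup>2 * max 0 (N - t))) = 0" .
  moreover have cont: "continuous_on {0..N} (\<lambda>t. (cmod (d t))\<^sup>2 * max 0 (N - t))"
    by (intro continuous_intros continuous_on_subset[OF dcont]) auto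
  ultimately have "integral {0..N} (\<lambda>t. (cmod (d t))\<^sup>2 * max 0 (N - t)) = 0"
    using integral_linear[OF integrable_continuous_real[OF cont] bounded_linear_of_real[where 'a = complex]]
    by (simp add: o_def)
  then have "(cmod (d t))\<^sup>2 * max 0 (N - t) = 0"
    using integral_eq_0_iff[OF cont N] t by (auto simp: N_def)
  then have "f t = B t" by (simp add: N_def d_def)
  moreover have "integral {0..t} b = (CLINT s:{0..t}|lborel. b s)"
    by (intro set_borel_integral_eq_integral(2)[symmetric] borel_integrable_atLeastAtMost' continuous_on_subset[OF b]) auto
  ultimately show ?thesis by (simp add: B_def)
qed

text \<open>
  The square makes this compactly supported bump continuously differentiable.
\<close>

definition cutoff :: "real \<Rightarrow> real \<Rightarrow> real" where
  "cutoff R w = (max 0 (1 - (w / R)\<^sup>2))\<^sup>2"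

lemma cutoff_bounds: "0 \<le> cutoff R w" "cutoff R w \<le> 1"
  unfolding cutoff_def by (auto intro!: power_le_one)

lemma cutoff_eq_0: "R > 0 \<Longrightarrow> \<bar>w\<bar> \<ge> R \<Longrightarrow> cutoff R w = 0"
proof -
  assume "R > 0" "\<bar>w\<bar> \<ge> R"
  then have "1 \<le> \<bar>w / R\<bar>" by (simp add: abs_divide)
  then have "1 \<le> (w / R)\<^sup>2" using abs_le_square_iff[of 1 "w / R"] by simp
  then show ?thesis by (simp add: cutoff_def)
qed

lemma cutoff_continuous [continuous_intros]:
  "R > 0 \<Longrightarrow> continuous_on S f \<Longrightarrow> continuous_on S (\<lambda>x. cutoff R (f x))"
  unfolding cutoff_def by (intro continuous_intros) auto

lemma positive_part_square_derivative:
  "((\<lambda>x::real. (max 0 x)\<^sup>2) has_real_derivative 2 * max 0 x) (at x)"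
proof -
  consider "x > 0" | "x < 0" | "x = 0" by linarith
  then show ?thesis
  proof cases
    case 1
    have "((\<lambda>x::real. x\<^sup>2) has_real_derivative 2 * max 0 x) (at x)"
      using 1 by (auto intro!: derivative_eq_intros)
    then show ?thesis
      by (rule has_field_derivative_transform_within_open[of _ _ _ "{0<..}"]) (use 1 in auto)
  next
    case 2
    have "((\<lambda>x::real. 0) has_real_derivative 2 * max 0 x) (at x)"
      using 2 by (auto intro!: derivative_eq_intros)
    then show ?thesis
      by (rule has_field_derivative_transform_within_open[of _ _ _ "{..<0}"]) (use 2 in auto)
  next
    case 3
    have "((\<lambda>h::real. (max 0 h)\<^sup>2 / h) \<longlongrightarrow> 0) (at 0)"
    proof (rule Lim_null_comparison)
      show "\<forall>\<^sub>F h in at 0. norm ((max 0 h)\<^sup>2 / h) \<le> \<bar>h\<bar>"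
        by (rule always_eventually) (auto simp: max_def power2_eq_square)
      show "((\<lambda>h::real. \<bar>h\<bar>) \<longlongrightarrow> 0) (at 0)"
        by (rule tendsto_rabs_zero[OF tendsto_ident_at])
    qed
    then show ?thesis unfolding 3 by (simp add: DERIV_def)
  qed
qed

definition cutoff_deriv :: "real \<Rightarrow> real \<Rightarrow> real" where
  "cutoff_deriv R w = 2 * max 0 (1 - (w / R)\<^sup>2) * (- 2 * w / R\<^sup>2)"

lemma cutoff_has_derivative:
  "R > 0 \<Longrightarrow> (cutoff R has_real_derivative cutoff_deriv R w) (at w)"
proof -
  assume R: "R > 0"
  have "((\<lambda>w. 1 - (w / R)\<^sup>2) has_real_derivative (- 2 * w / R\<^sup>2)) (at w)"
    using R by (auto intro!: derivative_eq_intros simp: power2_eq_square)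
  from DERIV_chain2[OF positive_part_square_derivative this] show ?thesis
    unfolding cutoff_def cutoff_deriv_def .
qed

definition character :: "int \<Rightarrow> real \<Rightarrow> real \<times> real \<Rightarrow> complex" where
  "character l \<xi> P = iexp (of_int l * fst P) * iexp (\<xi> * snd P)"

lemma fourier_eq_character: "fourier \<mu> l \<xi> = (CLINT P|\<mu>. character l \<xi> P)"
  by (simp add: fourier_def character_def)

lemma norm_character [simp]: "cmod (character l \<xi> P) = 1"
  by (simp add: character_def norm_mult)

lemma character_continuous [continuous_intros]:
  "continuous_on S f \<Longrightarrow> continuous_on S g \<Longrightarrow> continuous_on S (\<lambda>x. character l (f x) (g x))"
  unfolding character_def by (intro continuous_intros)

lemma iexp_linear_derivative:
  "((\<lambda>x. iexp (c * x)) has_vector_derivative \<i> * of_real c * iexp (c * x)) (at x within S)"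
proof -
  have "((\<lambda>z. exp (\<i> * (of_real c * z))) has_field_derivative \<i> * of_real c * exp (\<i> * (of_real c * of_real x))) (at (of_real x))"
    by (auto intro!: derivative_eq_intros)
  from has_vector_derivative_real_field[OF this] show ?thesis by simp
qed

lemma iexp_periodic: "iexp (of_int l * (\<theta> + 2 * pi)) = iexp (of_int l * \<theta>)"
proof -
  have "iexp (of_int l * (\<theta> + 2 * pi)) = iexp (of_int l * \<theta>) * exp (2 * of_int l * of_real pi * \<i>)"
    unfolding exp_add[symmetric] by (simp add: algebra_simps)
  also have "exp (2 * of_int l * of_real pi * \<i>) = 1"
    by (auto simp: exp_eq_1 intro!: exI[of _ l])
  finally show ?thesis by simp
qed

lemma phase_measure:
  assumes "\<mu> \<in> space (prob_algebra phase_space)"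
  shows "prob_space \<mu>" "continuous_on UNIV f \<Longrightarrow> (f :: real \<times> real \<Rightarrow> complex) \<in> borel_measurable \<mu>"
    "continuous_on UNIV f \<Longrightarrow> (\<And>P. cmod (f P) \<le> B) \<Longrightarrow> integrable \<mu> f"
proof -
  have ps: "prob_space \<mu>" and sets: "sets \<mu> = sets phase_space" using assms by (auto simp: space_prob_algebra)
  interpret prob_space \<mu> by (rule ps)
  show "prob_space \<mu>" by (rule ps)
  have *: "f \<in> borel_measurable \<mu>" if "continuous_on UNIV f" for f :: "real \<times> real \<Rightarrow> complex"
    unfolding measurable_cong_sets[OF sets refl] phase_space_def
    by (intro measurable_restrict_space1 borel_measurable_continuous_onI that)
  then show "continuous_on UNIV f \<Longrightarrow> f \<in> borel_measurable \<mu>" .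
  show "integrable \<mu> f" if "continuous_on UNIV f" "(\<And>P. cmod (f P) \<le> B)"
    by (rule integrable_const_bound[of _ B]) (use that * in auto)
qed

lemma norm_phase_integral_le:
  assumes "\<mu> \<in> space (prob_algebra phase_space)" "continuous_on UNIV f" "\<And>P. cmod (f P) \<le> B"
  shows "cmod (CLINT P|\<mu>. f P) \<le> B"
proof -
  interpret prob_space \<mu> by (rule phase_measure(1)[OF assms(1)])
  have "cmod (CLINT P|\<mu>. f P) \<le> (LINT P|\<mu>. B)"
    by (intro order_trans[OF integral_norm_bound integral_mono] integrable_norm phase_measure(3)[OF assms] assms(3)) simp
  then show ?thesis by (simp add: prob_space)
qed

definition cut_fourier :: "real \<Rightarrow> (real \<times> real) measure \<Rightarrow> int \<Rightarrow> real \<Rightarrow> complex" where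
  "cut_fourier R \<mu> l \<xi> = (CLINT P|\<mu>. of_real (cutoff R (snd P)) * character l \<xi> P)"

lemma cut_character_norm: "cmod (of_real (cutoff R (snd P)) * character l \<xi> P) \<le> 1"
  using cutoff_bounds[of R "snd P"] by (simp add: norm_mult)

lemma cut_character_continuous: "R > 0 \<Longrightarrow> continuous_on UNIV (\<lambda>P. of_real (cutoff R (snd P)) * character l \<xi> P)"
  by (intro continuous_intros)

lemma norm_fourier_le_1: "\<mu> \<in> space (prob_algebra phase_space) \<Longrightarrow> cmod (fourier \<mu> l \<xi>) \<le> 1"
  unfolding fourier_eq_character by (rule norm_phase_integral_le) (auto intro!: continuous_intros)

lemma norm_cut_fourier_le_1:
  "\<mu> \<in> space (prob_algebra phase_space) \<Longrightarrow> R > 0 \<Longrightarrow> cmod (cut_fourier R \<mu> l \<xi>) \<le> 1"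
  unfolding cut_fourier_def
  by (rule norm_phase_integral_le) (auto intro!: cut_character_continuous cut_character_norm)

lemma cut_fourier_tendsto:
  assumes "\<mu> \<in> space (prob_algebra phase_space)"
  shows "(\<lambda>n. cut_fourier (real (Suc n)) \<mu> l \<xi>) \<longlonglongrightarrow> fourier \<mu> l \<xi>"
  unfolding cut_fourier_def fourier_eq_character
proof (rule integral_dominated_convergence[where w = "\<lambda>_. 1"])
  interpret prob_space \<mu> by (rule phase_measure(1)[OF assms])
  show "integrable \<mu> (\<lambda>_. 1 :: real)" by simp
  show "character l \<xi> \<in> borel_measurable \<mu>"
    by (rule phase_measure(2)[OF assms]) (intro continuous_intros)
  show "(\<lambda>P. of_real (cutoff (real (Suc n)) (snd P)) * character l \<xi> P) \<in> borel_measurable \<mu>" for n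
    by (rule phase_measure(2)[OF assms]) (rule cut_character_continuous, simp)
  show "AE P in \<mu>. norm (of_real (cutoff (real (Suc n)) (snd P)) * character l \<xi> P) \<le> 1" for n
    using cut_character_norm by simp
  have "(\<lambda>n. cutoff (real (Suc n)) w) \<longlonglongrightarrow> 1" for w
  proof -
    have "(\<lambda>n. w / real (Suc n)) \<longlonglongrightarrow> 0" by (rule LIMSEQ_Suc[OF lim_const_over_n])
    then have "(\<lambda>n. cutoff (real (Suc n)) w) \<longlonglongrightarrow> (max 0 (1 - 0\<^sup>2))\<^sup>2"
      unfolding cutoff_def by (intro tendsto_intros)
    then show ?thesis by simp
  qed
  then have "(\<lambda>n. of_real (cutoff (real (Suc n)) (snd P)) * character l \<xi> P) \<longlonglongrightarrow> of_real 1 * character l \<xi> P" for P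
    by (intro tendsto_intros)
  then show "AE P in \<mu>. (\<lambda>n. of_real (cutoff (real (Suc n)) (snd P)) * character l \<xi> P) \<longlonglongrightarrow> character l \<xi> P"
    by simp
qed

text \<open>
  Without the cut-off the dependence on \<open>\<xi>\<close> would be governed by moments of \<open>\<mu>\<close>, which may be infinite.
\<close>

lemma cut_fourier_lipschitz:
  assumes "\<mu> \<in> space (prob_algebra phase_space)" "R > 0"
  shows "cmod (cut_fourier R \<mu> l \<xi> - cut_fourier R \<mu> l \<xi>') \<le> R * \<bar>\<xi> - \<xi>'\<bar>"
proof -
  have "cut_fourier R \<mu> l \<xi> - cut_fourier R \<mu> l \<xi>' =
     (CLINT P|\<mu>. of_real (cutoff R (snd P)) * character l \<xi> P - of_real (cutoff R (snd P)) * character l \<xi>' P)"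
    unfolding cut_fourier_def
    by (intro Bochner_Integration.integral_diff[symmetric] phase_measure(3)[OF assms(1), where B = 1]
          cut_character_continuous cut_character_norm assms(2))
  also have "cmod \<dots> \<le> R * \<bar>\<xi> - \<xi>'\<bar>"
  proof (rule norm_phase_integral_le[OF assms(1)])
    fix P :: "real \<times> real"
    have "cmod (character l \<xi> P - character l \<xi>' P) \<le> \<bar>\<xi> - \<xi>'\<bar> * \<bar>snd P\<bar>"
    proof -
      have "character l \<xi> P - character l \<xi>' P = character l \<xi>' P * (iexp ((\<xi> - \<xi>') * snd P) - 1)"
        unfolding character_def right_diff_distrib mult.assoc exp_add[symmetric] by (simp add: algebra_simps)
      moreover have "cmod (iexp ((\<xi> - \<xi>') * snd P) - 1) \<le> \<bar>\<xi> - \<xi>'\<bar> * \<bar>snd P\<bar>"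
        using iexp_approx1[of "(\<xi> - \<xi>') * snd P" 0] by (simp add: abs_mult)
      ultimately show ?thesis by (simp add: norm_mult)
    qed
    moreover have "cutoff R (snd P) * (\<bar>\<xi> - \<xi>'\<bar> * \<bar>snd P\<bar>) \<le> \<bar>\<xi> - \<xi>'\<bar> * R"
    proof (cases "\<bar>snd P\<bar> \<ge> R")
      case False
      then show ?thesis using cutoff_bounds[of R "snd P"] assms(2)
        by (intro order_trans[OF mult_left_le_one_le] mult_left_mono) auto
    qed (use assms(2) cutoff_eq_0 in auto)
    ultimately show "cmod (of_real (cutoff R (snd P)) * character l \<xi> P - of_real (cutoff R (snd P)) * character l \<xi>' P) \<le> R * \<bar>\<xi> - \<xi>'\<bar>"
      using cutoff_bounds[of R "snd P"] mult_left_mono[of "cmod (character l \<xi> P - character l \<xi>' P)" "\<bar>\<xi> - \<xi>'\<bar> * \<bar>snd P\<bar>" "cutoff R (snd P)"]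
      by (simp add: norm_mult mult.commute[of R] flip: right_diff_distrib)
  qed (intro continuous_on_diff cut_character_continuous assms(2))
  finally show ?thesis .
qed

text \<open>
  The phase \<open>\<xi> - l t\<close> follows the free transport, so that the unbounded term \<open>\<omega> \<partial>\<^sub>\<theta>\<close> cancels against the time
  derivative (\<open>wave_transport\<close> below) and only the mean-field coupling to the neighbouring modes \<open>l - 1\<close> and \<open>l + 1\<close> remains.
\<close>

definition wave :: "real \<Rightarrow> int \<Rightarrow> real \<Rightarrow> (real \<Rightarrow> complex) \<Rightarrow> real \<Rightarrow> real \<times> real \<Rightarrow> complex" where
  "wave R l \<xi> \<psi> t P = \<psi> t * (of_real (cutoff R (snd P)) * character l (\<xi> - of_int l * t) P)"

lemma character_shift: "character l \<xi> (\<theta> + 2 * pi, \<omega>) = character l \<xi> (\<theta>, \<omega>)"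
  unfolding character_def fst_conv snd_conv iexp_periodic ..

lemma character_periodic: "theta_periodic (character l \<xi>)"
  by (simp add: theta_periodic_def character_shift)

lemma character_derivs:
  "((\<lambda>s. character l (\<xi> - of_int l * s) P) has_vector_derivative
      - (\<i> * of_int l * of_real (snd P)) * character l (\<xi> - of_int l * t) P) (at t within S)"
  "((\<lambda>x. character l \<zeta> (x, w)) has_vector_derivative \<i> * of_int l * character l \<zeta> (\<theta>, w)) (at \<theta> within S)"
  "((\<lambda>v. character l \<zeta> (\<theta>, v)) has_vector_derivative \<i> * of_real \<zeta> * character l \<zeta> (\<theta>, w)) (at w within S)"
proof -
  have split: "iexp ((\<xi> - of_int l * s) * snd P) = iexp (\<xi> * snd P) * iexp (- (of_int l * snd P) * s)" for s
    unfolding exp_add[symmetric] by (simp add: algebra_simps)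
  have "((\<lambda>s. iexp (of_int l * fst P) * (iexp (\<xi> * snd P) * iexp (- (of_int l * snd P) * s))) has_vector_derivative
      iexp (of_int l * fst P) * (iexp (\<xi> * snd P) * (\<i> * of_real (- (of_int l * snd P)) * iexp (- (of_int l * snd P) * t)))) (at t within S)"
    by (intro has_vector_derivative_mult_right iexp_linear_derivative)
  then show "((\<lambda>s. character l (\<xi> - of_int l * s) P) has_vector_derivative
      - (\<i> * of_int l * of_real (snd P)) * character l (\<xi> - of_int l * t) P) (at t within S)"
    unfolding character_def split by (simp add: mult_ac)
  have "((\<lambda>x. iexp (of_int l * x) * iexp (\<zeta> * w)) has_vector_derivative
      \<i> * of_real (of_int l) * iexp (of_int l * \<theta>) * iexp (\<zeta> * w)) (at \<theta> within S)"
    by (intro has_vector_derivative_mult_left iexp_linear_derivative)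
  then show "((\<lambda>x. character l \<zeta> (x, w)) has_vector_derivative \<i> * of_int l * character l \<zeta> (\<theta>, w)) (at \<theta> within S)"
    unfolding character_def by (simp add: mult_ac)
  have "((\<lambda>v. iexp (of_int l * \<theta>) * iexp (\<zeta> * v)) has_vector_derivative
      iexp (of_int l * \<theta>) * (\<i> * of_real \<zeta> * iexp (\<zeta> * w))) (at w within S)"
    by (intro has_vector_derivative_mult_right iexp_linear_derivative)
  then show "((\<lambda>v. character l \<zeta> (\<theta>, v)) has_vector_derivative \<i> * of_real \<zeta> * character l \<zeta> (\<theta>, w)) (at w within S)"
    unfolding character_def by (simp add: mult_ac)
qed

context
  fixes R \<xi> N :: real and l :: int and \<psi> p :: "real \<Rightarrow> complex"
  assumes R: "R > 0" and pcont: "continuous_on {0..} p"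
    and pder: "\<And>t. t \<ge> 0 \<Longrightarrow> (\<psi> has_vector_derivative p t) (at t within {0..})"
    and \<psi>0: "\<And>t. t \<ge> N \<Longrightarrow> \<psi> t = 0"
begin

lemma wave_derivs:
  "t \<ge> 0 \<Longrightarrow> ((\<lambda>s. wave R l \<xi> \<psi> s P) has_vector_derivative
     (p t - \<i> * of_int l * of_real (snd P) * \<psi> t) * (of_real (cutoff R (snd P)) * character l (\<xi> - of_int l * t) P)) (at t within {0..})"
  "((\<lambda>x. wave R l \<xi> \<psi> t (x, w)) has_vector_derivative \<i> * of_int l * wave R l \<xi> \<psi> t (\<theta>, w)) (at \<theta>)"
  "((\<lambda>v. wave R l \<xi> \<psi> t (\<theta>, v)) has_vector_derivative
      \<psi> t * (of_real (cutoff_deriv R w) + of_real (cutoff R w) * (\<i> * of_real (\<xi> - of_int l * t)))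
        * character l (\<xi> - of_int l * t) (\<theta>, w)) (at w)"
proof -
  show "((\<lambda>s. wave R l \<xi> \<psi> s P) has_vector_derivative
     (p t - \<i> * of_int l * of_real (snd P) * \<psi> t) * (of_real (cutoff R (snd P)) * character l (\<xi> - of_int l * t) P)) (at t within {0..})"
    if "t \<ge> 0"
    using has_vector_derivative_mult[OF pder[OF that] has_vector_derivative_mult_right[OF character_derivs(1)]]
    unfolding wave_def by (rule has_vector_derivative_eq_rhs) (simp add: algebra_simps)
  show "((\<lambda>x. wave R l \<xi> \<psi> t (x, w)) has_vector_derivative \<i> * of_int l * wave R l \<xi> \<psi> t (\<theta>, w)) (at \<theta>)"
    using has_vector_derivative_mult_right[OF has_vector_derivative_mult_right[OF character_derivs(2)[of l _ w \<theta> UNIV]], of "\<psi> t" "of_real (cutoff R w)" "\<xi> - of_int l * t"]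
    unfolding wave_def by (simp add: mult_ac)
  have "((\<lambda>v. complex_of_real (cutoff R v)) has_vector_derivative of_real (cutoff_deriv R w)) (at w)"
    by (rule bounded_linear.has_vector_derivative[OF bounded_linear_of_real])
       (use cutoff_has_derivative[OF R, of w] in \<open>simp add: has_real_derivative_iff_has_vector_derivative\<close>)
  from has_vector_derivative_mult_right[OF has_vector_derivative_mult[OF this character_derivs(3)[of l _ \<theta> w UNIV]], of "\<psi> t" "\<xi> - of_int l * t"]
  show "((\<lambda>v. wave R l \<xi> \<psi> t (\<theta>, v)) has_vector_derivative
      \<psi> t * (of_real (cutoff_deriv R w) + of_real (cutoff R w) * (\<i> * of_real (\<xi> - of_int l * t)))
        * character l (\<xi> - of_int l * t) (\<theta>, w)) (at w)"
    unfolding wave_def snd_conv by (rule has_vector_derivative_eq_rhs) (simp add: algebra_simps)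
qed

lemma wave_partials:
  "t \<ge> 0 \<Longrightarrow> partial_t (wave R l \<xi> \<psi>) t P =
     (p t - \<i> * of_int l * of_real (snd P) * \<psi> t) * (of_real (cutoff R (snd P)) * character l (\<xi> - of_int l * t) P)"
  "partial_theta (wave R l \<xi> \<psi>) t P = \<i> * of_int l * wave R l \<xi> \<psi> t P"
  "partial_omega (wave R l \<xi> \<psi>) t P = 
      \<psi> t * (of_real (cutoff_deriv R (snd P)) + of_real (cutoff R (snd P)) * (\<i> * of_real (\<xi> - of_int l * t)))
        * character l (\<xi> - of_int l * t) P"
proof -
  show "partial_t (wave R l \<xi> \<psi>) t P =
     (p t - \<i> * of_int l * of_real (snd P) * \<psi> t) * (of_real (cutoff R (snd P)) * character l (\<xi> - of_int l * t) P)" if "t \<ge> 0"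
    unfolding partial_t_def using that by (intro vector_derivative_within at_within_atLeast_neq_bot wave_derivs(1))
  show "partial_theta (wave R l \<xi> \<psi>) t P = \<i> * of_int l * wave R l \<xi> \<psi> t P"
    unfolding partial_theta_def using vector_derivative_at[OF wave_derivs(2)[of t "snd P" "fst P"]] by simp
  show "partial_omega (wave R l \<xi> \<psi>) t P = 
      \<psi> t * (of_real (cutoff_deriv R (snd P)) + of_real (cutoff R (snd P)) * (\<i> * of_real (\<xi> - of_int l * t)))
        * character l (\<xi> - of_int l * t) P"
    unfolding partial_omega_def using vector_derivative_at[OF wave_derivs(3)[of t "fst P" "snd P"]] by simp
qed

lemma wave_test_function: "wave R l \<xi> \<psi> \<in> test_functions"
proof -
  have \<psi>cont: "continuous_on {0..} \<psi>"
    by (rule continuous_on_vector_derivative[OF pder]) simp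
  have c\<psi>: "continuous_on ({0..} \<times> (UNIV :: (real \<times> real) set)) (\<lambda>x. \<psi> (fst x))"
    by (rule continuous_on_compose2[OF \<psi>cont]) (auto intro!: continuous_intros)
  have cp: "continuous_on ({0..} \<times> (UNIV :: (real \<times> real) set)) (\<lambda>x. p (fst x))"
    by (rule continuous_on_compose2[OF pcont]) (auto intro!: continuous_intros)
  have "theta_periodic (wave R l \<xi> \<psi> t)" for t
    unfolding theta_periodic_def wave_def character_shift snd_conv by simp
  moreover have "(\<lambda>s. wave R l \<xi> \<psi> s (\<theta>, \<omega>)) differentiable (at t within {0..})" if "t \<ge> 0" for t \<theta> \<omega>
    using wave_derivs(1)[OF that] by (rule differentiableI_vector)
  moreover have "(\<lambda>x. wave R l \<xi> \<psi> t (x, \<omega>)) differentiable (at \<theta>)" for t \<theta> \<omega>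
    using wave_derivs(2) by (rule differentiableI_vector)
  moreover have "(\<lambda>w. wave R l \<xi> \<psi> t (\<theta>, w)) differentiable (at \<omega>)" for t \<theta> \<omega>
    using wave_derivs(3) by (rule differentiableI_vector)
  moreover have "continuous_on ({0..} \<times> UNIV) (\<lambda>(t, P). partial_t (wave R l \<xi> \<psi>) t P)"
  proof (subst continuous_on_cong[OF refl])
    show "continuous_on ({0..} \<times> UNIV) (\<lambda>x. (p (fst x) - \<i> * of_int l * of_real (snd (snd x)) * \<psi> (fst x)) * 
        (of_real (cutoff R (snd (snd x))) * character l (\<xi> - of_int l * fst x) (snd x)))"
      by (intro continuous_intros cp c\<psi> R)
  qed (auto simp: wave_partials(1))
  moreover have "continuous_on ({0..} \<times> UNIV) (\<lambda>(t, P). partial_theta (wave R l \<xi> \<psi>) t P)"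
    unfolding wave_partials(2) case_prod_beta wave_def by (intro continuous_intros c\<psi> R)
  moreover have "continuous_on ({0..} \<times> UNIV) (\<lambda>(t, P). partial_omega (wave R l \<xi> \<psi>) t P)"
    unfolding wave_partials(3) case_prod_beta cutoff_deriv_def using R by (intro continuous_intros c\<psi> R) auto
  moreover have "\<exists>M. \<forall>t\<ge>0. \<forall>\<theta> \<omega>. wave R l \<xi> \<psi> t (\<theta>, \<omega>) \<noteq> 0 \<longrightarrow> t \<le> M \<and> \<bar>\<omega>\<bar> \<le> M"
  proof (intro exI[of _ "max N R"] allI impI)
    fix t \<theta> \<omega> assume "wave R l \<xi> \<psi> t (\<theta>, \<omega>) \<noteq> 0"
    then have "\<psi> t \<noteq> 0" "cutoff R \<omega> \<noteq> 0" by (auto simp: wave_def)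
    then have "\<not> t \<ge> N" "\<not> \<bar>\<omega>\<bar> \<ge> R" using \<psi>0 cutoff_eq_0[OF R] by blast+
    then show "t \<le> max N R \<and> \<bar>\<omega>\<bar> \<le> max N R" by auto
  qed
  ultimately show ?thesis unfolding test_functions_def by blast
qed

lemma wave_transport:
  assumes "t \<ge> 0"
  shows "velocity K \<mu> P * partial_theta (wave R l \<xi> \<psi>) t P + partial_t (wave R l \<xi> \<psi>) t P =
    p t * (of_real (cutoff R (snd P)) * character l (\<xi> - of_int l * t) P) +
    \<psi> t * (of_int l * of_real K / 2 * (order_parameter \<mu> * (of_real (cutoff R (snd P)) * character (l - 1) (\<xi> - of_int l * t) P)
         - cnj (order_parameter \<mu>) * (of_real (cutoff R (snd P)) * character (l + 1) (\<xi> - of_int l * t) P)))"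
proof -
  have shift: "iexp (- fst P) * character l \<zeta> P = character (l - 1) \<zeta> P" "iexp (fst P) * character l \<zeta> P = character (l + 1) \<zeta> P" for \<zeta>
    unfolding character_def mult.assoc[symmetric] exp_add[symmetric] by (simp_all add: algebra_simps)
  have alg: "(w + k / (2 * \<i>) * (e * em - e' * ep)) * (\<i> * L * (ps * (x * y))) + (pt - \<i> * L * w * ps) * (x * y)
      = pt * (x * y) + ps * (L * k / 2 * (e * (x * (em * y)) - e' * (x * (ep * y))))" for w k e em e' ep L ps x y pt :: complex
    by (simp add: field_simps)
  show ?thesis
    unfolding wave_partials(1)[OF assms] wave_partials(2) velocity_def wave_def alg shift ..
qed

end

lemma kuramoto_solution_D:
  assumes "kuramoto_solution K \<rho>_in \<rho>"
  shows "t \<ge> 0 \<Longrightarrow> \<rho> t \<in> space (prob_algebra phase_space)"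
    and "theta_periodic f \<Longrightarrow> continuous_on UNIV f \<Longrightarrow> (\<And>P. cmod (f P) \<le> B) \<Longrightarrow> continuous_on {0..} (\<lambda>t. CLINT P|\<rho> t. f P)"
    and "h \<in> test_functions \<Longrightarrow>
        0 = (CLINT P|\<rho>_in. h 0 P) +
            (CLINT t:{0..}|lborel.
               (CLINT P|\<rho> t. velocity K (\<rho> t) P * partial_theta h t P + partial_t h t P))"
  using assms unfolding kuramoto_solution_def phase_Cb_def bounded_iff by blast+

lemma order_parameter_continuous:
  assumes "kuramoto_solution K \<rho>_in \<rho>"
  shows "continuous_on {0..} (\<lambda>t. order_parameter (\<rho> t))"
  unfolding order_parameter_eq_fourier fourier_eq_character
  by (rule kuramoto_solution_D(2)[OF assms character_periodic, of _ _ 1]) (auto intro!: continuous_intros)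

text \<open>
  The integrand moves with \<open>t\<close> as well, which weak continuity alone does not cover; the Lipschitz bound in \<open>\<xi>\<close>
  takes care of that.
\<close>

lemma cut_fourier_continuous:
  assumes sol: "kuramoto_solution K \<rho>_in \<rho>" and R: "R > 0"
  shows "continuous_on {0..} (\<lambda>t. cut_fourier R (\<rho> t) j (\<xi> - c * t))"
  unfolding continuous_on_def
proof
  fix t0 :: real assume t0: "t0 \<in> {0..}"
  have "continuous_on {0..} (\<lambda>t. cut_fourier R (\<rho> t) j (\<xi> - c * t0))"
    unfolding cut_fourier_def
  proof (rule kuramoto_solution_D(2)[OF sol _ cut_character_continuous[OF R] cut_character_norm])
    show "theta_periodic (\<lambda>P. of_real (cutoff R (snd P)) * character j (\<xi> - c * t0) P)"
      by (simp add: theta_periodic_def character_shift)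
  qed
  with t0 have 1: "((\<lambda>t. cut_fourier R (\<rho> t) j (\<xi> - c * t0)) \<longlongrightarrow> cut_fourier R (\<rho> t0) j (\<xi> - c * t0)) (at t0 within {0..})"
    by (simp add: continuous_on_def)
  have 2: "((\<lambda>t. cut_fourier R (\<rho> t) j (\<xi> - c * t) - cut_fourier R (\<rho> t) j (\<xi> - c * t0)) \<longlongrightarrow> 0) (at t0 within {0..})"
  proof (rule Lim_null_comparison)
    have "cmod (cut_fourier R (\<rho> t) j (\<xi> - c * t) - cut_fourier R (\<rho> t) j (\<xi> - c * t0)) \<le> R * \<bar>(\<xi> - c * t) - (\<xi> - c * t0)\<bar>" if "t \<in> {0..}" for t
      using that by (intro cut_fourier_lipschitz kuramoto_solution_D(1)[OF sol] R) auto
    then show "\<forall>\<^sub>F t in at t0 within {0..}. cmod (cut_fourier R (\<rho> t) j (\<xi> - c * t) - cut_fourier R (\<rho> t) j (\<xi> - c * t0)) \<le> R * \<bar>(\<xi> - c * t) - (\<xi> - c * t0)\<bar>"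
      by (auto simp: eventually_at_filter)
    have "((\<lambda>t. R * \<bar>(\<xi> - c * t) - (\<xi> - c * t0)\<bar>) \<longlongrightarrow> R * \<bar>(\<xi> - c * t0) - (\<xi> - c * t0)\<bar>) (at t0 within {0..})"
      by (intro tendsto_intros)
    then show "((\<lambda>t. R * \<bar>(\<xi> - c * t) - (\<xi> - c * t0)\<bar>) \<longlongrightarrow> 0) (at t0 within {0..})" by simp
  qed
  from tendsto_add[OF 2 1]
  show "((\<lambda>t. cut_fourier R (\<rho> t) j (\<xi> - c * t)) \<longlongrightarrow> cut_fourier R (\<rho> t0) j (\<xi> - c * t0)) (at t0 within {0..})"
    by simp
qed

lemma cut_fourier_duhamel:
  assumes sol: "kuramoto_solution K \<rho>_in \<rho>" and R: "R > 0" and t: "t \<ge> 0"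
  shows "cut_fourier R (\<rho> t) l (\<xi> - of_int l * t) = cut_fourier R \<rho>_in l \<xi> +
    (CLINT s:{0..t}|lborel. of_int l * of_real K / 2 *
       (order_parameter (\<rho> s) * cut_fourier R (\<rho> s) (l - 1) (\<xi> - of_int l * s)
        - cnj (order_parameter (\<rho> s)) * cut_fourier R (\<rho> s) (l + 1) (\<xi> - of_int l * s)))"
proof (rule weak_ode_imp_integral_equation[OF _ _ _ t])
  show "continuous_on {0..} (\<lambda>t. cut_fourier R (\<rho> t) l (\<xi> - of_int l * t))"
    by (rule cut_fourier_continuous[OF sol R])
  show "continuous_on {0..} (\<lambda>s. of_int l * of_real K / 2 *
       (order_parameter (\<rho> s) * cut_fourier R (\<rho> s) (l - 1) (\<xi> - of_int l * s)
        - cnj (order_parameter (\<rho> s)) * cut_fourier R (\<rho> s) (l + 1) (\<xi> - of_int l * s)))"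
    by (intro continuous_intros cut_fourier_continuous[OF sol R] order_parameter_continuous[OF sol])
  fix \<psi> p :: "real \<Rightarrow> complex" and N :: real
  assume p: "continuous_on {0..} p" "\<And>t. t \<ge> 0 \<Longrightarrow> (\<psi> has_vector_derivative p t) (at t within {0..})"
    "\<And>t. t \<ge> N \<Longrightarrow> \<psi> t = 0" "\<And>t. t \<ge> N \<Longrightarrow> p t = 0"
  have "wave R l \<xi> \<psi> \<in> test_functions"
    by (rule wave_test_function[OF R p(1)]) (use p in auto)
  note W = kuramoto_solution_D(3)[OF sol this]
  have init: "(CLINT P|\<rho>_in. wave R l \<xi> \<psi> 0 P) = \<psi> 0 * cut_fourier R \<rho>_in l \<xi>"
    by (simp add: wave_def cut_fourier_def)
  have step: "(CLINT P|\<rho> t. velocity K (\<rho> t) P * partial_theta (wave R l \<xi> \<psi>) t P + partial_t (wave R l \<xi> \<psi>) t P) =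
      p t * cut_fourier R (\<rho> t) l (\<xi> - of_int l * t) + \<psi> t * (of_int l * of_real K / 2 *
       (order_parameter (\<rho> t) * cut_fourier R (\<rho> t) (l - 1) (\<xi> - of_int l * t)
        - cnj (order_parameter (\<rho> t)) * cut_fourier R (\<rho> t) (l + 1) (\<xi> - of_int l * t)))" if t: "t \<ge> 0" for t
  proof -
    have i: "integrable (\<rho> t) (\<lambda>P. of_real (cutoff R (snd P)) * character j \<zeta> P)" for j \<zeta>
      by (rule phase_measure(3)[OF kuramoto_solution_D(1)[OF sol t], where B = 1])
         (auto intro!: cut_character_continuous cut_character_norm R)
    have "velocity K (\<rho> t) P * partial_theta (wave R l \<xi> \<psi>) t P + partial_t (wave R l \<xi> \<psi>) t P =
      p t * (of_real (cutoff R (snd P)) * character l (\<xi> - of_int l * t) P) +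
      \<psi> t * (of_int l * of_real K / 2 * (order_parameter (\<rho> t) * (of_real (cutoff R (snd P)) * character (l - 1) (\<xi> - of_int l * t) P)
         - cnj (order_parameter (\<rho> t)) * (of_real (cutoff R (snd P)) * character (l + 1) (\<xi> - of_int l * t) P)))" for P
      by (rule wave_transport[OF R p(1) _ _ t]) (use p in auto)
    then show ?thesis
      unfolding cut_fourier_def
      using i by (simp add: Bochner_Integration.integral_add Bochner_Integration.integral_diff)
  qed
  show "0 = \<psi> 0 * cut_fourier R \<rho>_in l \<xi> + (CLINT t:{0..}|lborel. 
      p t * cut_fourier R (\<rho> t) l (\<xi> - of_int l * t) + \<psi> t * (of_int l * of_real K / 2 *
       (order_parameter (\<rho> t) * cut_fourier R (\<rho> t) (l - 1) (\<xi> - of_int l * t)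
        - cnj (order_parameter (\<rho> t)) * cut_fourier R (\<rho> t) (l + 1) (\<xi> - of_int l * t))))"
    unfolding init[symmetric]
    by (subst W, intro arg_cong2[where f = "(+)"] refl set_lebesgue_integral_cong allI impI step) auto
qed

text \<open>
  The formula holds with a cut-off in \<open>\<omega>\<close>; both sides converge as the cut-off is removed, by dominated
  convergence first in phase space and then in time.
\<close>

lemma kuramoto_duhamel:
  assumes sol: "kuramoto_solution K \<rho>_in \<rho>" and \<rho>_in: "\<rho>_in \<in> space (prob_algebra phase_space)" and t: "t \<ge> 0"
  defines "b \<equiv> \<lambda>l \<xi> s. of_int l * of_real K / 2 *
       (order_parameter (\<rho> s) * fourier (\<rho> s) (l - 1) (\<xi> - of_int l * s)
        - cnj (order_parameter (\<rho> s)) * fourier (\<rho> s) (l + 1) (\<xi> - of_int l * s))"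
  shows "set_integrable lborel {0..t} (b l \<xi>)"
    and "fourier (\<rho> t) l (\<xi> - of_int l * t) = fourier \<rho>_in l \<xi> + (CLINT s:{0..t}|lborel. b l \<xi> s)"
proof -
  define c where "c n s = of_int l * of_real K / 2 *
       (order_parameter (\<rho> s) * cut_fourier (real (Suc n)) (\<rho> s) (l - 1) (\<xi> - of_int l * s)
        - cnj (order_parameter (\<rho> s)) * cut_fourier (real (Suc n)) (\<rho> s) (l + 1) (\<xi> - of_int l * s))" for n s
  have op: "cmod (order_parameter (\<rho> s)) \<le> 1" if "s \<ge> 0" for s
    unfolding order_parameter_eq_fourier by (rule norm_fourier_le_1[OF kuramoto_solution_D(1)[OF sol that]])
  have bound: "cmod (of_int l * of_real K / 2 * (e * x - cnj e * y)) \<le> \<bar>of_int l * K\<bar>" 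
    if "cmod e \<le> 1" "cmod x \<le> 1" "cmod y \<le> 1" for e x y :: complex
  proof -
    have "cmod (e * x - cnj e * y) \<le> cmod e * cmod x + cmod e * cmod y"
      using norm_triangle_ineq4[of "e * x" "cnj e * y"] by (simp add: norm_mult)
    also have "\<dots> \<le> 1 * 1 + 1 * 1" using that by (intro add_mono mult_mono) auto
    finally have "\<bar>of_int l * K\<bar> / 2 * cmod (e * x - cnj e * y) \<le> \<bar>of_int l * K\<bar> / 2 * 2"
      by (intro mult_left_mono) auto
    then show ?thesis by (simp add: norm_mult norm_divide abs_mult)
  qed
  have cb: "cmod (c n s) \<le> \<bar>of_int l * K\<bar>" if "s \<ge> 0" for n s
    unfolding c_def using that by (intro bound op norm_cut_fourier_le_1 kuramoto_solution_D(1)[OF sol]) auto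
  have lim: "(\<lambda>n. c n s) \<longlonglongrightarrow> b l \<xi> s" if "s \<ge> 0" for s
    unfolding c_def b_def by (intro tendsto_intros cut_fourier_tendsto kuramoto_solution_D(1)[OF sol that]) 
  have ccont: "continuous_on {0..t} (c n)" for n
    unfolding c_def
    by (intro continuous_intros continuous_on_subset[OF cut_fourier_continuous[OF sol]]
         continuous_on_subset[OF order_parameter_continuous[OF sol]]) auto
  have meas: "(\<lambda>s. indicator {0..t} s *\<^sub>R c n s) \<in> borel_measurable lborel" for n
    using borel_measurable_continuous_on_indicator[OF _ ccont] by simp
  have lim': "(\<lambda>n. indicator {0..t} s *\<^sub>R c n s) \<longlonglongrightarrow> indicator {0..t} s *\<^sub>R b l \<xi> s" for s
    using lim[of s] by (cases "s \<in> {0..t}") (auto intro!: tendsto_intros)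
  have measb: "(\<lambda>s. indicator {0..t} s *\<^sub>R b l \<xi> s) \<in> borel_measurable lborel"
    by (rule borel_measurable_LIMSEQ_metric[OF meas lim'])
  have dom: "integrable lborel (\<lambda>s. indicator {0..t} s *\<^sub>R \<bar>of_int l * K\<bar>)"
    using borel_integrable_atLeastAtMost'[of 0 t "\<lambda>_. \<bar>of_int l * K\<bar>"] by (simp add: set_integrable_def)
  have domb: "norm (indicator {0..t} s *\<^sub>R c n s) \<le> indicator {0..t} s *\<^sub>R \<bar>of_int l * K\<bar>" for n s
    using cb[of s n] by (auto simp: indicator_def)
  have conv: "(\<lambda>n. CLINT s:{0..t}|lborel. c n s) \<longlonglongrightarrow> (CLINT s:{0..t}|lborel. b l \<xi> s)"
    unfolding set_lebesgue_integral_def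
    by (rule integral_dominated_convergence[OF measb meas dom AE_I2[OF lim'] AE_I2[OF domb]])
  show "set_integrable lborel {0..t} (b l \<xi>)"
    unfolding set_integrable_def
    by (rule integrable_dominated_convergence[OF measb meas dom AE_I2[OF lim'] AE_I2[OF domb]])
  have "(\<lambda>n. cut_fourier (real (Suc n)) \<rho>_in l \<xi> + (CLINT s:{0..t}|lborel. c n s)) \<longlonglongrightarrow> fourier \<rho>_in l \<xi> + (CLINT s:{0..t}|lborel. b l \<xi> s)"
    by (intro tendsto_add conv cut_fourier_tendsto \<rho>_in)
  moreover have "cut_fourier (real (Suc n)) \<rho>_in l \<xi> + (CLINT s:{0..t}|lborel. c n s) = cut_fourier (real (Suc n)) (\<rho> t) l (\<xi> - of_int l * t)" for n
    unfolding c_def by (rule cut_fourier_duhamel[OF sol _ t, symmetric]) simp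
  moreover have "(\<lambda>n. cut_fourier (real (Suc n)) (\<rho> t) l (\<xi> - of_int l * t)) \<longlonglongrightarrow> fourier (\<rho> t) l (\<xi> - of_int l * t)"
    by (rule cut_fourier_tendsto[OF kuramoto_solution_D(1)[OF sol t]])
  ultimately show "fourier (\<rho> t) l (\<xi> - of_int l * t) = fourier \<rho>_in l \<xi> + (CLINT s:{0..t}|lborel. b l \<xi> s)"
    using LIMSEQ_unique by fastforce
qed

lemma fourier_zero_mode:
  assumes "kuramoto_solution K \<rho>_in \<rho>" "\<rho>_in \<in> space (prob_algebra phase_space)" "t \<ge> 0"
  shows "fourier (\<rho> t) 0 \<xi> = char (distr \<rho>_in borel snd) \<xi>"
proof -
  have "fourier (\<rho> t) 0 \<xi> = fourier \<rho>_in 0 \<xi>"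
    using kuramoto_duhamel(2)[OF assms, of 0 \<xi>] by simp
  also have "\<dots> = char (distr \<rho>_in borel snd) \<xi>"
  proof -
    have "sets \<rho>_in = sets phase_space" using assms(2) by (simp add: space_prob_algebra)
    then have "snd \<in> borel_measurable \<rho>_in"
      unfolding measurable_cong_sets[OF _ refl] phase_space_def
      by (subst measurable_cong_sets[of _ "restrict_space borel ({0..<2 * pi} \<times> UNIV)"])
         (auto intro!: measurable_restrict_space1 borel_measurable_continuous_onI continuous_intros simp: phase_space_def)
    then show ?thesis
      unfolding char_def fourier_def by (subst integral_distr) (auto simp: borel_measurable_continuous_onI intro!: borel_measurable_continuous_onI continuous_intros)
  qed
  finally show ?thesis .
qed

section \<open>Bootstrap for the hierarchy of Fourier modes\<close>

lemma exp_interval_integral: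
  assumes "c \<noteq> 0" "t \<ge> 0"
  shows "set_integrable lborel {0..t} (\<lambda>s. exp (c * s) :: real)"
    and "(LINT s:{0..t}|lborel. exp (c * s)) = (exp (c * t) - 1) / c"
proof -
  show "set_integrable lborel {0..t} (\<lambda>s. exp (c * s) :: real)"
    by (intro borel_integrable_atLeastAtMost' continuous_intros)
  have "((\<lambda>s. exp (c * s) / c) has_vector_derivative exp (c * s)) (at s within {0..t})" for s
    using assms(1) by (auto intro!: derivative_eq_intros simp flip: has_real_derivative_iff_has_vector_derivative)
  then show "(LINT s:{0..t}|lborel. exp (c * s)) = (exp (c * t) - 1) / c"
    unfolding set_lebesgue_integral_def
    by (subst integral_FTC_Icc[OF assms(2), of "\<lambda>s. exp (c * s) / c"])
       (auto intro!: continuous_intros simp: diff_divide_distrib)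
qed

lemma set_integral_norm_le:
  fixes f :: "real \<Rightarrow> complex"
  assumes "set_integrable lborel A f" "set_integrable lborel A g" "\<And>s. s \<in> A \<Longrightarrow> cmod (f s) \<le> g s"
  shows "cmod (CLINT s:A|lborel. f s) \<le> (LINT s:A|lborel. g s)"
  by (rule order_trans[OF set_integral_norm_bound set_integral_mono])
     (use assms in \<open>auto intro: set_integrable_norm\<close>)

text \<open>
  The Fourier side of the problem by itself: \<open>u\<close> solves the Duhamel formula, \<open>g\<close> is the time-independent zeroth mode
  with weighted integral \<open>\<Gamma>\<close>, \<open>M\<close> bounds the weighted data, and \<open>C\<close> is the constant in the stability
  estimate for the Volterra kernel, weighted by \<open>exp (a t)\<close>.
\<close>

locale mode_hierarchy =
  fixes K a M :: real and u :: "real \<Rightarrow> int \<Rightarrow> real \<Rightarrow> complex"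
    and u\<^sub>0 :: "int \<Rightarrow> real \<Rightarrow> complex" and g :: "real \<Rightarrow> complex" and \<Gamma> C :: real
  assumes K: "K \<ge> 0" and a: "a > 0" and M: "M > 0" and C: "C \<ge> 1"
    and u_bound: "\<And>t l \<xi>. t \<ge> 0 \<Longrightarrow> cmod (u t l \<xi>) \<le> 1"
    and u_zero: "\<And>t \<xi>. t \<ge> 0 \<Longrightarrow> u t 0 \<xi> = g \<xi>"
    and duhamel_integrable: "\<And>t l \<xi>. t \<ge> 0 \<Longrightarrow> set_integrable lborel {0..t} (\<lambda>s. of_int l * of_real K / 2 *
       (u s 1 0 * u s (l - 1) (\<xi> - of_int l * s) - cnj (u s 1 0) * u s (l + 1) (\<xi> - of_int l * s)))"
    and duhamel: "\<And>t l \<xi>. t \<ge> 0 \<Longrightarrow> u t l (\<xi> - of_int l * t) = u\<^sub>0 l \<xi> + (CLINT s:{0..t}|lborel. of_int l * of_real K / 2 *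
       (u s 1 0 * u s (l - 1) (\<xi> - of_int l * s) - cnj (u s 1 0) * u s (l + 1) (\<xi> - of_int l * s)))"
    and order_continuous: "continuous_on {0..} (\<lambda>t. u t 1 0)"
    and g_continuous: "continuous_on UNIV g"
    and g_integrable: "integrable lborel (\<lambda>x. exp (a * x) * cmod (g x))"
    and g_integral: "(LINT x|lborel. exp (a * x) * cmod (g x)) = \<Gamma>"
    and initial: "\<And>l \<xi>. l \<ge> 1 \<Longrightarrow> cmod (u\<^sub>0 l \<xi>) * exp (a * \<xi>) \<le> M"
    and stability: "\<And>f T B t. bounded_borel f \<Longrightarrow>
       (\<And>t. t \<le> T \<Longrightarrow> cmod (f t + conv (\<lambda>t. if t < 0 then 0 else of_real (exp (a * t)) * (- (of_real K / 2) * g t)) f t) \<le> B) \<Longrightarrow>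
       t \<le> T \<Longrightarrow> cmod (f t) \<le> C * B"
begin

lemma \<Gamma>_nonneg: "\<Gamma> \<ge> 0"
  unfolding g_integral[symmetric] by (rule integral_nonneg_AE) auto

lemma g_shift:
  shows "set_integrable lborel {0..t} (\<lambda>s. exp (- a * s) * cmod (g (\<xi> - s)))"
    and "(LINT s:{0..t}|lborel. exp (- a * s) * cmod (g (\<xi> - s))) \<le> exp (- a * \<xi>) * \<Gamma>"
proof -
  have eq: "exp (- a * s) * cmod (g (\<xi> - s)) = exp (- a * \<xi>) * (exp (a * (\<xi> - s)) * cmod (g (\<xi> - s)))" for s
    unfolding mult.assoc[symmetric] exp_add[symmetric] by (simp add: algebra_simps)
  have int: "integrable lborel (\<lambda>s. exp (- a * s) * cmod (g (\<xi> - s)))"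
    unfolding eq using lborel_integrable_real_affine[OF g_integrable, of "-1" \<xi>] by (intro integrable_mult_right) simp
  show 1: "set_integrable lborel {0..t} (\<lambda>s. exp (- a * s) * cmod (g (\<xi> - s)))"
    unfolding set_integrable_def by (rule integrable_mult_indicator) (use int in auto)
  have "(LINT s:{0..t}|lborel. exp (- a * s) * cmod (g (\<xi> - s))) \<le> (LINT s|lborel. exp (- a * s) * cmod (g (\<xi> - s)))"
    unfolding set_lebesgue_integral_def
    by (intro integral_mono 1[unfolded set_integrable_def] int) (auto simp: indicator_def)
  also have "\<dots> = exp (- a * \<xi>) * (LINT s|lborel. exp (a * (\<xi> - s)) * cmod (g (\<xi> - s)))"
    unfolding eq by simp
  also have "(LINT s|lborel. exp (a * (\<xi> - s)) * cmod (g (\<xi> - s))) = \<Gamma>"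
    unfolding g_integral[symmetric] by (subst (2) lborel_integral_real_affine[where c="-1" and t=\<xi>]) auto
  finally show "(LINT s:{0..t}|lborel. exp (- a * s) * cmod (g (\<xi> - s))) \<le> exp (- a * \<xi>) * \<Gamma>" .
qed

text \<open>
  Inserting the bound into the Duhamel formula reproduces it with \<open>n + 1\<close> in place of \<open>n\<close>. The weight
  \<open>exp (- a (\<xi> + t l / 2))\<close> at the mode \<open>l - 1\<close> is larger by \<open>exp (a s / 2)\<close>, which the decay \<open>exp (- a s)\<close>
  of the order parameter absorbs. Integrating along the characteristic yields \<open>2 / (a l)\<close>, respectively
  \<open>4 / (a l)\<close> for the auxiliary weight \<open>exp (l a t / 4)\<close>, so the factor \<open>l\<close> disappears and \<open>8 K E \<le> a\<close> makes both
  contributions contractive. The mode \<open>l = 1\<close> couples linearly to \<open>g\<close>; this produces the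
  summand \<open>K \<Gamma> E\<close>.
\<close>

lemma comparison:
  assumes E: "E \<ge> 0" "8 * K * E \<le> a" and \<eta>: "\<And>s. 0 \<le> s \<Longrightarrow> s \<le> T \<Longrightarrow> cmod (u s 1 0) \<le> E * exp (- a * s)"
    and tT: "0 \<le> t" "t \<le> T" and l: "l \<ge> 1"
  shows "cmod (u t l \<xi>) \<le> (2 * M + K * \<Gamma> * E) * exp (- a * (\<xi> + t * of_int l / 2)) + (1/2) ^ n * exp (of_int l * a * t / 4)"
  using tT l
proof (induction n arbitrary: t l \<xi>)
  case 0
  have "exp (of_int l * a * t / 4) \<ge> 1" using 0 a by simp
  moreover have "(2 * M + K * \<Gamma> * E) * exp (- a * (\<xi> + t * of_int l / 2)) \<ge> 0"
    using M K E \<Gamma>_nonneg by simp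
  ultimately show ?case using u_bound[OF 0(1), of l \<xi>] unfolding power_0 mult_1_left by linarith
next
  case (Suc n)
  define m where "m = 2 * M + K * \<Gamma> * E"
  define q :: real where "q = (1/2) ^ n"
  define L :: real where "L = of_int l"
  define \<xi>' where "\<xi>' = \<xi> + L * t"
  define V where "V = exp (- a * (\<xi> + t * L / 2))"
  define W where "W = exp (L * a * t / 4)"
  have m: "m \<ge> 0" using M K E \<Gamma>_nonneg by (simp add: m_def)
  have q: "q \<ge> 0" by (simp add: q_def)
  have L: "L \<ge> 1" using Suc.prems(3) by (simp add: L_def)
  define b where "b s = of_int l * of_real K / 2 *
       (u s 1 0 * u s (l - 1) (\<xi>' - of_int l * s) - cnj (u s 1 0) * u s (l + 1) (\<xi>' - of_int l * s))" for s
  define \<beta> where "\<beta> s = K * L * E * (m * exp (- a * \<xi>') * exp (a * L / 2 * s) + q * exp (a * L / 4 * s)) 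
      + K / 2 * E * (exp (- a * s) * cmod (g (\<xi>' - s)))" for s
  have b_int: "set_integrable lborel {0..t} b"
    unfolding b_def by (rule duhamel_integrable[OF Suc.prems(1)])
  have u_eq: "u t l \<xi> = u\<^sub>0 l \<xi>' + (CLINT s:{0..t}|lborel. b s)"
    using duhamel[OF Suc.prems(1), of l \<xi>'] unfolding b_def by (simp add: \<xi>'_def L_def)
  have b_le: "cmod (b s) \<le> \<beta> s" if s: "s \<in> {0..t}" for s
  proof -
    define X where "X = m * exp (- a * \<xi>') * exp (a * L / 2 * s) + q * exp (a * L / 4 * s)"
    have X: "X \<ge> 0" using m q by (simp add: X_def)
    have G: "exp (- a * s) * cmod (g (\<xi>' - s)) \<ge> 0" by simp
    \<comment> \<open>One estimate for both neighbours \<open>l - 1\<close> and \<open>l + 1\<close>, with \<open>\<epsilon>\<close> equal to \<open>-1\<close> or \<open>1\<close>.\<close>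
    have nb: "exp (- a * s) * cmod (u s j (\<xi>' - L * s)) \<le> X" if j: "j \<ge> 1" "of_int j = L + \<epsilon>" "\<bar>\<epsilon>\<bar> \<le> 1" for j \<epsilon>
    proof -
      have "cmod (u s j (\<xi>' - L * s)) \<le> m * exp (- a * (\<xi>' - L * s + s * of_int j / 2)) + q * exp (of_int j * a * s / 4)"
        unfolding m_def q_def using s Suc.prems j(1) by (intro Suc.IH) auto
      then have "exp (- a * s) * cmod (u s j (\<xi>' - L * s)) \<le> 
          exp (- a * s) * (m * exp (- a * (\<xi>' - L * s + s * of_int j / 2)) + q * exp (of_int j * a * s / 4))"
        by (intro mult_left_mono) auto
      also have "\<dots> = m * exp (- a * s + - a * (\<xi>' - L * s + s * (L + \<epsilon>) / 2)) + q * exp (- a * s + (L + \<epsilon>) * a * s / 4)"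
        unfolding j(2) exp_add[of "- a * s"] by (simp only: distrib_left mult.left_commute)
      also have "\<dots> \<le> m * exp (- a * \<xi>' + a * L / 2 * s) + q * exp (a * L / 4 * s)"
      proof -
        have as: "a * s \<ge> 0" using a s by simp
        have e: "\<bar>\<epsilon> * (a * s)\<bar> \<le> a * s" 
          unfolding abs_mult[of \<epsilon>] abs_of_nonneg[OF as] by (rule mult_left_le_one_le) (use as j(3) in auto)
        have "- a * s + - a * (\<xi>' - L * s + s * (L + \<epsilon>) / 2) = - a * \<xi>' + a * L / 2 * s - a * s - \<epsilon> * (a * s) / 2"
          by (simp add: field_simps)
        also have "\<dots> \<le> - a * \<xi>' + a * L / 2 * s" using e as by linarith
        finally have 1: "- a * s + - a * (\<xi>' - L * s + s * (L + \<epsilon>) / 2) \<le> - a * \<xi>' + a * L / 2 * s" .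
        have "- a * s + (L + \<epsilon>) * a * s / 4 = a * L / 4 * s - a * s + \<epsilon> * (a * s) / 4"
          by (simp add: field_simps)
        also have "\<dots> \<le> a * L / 4 * s" using e as by linarith
        finally show ?thesis using 1 m q by (intro add_mono mult_left_mono) auto
      qed
      also have "\<dots> = X" unfolding X_def exp_add by simp
      finally show ?thesis .
    qed
    have up: "exp (- a * s) * cmod (u s (l + 1) (\<xi>' - L * s)) \<le> X"
      by (rule nb[of _ 1]) (use Suc.prems in \<open>auto simp: L_def\<close>)
    have down: "exp (- a * s) * cmod (u s (l - 1) (\<xi>' - L * s)) \<le> X + exp (- a * s) * cmod (g (\<xi>' - s)) * (if l = 1 then 1 else 0)"
    proof (cases "l = 1")
      case True
      then show ?thesis using X u_zero[of s "\<xi>' - s"] s by (simp add: L_def)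
    next
      case False
      have "exp (- a * s) * cmod (u s (l - 1) (\<xi>' - L * s)) \<le> X"
        by (rule nb[of _ "-1"]) (use Suc.prems False in \<open>auto simp: L_def\<close>)
      then show ?thesis using False by simp
    qed
    have "cmod (b s) = L * K / 2 * cmod (u s 1 0 * u s (l - 1) (\<xi>' - L * s) - cnj (u s 1 0) * u s (l + 1) (\<xi>' - L * s))"
      unfolding b_def using L K by (simp add: norm_mult norm_divide L_def)
    also have "\<dots> \<le> L * K / 2 * (cmod (u s 1 0) * (cmod (u s (l - 1) (\<xi>' - L * s)) + cmod (u s (l + 1) (\<xi>' - L * s))))"
      using L K norm_triangle_ineq4[of "u s 1 0 * u s (l - 1) (\<xi>' - L * s)" "cnj (u s 1 0) * u s (l + 1) (\<xi>' - L * s)"]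
      by (intro mult_left_mono) (auto simp: norm_mult distrib_left)
    also have "\<dots> \<le> L * K / 2 * (E * exp (- a * s) * (cmod (u s (l - 1) (\<xi>' - L * s)) + cmod (u s (l + 1) (\<xi>' - L * s))))"
      using L K s Suc.prems by (intro mult_left_mono mult_right_mono \<eta>) auto
    also have "\<dots> = L * K / 2 * E * (exp (- a * s) * cmod (u s (l - 1) (\<xi>' - L * s)) + exp (- a * s) * cmod (u s (l + 1) (\<xi>' - L * s)))"
      by (simp add: algebra_simps)
    also have "\<dots> \<le> L * K / 2 * E * ((X + exp (- a * s) * cmod (g (\<xi>' - s)) * (if l = 1 then 1 else 0)) + X)"
      using L K E by (intro mult_left_mono add_mono up down) auto
    also have "\<dots> \<le> K * L * E * X + K / 2 * E * (exp (- a * s) * cmod (g (\<xi>' - s)))"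
    proof -
      have "L * K / 2 * E * (exp (- a * s) * cmod (g (\<xi>' - s)) * (if l = 1 then 1 else 0)) \<le> K / 2 * E * (exp (- a * s) * cmod (g (\<xi>' - s)))"
        using K E by (auto simp: L_def)
      then show ?thesis by (simp only: distrib_left) (simp add: field_simps)
    qed
    finally show ?thesis unfolding \<beta>_def X_def .
  qed
  have c2: "a * L / 2 > 0" and c4: "a * L / 4 > 0" using a L by auto
  note I2 = exp_interval_integral[OF less_imp_neq[OF c2, symmetric] Suc.prems(1)]
  note I4 = exp_interval_integral[OF less_imp_neq[OF c4, symmetric] Suc.prems(1)]
  note IG = g_shift[of t \<xi>']
  have \<beta>_int: "set_integrable lborel {0..t} \<beta>"
    unfolding \<beta>_def by (intro set_integral_add set_integrable_mult_right I2 I4 IG)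
  have "(LINT s:{0..t}|lborel. \<beta> s) = K * L * E * (m * exp (- a * \<xi>') * ((exp (a * L / 2 * t) - 1) / (a * L / 2)) + q * ((exp (a * L / 4 * t) - 1) / (a * L / 4)))
      + K / 2 * E * (LINT s:{0..t}|lborel. exp (- a * s) * cmod (g (\<xi>' - s)))"
    unfolding \<beta>_def
    by (simp only: set_integral_add set_integrable_mult_right set_integral_mult_right I2 I4 IG(1))
  also have "\<dots> \<le> K * L * E * (m * exp (- a * \<xi>') * (exp (a * L / 2 * t) / (a * L / 2)) + q * (W / (a * L / 4)))
      + K / 2 * E * (exp (- a * \<xi>') * \<Gamma>)"
    using K L E m q a IG(2) by (intro add_mono mult_left_mono divide_right_mono) (auto simp: W_def mult_ac)
  also have "K * L * E * (m * exp (- a * \<xi>') * (exp (a * L / 2 * t) / (a * L / 2)) + q * (W / (a * L / 4)))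
      = (2 * K * E / a) * (m * (exp (- a * \<xi>') * exp (a * L / 2 * t))) + (4 * K * E / a) * (q * W)"
    using a L by (simp add: field_simps)
  also have "exp (- a * \<xi>') * exp (a * L / 2 * t) = V"
    unfolding exp_add[symmetric] V_def \<xi>'_def by (simp add: field_simps)
  finally have \<beta>_le: "(LINT s:{0..t}|lborel. \<beta> s) \<le> (2 * K * E / a) * (m * V) + (4 * K * E / a) * (q * W) + K / 2 * E * (exp (- a * \<xi>') * \<Gamma>)" .
  have KE: "2 * K * E / a \<le> 1/4" "4 * K * E / a \<le> 1/2" using E(2) a by (auto simp: divide_le_eq)
  have eV: "exp (- a * \<xi>') \<le> V"
    unfolding V_def \<xi>'_def using a L Suc.prems(1) by (simp add: mult_left_mono algebra_simps)
  have in_le: "cmod (u\<^sub>0 l \<xi>') \<le> M * exp (- a * \<xi>')"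
    using initial[OF Suc.prems(3), of \<xi>'] by (simp add: exp_minus field_simps)
  have V: "V \<ge> 0" and W: "W \<ge> 0" by (auto simp: V_def W_def)
  have "cmod (u t l \<xi>) \<le> cmod (u\<^sub>0 l \<xi>') + cmod (CLINT s:{0..t}|lborel. b s)"
    unfolding u_eq by (rule norm_triangle_ineq)
  also have "cmod (CLINT s:{0..t}|lborel. b s) \<le> (LINT s:{0..t}|lborel. \<beta> s)"
    by (rule set_integral_norm_le[OF b_int \<beta>_int b_le])
  also note \<beta>_le
  also note in_le
  finally have "cmod (u t l \<xi>) \<le> M * exp (- a * \<xi>') + ((2 * K * E / a) * (m * V) + (4 * K * E / a) * (q * W) + K / 2 * E * (exp (- a * \<xi>') * \<Gamma>))"
    by simp
  also have "\<dots> \<le> M * V + (1/4 * (m * V) + 1/2 * (q * W) + K / 2 * E * (V * \<Gamma>))"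
    using M K E \<Gamma>_nonneg m q V W by (intro add_mono mult_left_mono mult_right_mono KE eV) auto
  also have "\<dots> = 3/4 * (m * V) + 1/2 * (q * W)" by (simp add: m_def algebra_simps)
  also have "\<dots> \<le> m * V + (1/2) ^ Suc n * W" using m V by (simp add: q_def)
  finally show ?case unfolding m_def V_def W_def L_def .
qed

lemma weighted_bound:
  assumes E: "E \<ge> 0" "8 * K * E \<le> a" and \<eta>: "\<And>s. 0 \<le> s \<Longrightarrow> s \<le> T \<Longrightarrow> cmod (u s 1 0) \<le> E * exp (- a * s)"
    and tT: "0 \<le> t" "t \<le> T" and l: "l \<ge> 1"
  shows "cmod (u t l \<xi>) \<le> (2 * M + K * \<Gamma> * E) * exp (- a * (\<xi> + t * of_int l / 2))"
proof (rule LIMSEQ_le_const)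
  have "(\<lambda>n. (2 * M + K * \<Gamma> * E) * exp (- a * (\<xi> + t * of_int l / 2)) + (1/2) ^ n * exp (of_int l * a * t / 4)) \<longlonglongrightarrow> 
     (2 * M + K * \<Gamma> * E) * exp (- a * (\<xi> + t * of_int l / 2)) + 0 * exp (of_int l * a * t / 4)"
    by (intro tendsto_intros LIMSEQ_power_zero) auto
  then show "(\<lambda>n. (2 * M + K * \<Gamma> * E) * exp (- a * (\<xi> + t * of_int l / 2)) + (1/2) ^ n * exp (of_int l * a * t / 4)) \<longlonglongrightarrow> 
     (2 * M + K * \<Gamma> * E) * exp (- a * (\<xi> + t * of_int l / 2))" by simp
qed (use comparison[OF assms] in blast)

text \<open>
  At \<open>l = 1\<close>, \<open>\<xi> = 0\<close> the coupling to the zeroth mode is the convolution with the kernel, and the coupling to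
  the second mode is at most \<open>(K / 2) E exp (- a s) m exp (- a t)\<close>. The order parameter is set to zero outside \<open>[0, T]\<close>,
  which by causality does not disturb the equation up to time \<open>T\<close>.
\<close>

lemma order_bound_step:
  assumes E: "E \<ge> 0" "8 * K * E \<le> a" and \<eta>: "\<And>s. 0 \<le> s \<Longrightarrow> s \<le> T \<Longrightarrow> cmod (u s 1 0) \<le> E * exp (- a * s)"
    and T: "0 \<le> T"
  shows "cmod (u T 1 0) * exp (a * T) \<le> C * (M + K * E * (2 * M + K * \<Gamma> * E) / (2 * a))"
proof -
  define m where "m = 2 * M + K * \<Gamma> * E"
  have m: "m \<ge> 0" using M K E \<Gamma>_nonneg by (simp add: m_def)
  define k where "k t = (if t < 0 then 0 else of_real (exp (a * t)) * (- (of_real K / 2) * g t))" for t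
  define f where "f t = indicator {0..T} t *\<^sub>R (of_real (exp (a * t)) * u t 1 0)" for t
  have "continuous_on {0..T} (\<lambda>t. of_real (exp (a * t)) * u t 1 0)"
    by (intro continuous_intros continuous_on_subset[OF order_continuous]) auto
  then have f_meas: "f \<in> borel_measurable borel"
    unfolding f_def by (intro borel_measurable_continuous_on_indicator) auto
  have f_le: "cmod (f t) \<le> E" for t
  proof (cases "t \<in> {0..T}")
    case True
    then have "cmod (f t) = exp (a * t) * cmod (u t 1 0)" by (simp add: f_def norm_mult)
    also have "\<dots> \<le> exp (a * t) * (E * exp (- a * t))" using True by (intro mult_left_mono \<eta>) auto
    also have "\<dots> = E" by (simp add: exp_minus)
    finally show ?thesis .
  qed (simp add: f_def E)
  have bb: "bounded_borel f" using f_meas f_le by (auto simp: bounded_borel_def bounded_iff)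
  have "cmod (f t + conv k f t) \<le> M + K * E * m / (2 * a)" if tT: "t \<le> T" for t
  proof (cases "t < 0")
    case True
    then have "(\<lambda>s. k s * f (t - s)) = (\<lambda>_. 0)" by (auto simp: k_def f_def indicator_def)
    then have "conv k f t = 0" by (simp add: conv_def)
    then show ?thesis using True M K E m a by (simp add: f_def indicator_def)
  next
    case False
    then have t: "t \<ge> 0" by simp
    define p where "p s = of_real K / 2 * (u s 1 0 * g (t - s))" for s
    define r where "r s = of_real K / 2 * (cnj (u s 1 0) * u s 2 (t - s))" for s
    have p_int: "set_integrable lborel {0..t} p"
      unfolding p_def
      by (intro borel_integrable_atLeastAtMost' continuous_intros continuous_on_subset[OF order_continuous]
           continuous_on_compose2[OF g_continuous]) auto
    have pr: "of_int 1 * of_real K / 2 * (u s 1 0 * u s (1 - 1) (t - of_int 1 * s) - cnj (u s 1 0) * u s (1 + 1) (t - of_int 1 * s)) = p s - r s"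
      if "s \<in> {0..t}" for s
      using u_zero[of s "t - s"] that by (simp add: p_def r_def algebra_simps)
    have pr_int: "set_integrable lborel {0..t} (\<lambda>s. p s - r s)"
      using duhamel_integrable[OF t, of 1 t] by (simp only: pr cong: set_integrable_cong)
    have "set_integrable lborel {0..t} (\<lambda>s. p s - (p s - r s))"
      by (rule set_integral_diff(1)[OF p_int pr_int])
    then have r_int: "set_integrable lborel {0..t} r" by simp
    have "(CLINT s:{0..t}|lborel. p s - r s) = (CLINT s:{0..t}|lborel. of_int 1 * of_real K / 2 *
        (u s 1 0 * u s (1 - 1) (t - of_int 1 * s) - cnj (u s 1 0) * u s (1 + 1) (t - of_int 1 * s)))"
      by (intro set_lebesgue_integral_cong allI impI pr[symmetric]) auto
    with duhamel[OF t, of 1 t] have "u t 1 0 = u\<^sub>0 1 t + (CLINT s:{0..t}|lborel. p s - r s)" by simp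
    also have "(CLINT s:{0..t}|lborel. p s - r s) = (CLINT s:{0..t}|lborel. p s) - (CLINT s:{0..t}|lborel. r s)"
      by (rule set_integral_diff(2)[OF p_int r_int])
    finally have u_eq: "u t 1 0 = u\<^sub>0 1 t + (CLINT s:{0..t}|lborel. p s) - (CLINT s:{0..t}|lborel. r s)" by simp
    have "conv k f t = conv f k t" by (rule conv_commute)
    also have "\<dots> = (CLINT s|lborel. - of_real (exp (a * t)) * (indicator {0..t} s *\<^sub>R p s))"
      unfolding conv_def
    proof (rule Bochner_Integration.integral_cong)
      fix s show "f s * k (t - s) = - of_real (exp (a * t)) * (indicator {0..t} s *\<^sub>R p s)"
      proof (cases "s \<in> {0..t}")
        case True
        have "exp (a * t) = exp (a * s) * exp (a * (t - s))"
          unfolding exp_add[symmetric] by (simp add: algebra_simps)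
        then show ?thesis using True tT by (simp add: f_def k_def p_def)
      qed (use tT in \<open>auto simp: f_def k_def indicator_def\<close>)
    qed simp
    also have "\<dots> = - of_real (exp (a * t)) * (CLINT s:{0..t}|lborel. p s)"
      unfolding set_lebesgue_integral_def by (rule integral_mult_right_zero)
    finally have "conv k f t = - of_real (exp (a * t)) * (CLINT s:{0..t}|lborel. p s)" .
    moreover have "f t = of_real (exp (a * t)) * (u\<^sub>0 1 t + (CLINT s:{0..t}|lborel. p s) - (CLINT s:{0..t}|lborel. r s))"
      using t tT by (simp add: f_def flip: u_eq)
    ultimately have "f t + conv k f t = of_real (exp (a * t)) * (u\<^sub>0 1 t - (CLINT s:{0..t}|lborel. r s))"
      by (simp add: algebra_simps)
    then have "cmod (f t + conv k f t) \<le> exp (a * t) * (cmod (u\<^sub>0 1 t) + cmod (CLINT s:{0..t}|lborel. r s))"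
      using norm_triangle_ineq4[of "u\<^sub>0 1 t" "CLINT s:{0..t}|lborel. r s"] by (simp add: norm_mult)
    also have "\<dots> = cmod (u\<^sub>0 1 t) * exp (a * t) + exp (a * t) * cmod (CLINT s:{0..t}|lborel. r s)"
      by (simp add: algebra_simps)
    also have "\<dots> \<le> M + exp (a * t) * (exp (- a * t) * (K * E * m / (2 * a)))"
    proof (intro add_mono mult_left_mono initial)
      have na: "- a \<noteq> 0" using a by simp
      note IA = exp_interval_integral[OF na t]
      have "cmod (CLINT s:{0..t}|lborel. r s) \<le> (LINT s:{0..t}|lborel. K / 2 * E * m * exp (- a * t) * exp (- a * s))"
      proof (rule set_integral_norm_le[OF r_int])
        show "set_integrable lborel {0..t} (\<lambda>s. K / 2 * E * m * exp (- a * t) * exp (- a * s))"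
          by (intro set_integrable_mult_right IA)
        fix s assume s: "s \<in> {0..t}"
        have "cmod (u s 2 (t - s)) \<le> m * exp (- a * ((t - s) + s * of_int 2 / 2))"
          unfolding m_def by (rule weighted_bound[OF E \<eta>]) (use s tT in auto)
        then have u2: "cmod (u s 2 (t - s)) \<le> m * exp (- a * t)" by simp
        have "cmod (r s) = K / 2 * (cmod (u s 1 0) * cmod (u s 2 (t - s)))" using K by (simp add: r_def norm_mult norm_divide)
        also have "\<dots> \<le> K / 2 * ((E * exp (- a * s)) * (m * exp (- a * t)))"
          using K E s tT by (intro mult_left_mono mult_mono u2 \<eta>) auto
        finally show "cmod (r s) \<le> K / 2 * E * m * exp (- a * t) * exp (- a * s)" by (simp add: mult_ac)
      qed
      also have "\<dots> = K / 2 * E * m * exp (- a * t) * ((exp (- a * t) - 1) / - a)"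
        using IA(2) by simp
      also have "\<dots> \<le> K / 2 * E * m * exp (- a * t) * (1 / a)"
        using K E m a by (intro mult_left_mono) (auto simp: divide_simps)
      finally show "cmod (CLINT s:{0..t}|lborel. r s) \<le> exp (- a * t) * (K * E * m / (2 * a))" by (simp add: mult_ac)
    qed auto
    also have "\<dots> = M + K * E * m / (2 * a)" by (simp add: exp_minus)
    finally show ?thesis .
  qed
  then have "cmod (f T) \<le> C * (M + K * E * m / (2 * a))"
    unfolding k_def[abs_def] by (rule stability[OF bb _ order_refl])
  then show ?thesis using T by (simp add: f_def m_def norm_mult mult.commute)
qed

text \<open>
  At the first time \<open>T\<close> at which \<open>\<bar>\<eta>\<bar> exp (a t)\<close> reaches \<open>E = 4 C M\<close>, the previous step bounds it by
  \<open>2 C M\<close>, since the quadratic term contributes at most \<open>M\<close> under the smallness assumption.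
\<close>

lemma order_decay:
  assumes small: "32 * K * C * M \<le> a" "2 * K * C * (2 + 4 * K * \<Gamma> * C) * M \<le> a" and t: "t \<ge> 0"
  shows "cmod (u t 1 0) \<le> 4 * C * M * exp (- a * t)"
proof (rule ccontr)
  define E where "E = 4 * C * M"
  define \<phi> where "\<phi> s = cmod (u s 1 0) * exp (a * s)" for s
  assume "\<not> ?thesis"
  then have big: "\<phi> t > E" by (simp add: \<phi>_def E_def exp_minus field_simps)
  have E: "E > 0" "8 * K * E \<le> a" using C M small by (auto simp: E_def mult_ac)
  have cont: "continuous_on {0..s} \<phi>" for s
    unfolding \<phi>_def by (intro continuous_intros continuous_on_subset[OF order_continuous]) auto
  have "u 0 1 0 = u\<^sub>0 1 0"
    using duhamel[of 0 1 0] set_borel_integral_eq_integral(2)[OF duhamel_integrable[of 0 1 0]] by simp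
  then have "\<phi> 0 \<le> M" using initial[of 1 0] by (simp add: \<phi>_def)
  also have "M < E" using C M by (simp add: E_def)
  finally have \<phi>0: "\<phi> 0 < E" .
  have hit: "\<exists>r. 0 \<le> r \<and> r \<le> s \<and> \<phi> r = E" if "0 \<le> s" "\<phi> s \<ge> E" for s
    using IVT'[of \<phi> 0 E s] that \<phi>0 cont by auto
  define S where "S = {s \<in> {0..t}. \<phi> s = E}"
  have "closed S" unfolding S_def by (rule continuous_closed_preimage_constant[OF cont]) simp
  then have "compact ({0..t} \<inter> S)" by (rule compact_Int_closed[OF compact_Icc])
  also have "{0..t} \<inter> S = S" by (auto simp: S_def)
  finally have "compact S" .
  moreover have "S \<noteq> {}" using hit[OF t] big by (auto simp: S_def)
  ultimately obtain T where T: "T \<in> S" "\<And>s. s \<in> S \<Longrightarrow> T \<le> s" by (metis compact_attains_inf)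
  have before: "\<phi> s \<le> E" if "0 \<le> s" "s \<le> T" for s
  proof (rule ccontr)
    note s = that
    assume "\<not> \<phi> s \<le> E"
    then obtain r where r: "0 \<le> r" "r \<le> s" "\<phi> r = E" using hit[OF s(1)] by auto
    then have "T \<le> r" using T s by (auto simp: S_def)
    with r s have "r = s" by simp
    with r \<open>\<not> \<phi> s \<le> E\<close> show False by simp
  qed
  have "\<phi> T \<le> C * (M + K * E * (2 * M + K * \<Gamma> * E) / (2 * a))"
    unfolding \<phi>_def
  proof (rule order_bound_step)
    fix s assume "0 \<le> s" "s \<le> T"
    then show "cmod (u s 1 0) \<le> E * exp (- a * s)"
      using before[of s] by (simp add: \<phi>_def exp_minus field_simps)
  qed (use E T in \<open>auto simp: S_def\<close>)
  also have "\<dots> \<le> C * (M + M)"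
  proof (intro mult_left_mono add_left_mono)
    have "K * E * (2 * M + K * \<Gamma> * E) = 2 * K * C * (2 + 4 * K * \<Gamma> * C) * M * (2 * M)"
      by (simp add: E_def algebra_simps)
    also have "\<dots> \<le> a * (2 * M)" using small(2) M by (intro mult_right_mono) auto
    finally show "K * E * (2 * M + K * \<Gamma> * E) / (2 * a) \<le> M" using a by (simp add: divide_le_eq mult_ac)
  qed (use C in simp)
  also have "\<dots> < E" using C M by (simp add: E_def)
  finally show False using T(1) by (simp add: S_def)
qed

lemma mode_decay:
  assumes small: "32 * K * C * M \<le> a" "2 * K * C * (2 + 4 * K * \<Gamma> * C) * M \<le> a" and t: "t \<ge> 0" and l: "l \<ge> 1"
  shows "cmod (u t l \<xi>) * exp (a * (\<xi> + t * of_int l / 2)) \<le> (2 + 4 * K * \<Gamma> * C) * M"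
proof -
  have "cmod (u t l \<xi>) \<le> (2 * M + K * \<Gamma> * (4 * C * M)) * exp (- a * (\<xi> + t * of_int l / 2))"
    by (rule weighted_bound[of _ t]) (use order_decay[OF small] small C M t l in \<open>auto simp: mult_ac\<close>)
  then have "cmod (u t l \<xi>) * exp (a * (\<xi> + t * of_int l / 2)) \<le>
      (2 * M + K * \<Gamma> * (4 * C * M)) * exp (- a * (\<xi> + t * of_int l / 2)) * exp (a * (\<xi> + t * of_int l / 2))"
    by (intro mult_right_mono) auto
  also have "\<dots> = 2 * M + K * \<Gamma> * (4 * C * M)"
    unfolding mult.assoc exp_add[symmetric] by simp
  finally show ?thesis by (simp add: algebra_simps)
qed

end

section \<open>Exponential stability of the Kuramoto equation\<close>

lemma kuramoto_mode_hierarchy: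
  assumes "K \<ge> 0" "a > 0" "M > 0" "C \<ge> 1"
    and sol: "kuramoto_solution K \<rho>_in \<rho>" and \<rho>_in: "\<rho>_in \<in> space (prob_algebra phase_space)"
    and g: "distr \<rho>_in borel snd = g" "continuous_on UNIV (char g)"
    and int: "integrable lborel (\<lambda>x. exp (a * x) * cmod (char g x))"
    and init: "\<And>l \<xi>. l \<ge> 1 \<Longrightarrow> cmod (fourier \<rho>_in l \<xi>) * exp (a * \<xi>) \<le> M"
    and stab: "\<And>f T B t. bounded_borel f \<Longrightarrow>
       (\<And>t. t \<le> T \<Longrightarrow> cmod (f t + conv (\<lambda>t. if t < 0 then 0 else of_real (exp (a * t)) * (- (of_real K / 2) * char g t)) f t) \<le> B) \<Longrightarrow>
       t \<le> T \<Longrightarrow> cmod (f t) \<le> C * B"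
  shows "mode_hierarchy K a M (\<lambda>t. fourier (\<rho> t)) (fourier \<rho>_in) (char g) (LINT x|lborel. exp (a * x) * cmod (char g x)) C"
proof (unfold_locales, goal_cases)
  case (5 t l \<xi>) then show ?case by (rule norm_fourier_le_1[OF kuramoto_solution_D(1)[OF sol]])
next
  case (6 t \<xi>) then show ?case using fourier_zero_mode[OF sol \<rho>_in, of t \<xi>] g(1) by simp
next
  case (7 t l \<xi>) then show ?case
    using kuramoto_duhamel(1)[OF sol \<rho>_in, of t l \<xi>] by (simp add: order_parameter_eq_fourier)
next
  case (8 t l \<xi>) then show ?case
    using kuramoto_duhamel(2)[OF sol \<rho>_in, of t l \<xi>] by (simp add: order_parameter_eq_fourier)
next
  case 9 then show ?case using order_parameter_continuous[OF sol] by (simp add: order_parameter_eq_fourier)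
next
  case (14 f T B t) then show ?case by (rule stab) 
qed (use assms in auto)

lemma nonneg_ereal_cases:
  assumes "0 \<le> x" "x \<le> ereal d"
  obtains r where "x = ereal r" "0 \<le> r" "r \<le> d"
  using assms by (cases x) auto

text \<open>
  The bounds hold for every \<open>M\<close> slightly larger than the norm of the data. Letting \<open>M\<close> decrease to the
  norm covers data of norm zero as well.
\<close>

theorem theorem4:
  fixes K a :: real and g :: "real measure"
  assumes "K \<ge> 0"
    and "a > 0"
    and "g \<in> space (prob_algebra borel)"
    and "set_integrable lborel {0..} (\<lambda>\<xi>. cmod (char g \<xi>) * exp (a * \<xi>))"
    and "\<And>z. Re z \<ge> - a \<Longrightarrow> laplace_transform (kuramoto_kernel K g) z \<noteq> - 1"
  shows "\<exists>\<delta>>0. \<exists>c\<^sub>1 :: real.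
    \<forall>\<rho>_in \<in> space (prob_algebra phase_space).
      distr \<rho>_in borel snd = g \<longrightarrow> initial_norm a \<rho>_in \<le> ereal \<delta> \<longrightarrow>
      (\<forall>\<rho>. kuramoto_solution K \<rho>_in \<rho> \<longrightarrow>
        (SUP t\<in>{0..}. SUP l\<in>{1..}. SUP \<xi>.
            ereal (cmod (fourier (\<rho> t) l \<xi>) * exp (a * (\<xi> + t * of_int l / 2))))
          \<le> ereal (1 + c\<^sub>1) * initial_norm a \<rho>_in \<and>
        (\<lambda>t. order_parameter (\<rho> t)) \<in> O(\<lambda>t. of_real (exp (- a * t))))"
proof -
  have "prob_space g" "sets g = sets borel" using assms(3) by (auto simp: space_prob_algebra)
  then have rd: "real_distribution g"
    by (auto simp: real_distribution_def real_distribution_axioms_def dest: sets_eq_imp_space_eq)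
  interpret real_distribution g by (rule rd)
  have char_cont: "continuous_on UNIV (char g)"
    by (intro continuous_at_imp_continuous_on ballI isCont_char)
  have int_pos: "integrable lborel (\<lambda>x. indicator {0..} x *\<^sub>R (cmod (char g x) * exp (a * x)))"
    using assms(4) by (simp add: set_integrable_def)
  define k where "k t = (if t < 0 then 0 else of_real (exp (a * t)) * (- (of_real K / 2) * char g t))" for t
  have char_meas [measurable]: "char g \<in> borel_measurable borel"
    by (rule borel_measurable_continuous_onI[OF char_cont])
  have "integrable lborel k"
  proof (rule Bochner_Integration.integrable_bound)
    show "integrable lborel (\<lambda>x. K / 2 * (indicator {0..} x *\<^sub>R (cmod (char g x) * exp (a * x))))"
      by (intro integrable_mult_right int_pos)
    show "k \<in> borel_measurable lborel" unfolding k_def by measurable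
  qed (use assms(1) in \<open>auto simp: k_def indicator_def norm_mult\<close>)
  then have k_causal: "causal_kernel k" by (simp add: causal_kernel_def k_def)
  have "continuous_on {0..} (\<lambda>t. of_real (exp (a * t)) * (- (of_real K / 2) * char g t))"
    by (intro continuous_intros continuous_on_subset[OF char_cont]) auto
  then have k_cont: "continuous_on {0..} k" by (rule continuous_on_eq) (simp add: k_def)
  have k_laplace: "laplace k z \<noteq> -1" if "Re z \<ge> 0" for z
  proof -
    have "laplace k z = laplace_transform (kuramoto_kernel K g) (z - of_real a)"
      unfolding laplace_def laplace_transform_def set_lebesgue_integral_def
    proof (rule Bochner_Integration.integral_cong)
      fix t :: real
      have "exp (- (complex_of_real t * (z - of_real a))) = of_real (exp (a * t)) * exp (- (of_real t * z))"
        unfolding exp_of_real[symmetric] exp_add[symmetric] by (simp add: algebra_simps)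
      then show "k t * exp (- (of_real t * z)) = indicator {0..} t *\<^sub>R (kuramoto_kernel K g t * exp (- (of_real t * (z - of_real a))))"
        by (simp add: k_def kuramoto_kernel_def indicator_def)
    qed simp
    then show ?thesis using assms(5)[of "z - of_real a"] that by simp
  qed
  obtain C' where C': "C' \<ge> 0" "\<And>f T B t. bounded_borel f \<Longrightarrow> (\<And>t. t \<le> T \<Longrightarrow> cmod (f t + conv k f t) \<le> B) \<Longrightarrow>
       t \<le> T \<Longrightarrow> cmod (f t) \<le> C' * B"
    by (rule volterra_stability[OF k_causal k_cont k_laplace]) (assumption, blast)
  define C where "C = max 1 C'"
  have C: "C \<ge> 1" by (simp add: C_def)
  have stab: "cmod (f t) \<le> C * B" if "bounded_borel f" "\<And>t. t \<le> T \<Longrightarrow> cmod (f t + conv k f t) \<le> B" "t \<le> T" for f T B t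
  proof -
    have "B \<ge> 0" using that(2)[OF that(3)] norm_ge_zero order_trans by blast
    then have "C' * B \<le> C * B" by (intro mult_right_mono) (auto simp: C_def)
    with C'(2)[OF that] show ?thesis by linarith
  qed
  define \<Gamma> where "\<Gamma> = (LINT x|lborel. exp (a * x) * cmod (char g x))"
  have \<Gamma>: "\<Gamma> \<ge> 0" unfolding \<Gamma>_def by (rule integral_nonneg_AE) auto
  have int: "integrable lborel (\<lambda>x. exp (a * x) * cmod (char g x))"
  proof (rule Bochner_Integration.integrable_bound)
    have "integrable lborel (\<lambda>x. indicator {0..} (- x) *\<^sub>R exp (- (a * (- x))))"
      using lborel_integrable_real_affine[OF exp_integral(1)[OF assms(2), unfolded set_integrable_def], of "-1" 0] by simp
    then show "integrable lborel (\<lambda>x. indicator {0..} x *\<^sub>R (cmod (char g x) * exp (a * x)) + indicator {0..} (- x) *\<^sub>R exp (- (a * (- x))))"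
      using int_pos by (rule Bochner_Integration.integrable_add[rotated])
    show "AE x in lborel. norm (exp (a * x) * cmod (char g x)) \<le> 
        norm (indicator {0..} x *\<^sub>R (cmod (char g x) * exp (a * x)) + indicator {0..} (- x) *\<^sub>R exp (- (a * (- x))))"
    proof (rule AE_I2)
      fix x :: real
      show "norm (exp (a * x) * cmod (char g x)) \<le> 
        norm (indicator {0..} x *\<^sub>R (cmod (char g x) * exp (a * x)) + indicator {0..} (- x) *\<^sub>R exp (- (a * (- x))))"
        using cmod_char_le_1[of x] by (cases "x < 0"; cases "x = 0") (auto simp: indicator_def mult_left_le)
    qed
  qed measurable
  \<comment> \<open>\<open>A M \<le> a\<close> implies both smallness assumptions of the bootstrap.\<close>
  define A where "A = 32 * K * C + 2 * K * C * (2 + 4 * K * \<Gamma> * C) + 1"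
  have KC: "0 \<le> 32 * K * C" "0 \<le> 2 * K * C * (2 + 4 * K * \<Gamma> * C)" using assms(1) C \<Gamma> by auto
  then have A: "A > 0" unfolding A_def by linarith
  define c1 where "c1 = 1 + 4 * K * \<Gamma> * C"
  have c1: "1 + c1 > 0" using assms(1) C \<Gamma> by (simp add: c1_def add_pos_nonneg)
  define \<delta> where "\<delta> = a / A / 2"
  have \<delta>: "\<delta> > 0" using assms(2) A by (simp add: \<delta>_def)
  show ?thesis
  proof (rule exI[of _ \<delta>], rule conjI[OF \<delta>], rule exI[of _ c1], intro ballI impI allI conjI)
    fix \<rho>_in \<rho>
    assume \<rho>_in: "\<rho>_in \<in> space (prob_algebra phase_space)" and g: "distr \<rho>_in borel snd = g"
      and le: "initial_norm a \<rho>_in \<le> ereal \<delta>" and sol: "kuramoto_solution K \<rho>_in \<rho>"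
    have term_le: "ereal (cmod (fourier \<rho>_in l \<xi>) * exp (a * \<xi>)) \<le> initial_norm a \<rho>_in" if "l \<ge> 1" for l \<xi>
      unfolding initial_norm_def using that by (intro SUP_upper2[of l] SUP_upper2[of \<xi>]) auto
    have "0 \<le> ereal (cmod (fourier \<rho>_in 1 0) * exp (a * 0))"
      unfolding zero_ereal_def ereal_less_eq by simp
    then have "0 \<le> initial_norm a \<rho>_in" using term_le[of 1 0] by (rule order_trans) simp
    then obtain r where r: "initial_norm a \<rho>_in = ereal r" "0 \<le> r" "r \<le> \<delta>"
      using le by (rule nonneg_ereal_cases)
    have mh: "mode_hierarchy K a M (\<lambda>t. fourier (\<rho> t)) (fourier \<rho>_in) (char g) \<Gamma> C"
      and small: "32 * K * C * M \<le> a" "2 * K * C * (2 + 4 * K * \<Gamma> * C) * M \<le> a"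
      if M: "r < M" "M < 2 * \<delta>" for M
    proof -
      have "M > 0" using r(2) M by simp
      have "cmod (fourier \<rho>_in l \<xi>) * exp (a * \<xi>) \<le> M" if "l \<ge> 1" for l \<xi>
        using term_le[OF that, of \<xi>] M(1) by (simp add: r(1))
      then show "mode_hierarchy K a M (\<lambda>t. fourier (\<rho> t)) (fourier \<rho>_in) (char g) \<Gamma> C"
        unfolding \<Gamma>_def
        by (intro kuramoto_mode_hierarchy assms(1,2) C sol \<rho>_in g char_cont int \<open>M > 0\<close> stab[unfolded k_def[abs_def]]) auto
      have "A * M \<le> A * (a / A)" using M A by (intro mult_left_mono) (auto simp: \<delta>_def)
      then have "A * M \<le> a" using A by simp
      moreover have "A * M = 32 * K * C * M + 2 * K * C * (2 + 4 * K * \<Gamma> * C) * M + M"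
        by (simp add: A_def algebra_simps)
      moreover have "0 \<le> 32 * K * C * M" "0 \<le> 2 * K * C * (2 + 4 * K * \<Gamma> * C) * M"
        using KC \<open>M > 0\<close> by (auto intro!: mult_nonneg_nonneg[OF _ less_imp_le])
      ultimately show "32 * K * C * M \<le> a" "2 * K * C * (2 + 4 * K * \<Gamma> * C) * M \<le> a" using \<open>M > 0\<close> by linarith+
    qed
    have mode: "cmod (fourier (\<rho> t) l \<xi>) * exp (a * (\<xi> + t * of_int l / 2)) \<le> (1 + c1) * r"
      if "t \<ge> 0" "l \<ge> 1" for t l \<xi>
    proof -
      have "cmod (fourier (\<rho> t) l \<xi>) * exp (a * (\<xi> + t * of_int l / 2)) / (1 + c1) \<le> r"
      proof (rule dense_ge_bounded)
        show "r < 2 * \<delta>" using r(3) \<delta> by simp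
        fix M assume M: "r < M" "M < 2 * \<delta>"
        have "cmod (fourier (\<rho> t) l \<xi>) * exp (a * (\<xi> + t * of_int l / 2)) \<le> (2 + 4 * K * \<Gamma> * C) * M"
          by (rule mode_hierarchy.mode_decay[OF mh[OF M] small[OF M] that])
        then show "cmod (fourier (\<rho> t) l \<xi>) * exp (a * (\<xi> + t * of_int l / 2)) / (1 + c1) \<le> M"
          using c1 by (simp add: divide_le_eq c1_def mult.commute)
      qed
      then show ?thesis using c1 by (simp add: divide_le_eq mult.commute)
    qed
    show "(SUP t\<in>{0..}. SUP l\<in>{1..}. SUP \<xi>.
            ereal (cmod (fourier (\<rho> t) l \<xi>) * exp (a * (\<xi> + t * of_int l / 2))))
          \<le> ereal (1 + c1) * initial_norm a \<rho>_in"
      unfolding r(1) by (intro SUP_least) (use mode in auto)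
    obtain M where M: "r < M" "M < 2 * \<delta>" using dense[of r "2 * \<delta>"] r(3) \<delta> by auto
    have "eventually (\<lambda>t. cmod (order_parameter (\<rho> t)) \<le> 4 * C * M * cmod (of_real (exp (- a * t)))) at_top"
      using eventually_ge_at_top[of 0]
      by eventually_elim
         (use mode_hierarchy.order_decay[OF mh[OF M] small[OF M]] in \<open>simp add: order_parameter_eq_fourier\<close>)
    then show "(\<lambda>t. order_parameter (\<rho> t)) \<in> O(\<lambda>t. of_real (exp (- a * t)))"
      by (rule bigoI)
  qed
qed

end
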